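(* Let $k\ge0$ be an integer, regard $n$ as an indeterminate, and let $G_{kn}$ be the Gram matrix associated to $B_n$. Then $$\det(G_{kn})=n^{a_k}\prod_{|\lambda|\le k/2}f_n(\lambda)^{\binom{k}{2|\lambda|}f^{2\lambda}},$$ where the product is over all Young diagrams $\lambda$ with at most $k/2$ boxes, $a_k=\sum_{\pi\in\mathcal P_b(k)}(2|\pi|-k)$, and $f_n(\lambda)=\prod_{(i,j)\in\lambda}(n+2j-i-2)$.
   Context: Let $\mathcal P_b(k)$ be the set of all set partitions of $\{1,\dots,k\}$ with all blocks of size 1 or 2 (singletons and pairings, crossings allowed). The Gram matrix associated to $B_n$ is $G_{kn}=(n^{|\pi\vee\sigma|})_{\pi,\sigma\in\mathcal P_b(k)}$, where $\pi\vee\sigma$ is the join in the lattice of all set partitions of $\{1,\dots,k\}$ and $|\cdot|$ is the number of blocks. For a Young diagram $\lambda$, $|\lambda|$ is its number of boxes, $(i,j)\in\lambda$ means the box in row $i$ and column $j$ (starting from $1$), $f^\lambda$ is the number of standard Young tableaux of shape $\lambda$ (with $f^\emptyset=1$), and $2\lambda$ is the diagram obtained by doubling the length of each row of $\lambda$. *)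

theory Defs
  imports
    "HOL-Library.Disjoint_Sets"
    "HOL-Library.FuncSet"
    "HOL-Computational_Algebra.Polynomial"
    "Jordan_Normal_Form.Determinant"
begin

definition P_b :: "nat \<Rightarrow> nat set set set" where
  "P_b k = {\<pi>. partition_on {1..k} \<pi> \<and> (\<forall>b\<in>\<pi>. card b = 1 \<or> card b = 2)}"

lemma finite_P_b: "finite (P_b k)"
proof (rule finite_subset)
  show "P_b k \<subseteq> Pow (Pow {1..k})"
    by (auto simp: P_b_def partition_on_def)
qed simp

lemma P_b_le_card:
  assumes "\<pi> \<in> P_b k"
  shows "k \<le> 2 * card \<pi>"
proof -
  have p: "partition_on {1..k} \<pi>" and b: "\<And>b. b \<in> \<pi> \<Longrightarrow> card b \<le> 2"
    using assms by (auto simp: P_b_def)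
  have "k = card (\<Union>\<pi>)"
    using partition_onD1[OF p] by (metis card_atLeastAtMost diff_Suc_1)
  also have "\<dots> \<le> (\<Sum>b\<in>\<pi>. card b)"
    by (rule card_Union_le_sum_card)
  also have "\<dots> \<le> (\<Sum>b\<in>\<pi>. 2)"
    by (rule sum_mono) (rule b)
  finally show ?thesis by simp
qed

text \<open>The least upper bound for refinement order; \<open>partition_join_lub\<close> shows that it exists.\<close>

definition partition_join :: "'a set \<Rightarrow> 'a set set \<Rightarrow> 'a set set \<Rightarrow> 'a set set" where
  "partition_join A P Q = (THE R. refines A P R \<and> refines A Q R \<and>
      (\<forall>S. refines A P S \<and> refines A Q S \<longrightarrow> refines A R S))"

lemma ex1_partition_join:
  assumes P: "partition_on A P" and Q: "partition_on A Q"
  shows "\<exists>!R. refines A P R \<and> refines A Q R \<and>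
      (\<forall>S. refines A P S \<and> refines A Q S \<longrightarrow> refines A R S)"
proof -
  let ?rel = "\<lambda>P. {(x, y). \<exists>p\<in>P. x \<in> p \<and> y \<in> p}"
  define r where "r = (?rel P \<union> ?rel Q)\<^sup>+"
  have eP: "equiv A (?rel P)" and eQ: "equiv A (?rel Q)"
    using equiv_partition_on P Q by auto
  have sub: "?rel P \<union> ?rel Q \<subseteq> A \<times> A"
    using eP eQ by (auto simp: equiv_def refl_on_def)
  have r_sub: "r \<subseteq> A \<times> A"
    unfolding r_def using sub by (rule trancl_subset_Sigma)
  have "equiv A r"
  proof (rule equivI)
    show "r \<subseteq> A \<times> A" by (rule r_sub)
    show "refl_on A r"
      using eP unfolding r_def equiv_def refl_on_def by (meson UnI1 r_into_trancl')
    show "sym r"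
      unfolding r_def by (rule sym_trancl) (auto simp: sym_def)
    show "trans r"
      unfolding r_def by (rule trans_trancl)
  qed
  then have pr: "partition_on A (A // r)"
    by (rule partition_on_quotient)
  have up: "refines A X (A // r)" if X: "partition_on A X" and sX: "?rel X \<subseteq> r" for X
    unfolding refines_def
  proof (intro conjI X pr ballI)
    fix p assume p: "p \<in> X"
    then have "p \<noteq> {}" "p \<subseteq> A"
      using X unfolding partition_on_def by blast+
    then obtain x where x: "x \<in> p" "x \<in> A" by blast
    have "p \<subseteq> r `` {x}"
    proof
      fix y assume "y \<in> p"
      then have "(x, y) \<in> ?rel X" using p x(1) by blast
      then show "y \<in> r `` {x}" using sX by blast
    qed
    then show "\<exists>Y\<in>A // r. p \<subseteq> Y" using quotientI[OF x(2)] by (rule bexI)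
  qed
  have PQ: "refines A P (A // r)" "refines A Q (A // r)"
  proof -
    have "?rel P \<union> ?rel Q \<subseteq> r" unfolding r_def by (rule subsetI, erule r_into_trancl')
    then show "refines A P (A // r)" "refines A Q (A // r)"
      using up[OF P] up[OF Q] by simp_all
  qed
  have least: "refines A (A // r) S" if S: "refines A P S" "refines A Q S" for S
  proof -
    have pS: "partition_on A S" using S by (simp add: refines_def)
    have mono: "?rel X \<subseteq> ?rel S" if X: "refines A X S" for X
    proof clarify
      fix x y p assume p: "p \<in> X" "x \<in> p" "y \<in> p"
      then obtain s where "s \<in> S" "p \<subseteq> s" using X unfolding refines_def by blast
      then show "\<exists>s\<in>S. x \<in> s \<and> y \<in> s" using p by blast
    qed
    have PQS: "?rel P \<union> ?rel Q \<subseteq> ?rel S"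
      using mono[OF S(1)] mono[OF S(2)] by (rule Un_least)
    have tS: "trans (?rel S)"
      using equiv_partition_on[OF pS] unfolding equiv_def by (elim conjE)
    have "r \<subseteq> (?rel S)\<^sup>+"
      unfolding r_def by (rule subsetI, erule trancl_mono, rule PQS)
    then have rS: "r \<subseteq> ?rel S"
      unfolding trancl_id[OF tS] .
    show ?thesis
      unfolding refines_def
    proof (intro conjI pr pS ballI)
      fix X assume "X \<in> A // r"
      then obtain x where x: "x \<in> A" "X = r `` {x}" by (rule quotientE)
      then obtain s where s: "s \<in> S" "x \<in> s" using pS by (auto simp: partition_on_def)
      have "X \<subseteq> s"
      proof
        fix y assume "y \<in> X"
        then have "(x, y) \<in> ?rel S" using x rS by auto
        then obtain t where t: "t \<in> S" "x \<in> t" "y \<in> t" by auto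
        then have "t = s" using s pS by (auto simp: partition_on_def disjoint_def)
        then show "y \<in> s" using t by simp
      qed
      then show "\<exists>Y\<in>S. X \<subseteq> Y" using s by blast
    qed
  qed
  show ?thesis
  proof (rule ex1I[of _ "A // r"])
    show "refines A P (A // r) \<and> refines A Q (A // r) \<and>
        (\<forall>S. refines A P S \<and> refines A Q S \<longrightarrow> refines A (A // r) S)"
      using PQ least by blast
  next
    fix R assume "refines A P R \<and> refines A Q R \<and>
        (\<forall>S. refines A P S \<and> refines A Q S \<longrightarrow> refines A R S)"
    then show "R = A // r" using PQ least refines_asym by metis
  qed
qed

lemma partition_join_lub:
  assumes "partition_on A P" "partition_on A Q"
  shows "refines A P (partition_join A P Q)" "refines A Q (partition_join A P Q)"
    and "refines A P S \<Longrightarrow> refines A Q S \<Longrightarrow> refines A (partition_join A P Q) S"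
  using theI'[OF ex1_partition_join[OF assms]] unfolding partition_join_def by blast+

text \<open>
  Matrices have index set \<open>{0..<N}\<close>, so the index set \<open>P_b k\<close> is given by an
  enumeration \<open>\<pi>s\<close> of its elements.
\<close>

definition gram_mat :: "nat \<Rightarrow> nat set set list \<Rightarrow> 'a::comm_ring_1 \<Rightarrow> 'a mat" where
  "gram_mat k \<pi>s n = mat (length \<pi>s) (length \<pi>s)
     (\<lambda>(i, j). n ^ card (partition_join {1..k} (\<pi>s ! i) (\<pi>s ! j)))"

text \<open>The subtraction does not truncate, by \<open>P_b_le_card\<close>.\<close>

definition a_exp :: "nat \<Rightarrow> nat" where
  "a_exp k = (\<Sum>\<pi>\<in>P_b k. 2 * card \<pi> - k)"

text \<open>
  A Young diagram is its set of boxes \<open>(i, j)\<close> (row, column), both coordinates starting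
  from 1; its number of boxes is \<open>card\<close>.
\<close>

definition young_diagram :: "(nat \<times> nat) set \<Rightarrow> bool" where
  "young_diagram l \<longleftrightarrow> finite l \<and> (\<forall>(i, j)\<in>l. 1 \<le> i \<and> 1 \<le> j \<and>
     (\<forall>i' j'. 1 \<le> i' \<and> i' \<le> i \<and> 1 \<le> j' \<and> j' \<le> j \<longrightarrow> (i', j') \<in> l))"

lemma finite_young_diagrams: "finite {l. young_diagram l \<and> 2 * card l \<le> k}"
proof (rule finite_subset)
  show "{l. young_diagram l \<and> 2 * card l \<le> k} \<subseteq> Pow ({1..k} \<times> {1..k})"
  proof clarsimp
    fix l i j assume l: "young_diagram l" "2 * card l \<le> k" and ij: "(i, j) \<in> l"
    have f: "finite l" and ge: "1 \<le> i" "1 \<le> j" and s: "{1..i} \<times> {1..j} \<subseteq> l"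
      using l(1) ij by (fastforce simp: young_diagram_def)+
    have "i * j \<le> card l" using card_mono[OF f s] by (simp add: card_cartesian_product)
    moreover have "i \<le> i * j" "j \<le> i * j" using ge by auto
    ultimately show "Suc 0 \<le> i \<and> i \<le> k \<and> Suc 0 \<le> j \<and> j \<le> k"
      using ge l(2) by linarith
  qed
qed simp

definition row_length :: "(nat \<times> nat) set \<Rightarrow> nat \<Rightarrow> nat" where
  "row_length l i = card {j. (i, j) \<in> l}"

definition double_rows :: "(nat \<times> nat) set \<Rightarrow> (nat \<times> nat) set" where
  "double_rows l = {(i, j). 1 \<le> j \<and> j \<le> 2 * row_length l i}"

text \<open>Tableaux are \<open>extensional\<close>, so that different values outside the shape are not counted.\<close>

definition standard_young_tableaux :: "(nat \<times> nat) set \<Rightarrow> (nat \<times> nat \<Rightarrow> nat) set" where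
  "standard_young_tableaux l = {T \<in> extensional l. bij_betw T l {1..card l} \<and>
     (\<forall>i j. (i, j) \<in> l \<and> (i, j + 1) \<in> l \<longrightarrow> T (i, j) < T (i, j + 1)) \<and>
     (\<forall>i j. (i, j) \<in> l \<and> (i + 1, j) \<in> l \<longrightarrow> T (i, j) < T (i + 1, j))}"

definition num_SYT :: "(nat \<times> nat) set \<Rightarrow> nat" where
  "num_SYT l = card (standard_young_tableaux l)"

lemma num_SYT_empty: "num_SYT {} = 1"
  by (simp add: num_SYT_def standard_young_tableaux_def bij_betw_def)

definition f_content :: "'a::comm_ring_1 \<Rightarrow> (nat \<times> nat) set \<Rightarrow> 'a" where
  "f_content n l = (\<Prod>(i, j)\<in>l. n + 2 * of_nat j - of_nat i - 2)"

end

theory Submission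
  imports Defs
begin

text \<open>
  Both sides are polynomials in \<open>n\<close>, so they may be compared at every positive integer \<open>n\<close>.
  There the entry for two partitions counts the colourings of \<open>{1..k}\<close> by \<open>n\<close> colours that are
  constant on the blocks of both (\<open>power_card_join\<close>). So the matrix is the Gram matrix, in the space
  of functions of a colouring \<open>f\<close>, of the products of the indicators \<open>[f x = f y]\<close> over the pairs
  \<open>{x, y}\<close> of a partition; a partition only enters through its matching of pairs.

  Replacing \<open>[f x = f y]\<close> by \<open>kappa = [f x = f y] - 1/n\<close> is a unitriangular change of basis, hence
  does not change the determinant. As \<open>kappa\<close> is the matrix of the orthogonal projection that
  removes the constant vectors, summing over a colour that occurs in one \<open>kappa\<close> only gives \<open>0\<close>.
  Therefore matchings with different supports become orthogonal, and on the matchings with support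
  \<open>A\<close> the matrix is \<open>n ^ (k - card A)\<close> times the Gram matrix of the pairings of \<open>A\<close> built from a
  projection of trace \<open>N = n - 1\<close>: this is the reduction from the bistochastic group to the
  orthogonal group in dimension \<open>n - 1\<close>.

  It remains to diagonalise the latter on the pairings of \<open>{1..2m}\<close>. It commutes with the
  symmetric group. Applied to the point mass at \<open>{{1,2},{3,4},...}\<close> it acts as the product of
  \<open>N + J\<close> over the Jucys-Murphy elements \<open>J\<close> of the odd points (\<open>gram_op_std\<close>), because summing out
  the colours of the last pair either gives the trace \<open>N\<close> or joins two pairs into one. For a
  diagram \<open>\<lambda>\<close> of size \<open>m\<close>, number the boxes of \<open>2\<lambda>\<close> row by row and let row sums and signed column
  sums act on this point mass. By the Garnir relations every \<open>J\<close> acts on a row sum of a column sum by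
  the content of its box, and the product above acts by the product of \<open>N + content\<close> over the odd
  points. These occupy the odd columns, so the result is an eigenvector with eigenvalue
  \<open>f_content n \<lambda>\<close> (\<open>row_tableau_vector\<close>). It is at the same time a joint eigenvector of the
  Jucys-Murphy elements, and Young's intertwiners move it to a joint eigenvector with the contents
  of any other standard tableau of shape \<open>2\<lambda>\<close>, keeping the eigenvalue (\<open>exists_tableau_vector\<close>).

  Tableaux are determined by their sequences of contents, so all these vectors are linearly
  independent. They form a basis since the numbers of standard tableaux of the shapes \<open>2\<lambda>\<close> add up
  to the number \<open>(2m-1)!!\<close> of pairings (\<open>card_pairings\<close>), a consequence of the commutation rule
  between adding and removing boxes. Collecting the eigenvectors for all supports \<open>A\<close>, the
  determinant is the product of the eigenvalues: a diagram \<open>\<lambda>\<close> occurs for the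
  \<open>k choose (2 * card \<lambda>)\<close> supports with \<open>2 * card \<lambda>\<close> points, and the exponents \<open>k - card A\<close> add up to
  \<open>a_exp k\<close>, because a partition with support \<open>A\<close> of its pairs has \<open>k - card A\<close> singletons.
\<close>

unbundle no m_inv_syntax

abbreviation tr :: "'a \<Rightarrow> 'a \<Rightarrow> 'a \<Rightarrow> 'a" where
  "tr \<equiv> Transposition.transpose"

section \<open>Garnir relations for row and column sums\<close>

lemma sum_eq_0_sign_reversing:
  fixes g :: "'a \<Rightarrow> real"
  assumes "\<And>x. x \<in> X \<Longrightarrow> \<theta> x \<in> X \<and> \<theta> (\<theta> x) = x \<and> g (\<theta> x) = - g x"
  shows "sum g X = 0"
proof -
  have "sum g X = (\<Sum>x\<in>X. g (\<theta> x))"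
    by (rule sum.reindex_bij_witness[of X \<theta> \<theta>]) (use assms in auto)
  also have "\<dots> = - sum g X"
    using assms by (simp add: sum_negf)
  finally show ?thesis by simp
qed

text \<open>
  A Young diagram is given by the coordinates of its labelled boxes. Keeping the set of labels
  fixed lets the row and column groups of all shapes act on the same pairings.
\<close>

locale labelled_diagram =
  fixes D :: "nat set" and row col :: "nat \<Rightarrow> nat"
  assumes finite_D: "finite D"
    and box_inj: "x \<in> D \<Longrightarrow> y \<in> D \<Longrightarrow> row x = row y \<Longrightarrow> col x = col y \<Longrightarrow> x = y"
    and box_closed: "x \<in> D \<Longrightarrow> 1 \<le> i \<Longrightarrow> i \<le> row x \<Longrightarrow> 1 \<le> j \<Longrightarrow> j \<le> col x \<Longrightarrow>
      \<exists>y\<in>D. row y = i \<and> col y = j"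
    and box_pos: "x \<in> D \<Longrightarrow> 1 \<le> row x \<and> 1 \<le> col x"
begin

definition preserving :: "(nat \<Rightarrow> nat) \<Rightarrow> (nat \<Rightarrow> nat) set" where
  "preserving h = {p. p permutes D \<and> (\<forall>x\<in>D. h (p x) = h x)}"

abbreviation row_group :: "(nat \<Rightarrow> nat) set" where
  "row_group \<equiv> preserving row"

abbreviation col_group :: "(nat \<Rightarrow> nat) set" where
  "col_group \<equiv> preserving col"

lemma finite_preserving: "finite (preserving h)"
  using finite_permutations[OF finite_D] by (auto simp: preserving_def intro: rev_finite_subset)

lemma preserving_permutes: "p \<in> preserving h \<Longrightarrow> p permutes D"
  by (auto simp: preserving_def)

lemma preserving_comp: "p \<in> preserving h \<Longrightarrow> p' \<in> preserving h \<Longrightarrow> p \<circ> p' \<in> preserving h"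
  by (auto simp: preserving_def permutes_compose permutes_in_image)

lemma preserving_inv: assumes "p \<in> preserving h" shows "inv p \<in> preserving h"
proof -
  have p: "p permutes D" and eq: "\<And>x. x \<in> D \<Longrightarrow> h (p x) = h x"
    using assms by (auto simp: preserving_def)
  have "h (inv p x) = h x" if "x \<in> D" for x
    using eq[of "inv p x"] that p by (simp add: permutes_inverses permutes_inv permutes_in_image)
  then show ?thesis using p by (simp add: preserving_def permutes_inv)
qed

lemma tr_preserving: "x \<in> D \<Longrightarrow> y \<in> D \<Longrightarrow> h x = h y \<Longrightarrow> tr x y \<in> preserving h"
  by (auto simp: preserving_def permutes_swap_id Transposition.transpose_def)

lemma id_preserving: "id \<in> preserving h"
  by (auto simp: preserving_def permutes_id)

lemma sum_preserving_right:
  "p \<in> preserving h \<Longrightarrow> (\<Sum>r\<in>preserving h. g (r \<circ> p)) = (\<Sum>r\<in>preserving h. g r)"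
  by (rule sum.reindex_bij_witness[of _ "\<lambda>r. r \<circ> inv p" "\<lambda>r. r \<circ> p"])
    (auto simp: preserving_comp preserving_inv comp_assoc permutes_inv_o[OF preserving_permutes])

lemma sum_preserving_inv: "(\<Sum>r\<in>preserving h. g (inv r)) = (\<Sum>r\<in>preserving h. g r)"
  by (rule sum.reindex_bij_witness[of _ inv inv])
    (auto simp: preserving_inv permutes_inv_inv[OF preserving_permutes])

lemma permutation_preserving: "p \<in> preserving h \<Longrightarrow> permutation p"
  using finite_D preserving_permutes permutation_permutes by blast

lemma column_sum_tr:
  fixes f :: "(nat \<Rightarrow> nat) \<Rightarrow> real"
  assumes "x \<in> D" "y \<in> D" "col x = col y" "x \<noteq> y"
  shows "(\<Sum>c\<in>col_group. of_int (sign c) * f (c \<circ> (tr x y \<circ> w))) = - (\<Sum>c\<in>col_group. of_int (sign c) * f (c \<circ> w))"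
proof -
  have t: "tr x y \<in> col_group" using assms by (intro tr_preserving)
  have "(\<Sum>c\<in>col_group. of_int (sign c) * f (c \<circ> w)) =
      (\<Sum>c\<in>col_group. of_int (sign (c \<circ> tr x y)) * f ((c \<circ> tr x y) \<circ> w))"
    by (rule sum_preserving_right[OF t, symmetric])
  also have "\<dots> = (\<Sum>c\<in>col_group. - (of_int (sign c) * f (c \<circ> (tr x y \<circ> w))))"
    by (rule sum.cong) (use t assms in \<open>auto simp: sign_compose[OF permutation_preserving permutation_preserving] sign_swap_id comp_assoc\<close>)
  finally show ?thesis by (simp add: sum_negf)
qed

text \<open>
  The classical argument: \<open>w = r \<circ> tr l k\<close> runs over the permutations that distribute row \<open>i0\<close>
  together with \<open>k\<close> onto row \<open>i0\<close> and one box \<open>z = r k\<close> of the row of \<open>k\<close>. Above \<open>z\<close> lies a box \<open>y\<close> of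
  row \<open>i0\<close>, because upper rows are at least as long. Replacing \<open>w\<close> by \<open>tr y z \<circ> w\<close> is an involution
  on these permutations, and it changes the sign of the signed column sum.
\<close>

lemma garnir_relation:
  fixes f :: "(nat \<Rightarrow> nat) \<Rightarrow> real"
  assumes k: "k \<in> D" and i0: "1 \<le> i0" "i0 < row k"
  shows "(\<Sum>l\<in>insert k {l\<in>D. row l = i0}. \<Sum>r\<in>row_group. \<Sum>c\<in>col_group. of_int (sign c) * f (c \<circ> (r \<circ> tr l k))) = 0"
proof -
  define Y where "Y = insert k {l\<in>D. row l = i0}"
  define F where "F = (\<lambda>w. \<Sum>c\<in>col_group. of_int (sign c) * f (c \<circ> w))"
  \<comment> \<open>the box of row \<open>i0\<close> in the column of \<open>z\<close>\<close>
  define opp where "opp = (\<lambda>z. SOME y. y \<in> D \<and> row y = i0 \<and> col y = col z)"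
  have YD: "Y \<subseteq> D" using k by (auto simp: Y_def)
  have opp: "opp z \<in> D \<and> row (opp z) = i0 \<and> col (opp z) = col z" if "z \<in> D" "row z = row k" for z
    unfolding opp_def
    by (rule someI_ex) (use box_closed[of z i0 "col z"] that i0 box_pos[of z] in auto)
  \<comment> \<open>the passage from \<open>w\<close> to \<open>tr y z \<circ> w\<close>, with \<open>l'\<close> the point that now goes to \<open>z\<close>\<close>
  define \<theta> where "\<theta> = (\<lambda>(l, r). let z = r k; y = opp z; w = r \<circ> tr l k; l' = inv w y
     in (l', tr y z \<circ> w \<circ> tr l' k))"
  have main: "\<theta> x \<in> Y \<times> row_group \<and> \<theta> (\<theta> x) = x \<and>
     (case \<theta> x of (l, r) \<Rightarrow> F (r \<circ> tr l k)) = - (case x of (l, r) \<Rightarrow> F (r \<circ> tr l k))"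
    if x: "x \<in> Y \<times> row_group" for x
  proof -
    obtain l r where x_eq: "x = (l, r)" and l: "l \<in> Y" and r: "r \<in> row_group" using x by auto
    have rp: "r permutes D" using r by (rule preserving_permutes)
    have lD: "l \<in> D" using l YD by auto
    define z where "z = r k"
    define y where "y = opp z"
    define w where "w = r \<circ> tr l k"
    define l' where "l' = inv w y"
    define r' where "r' = tr y z \<circ> w \<circ> tr l' k"
    have \<theta>x: "\<theta> x = (l', r')"
      by (simp add: \<theta>_def x_eq Let_def z_def y_def w_def l'_def r'_def)
    have zD: "z \<in> D" "row z = row k" using r k by (auto simp: z_def preserving_def permutes_in_image)
    have y: "y \<in> D" "row y = i0" "col y = col z" using opp[OF zD] by (auto simp: y_def)
    have yz: "y \<noteq> z" using y zD i0 by auto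
    have wp: "w permutes D"
      unfolding w_def using rp lD k by (intro permutes_compose) (auto simp: permutes_swap_id)
    have wl': "w l' = y" unfolding l'_def using wp by (simp add: permutes_inverses)
    have l'D: "l' \<in> D" using wl' y wp permutes_in_image[OF wp, of l'] by auto
    have wl: "w l = z" by (simp add: w_def z_def)
    have rowr: "\<And>u. u \<in> D \<Longrightarrow> row (r u) = row u" using r by (auto simp: preserving_def)
    have ll': "l \<noteq> l'" using wl wl' yz by auto
    have rowk: "row u = i0" if "u \<in> Y" "u \<noteq> k" for u using that by (auto simp: Y_def)
    have l'Y: "l' \<in> Y"
    proof (cases "l' = k")
      case False
      then have "w l' = r l'" using ll' by (simp add: w_def)
      then show ?thesis using wl' y rowr[OF l'D] l'D by (auto simp: Y_def)
    qed (simp add: Y_def)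
    have w_inj: "w u = w v \<Longrightarrow> u = v" for u v using permutes_inj[OF wp] by (auto dest: injD)
    have wrow: "row (w u) = row u" if "u \<in> D" "u \<noteq> k" "u \<noteq> l" for u
      using rowr[OF that(1)] that by (simp add: w_def)
    have r'row: "row (r' u) = row u" if u: "u \<in> D" for u
    proof -
      consider "u = k" | "u \<noteq> k" "u = l'" | "u \<noteq> k" "u \<noteq> l'" "u = l" | "u \<noteq> k" "u \<noteq> l'" "u \<noteq> l" by blast
      then show ?thesis
      proof cases
        case 1
        then show ?thesis using wl' zD by (simp add: r'_def)
      next
        case 2
        have "r' u = tr y z (w k)" using 2 by (simp add: r'_def)
        show ?thesis
        proof (cases "k = l")
          case True
          then have "r' u = y" using wl \<open>r' u = tr y z (w k)\<close> by simp
          then show ?thesis using y 2 rowk[OF l'Y] by simp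
        next
          case False
          have wk: "w k = r l" by (simp add: w_def)
          have "w k \<noteq> y" using w_inj[of k l'] wl' 2 by auto
          moreover have "w k \<noteq> z" using w_inj[of k l] wl False by auto
          ultimately have "r' u = r l" using \<open>r' u = tr y z (w k)\<close> wk by simp
          then show ?thesis using rowr[OF lD] rowk[OF l] False rowk[OF l'Y] 2 by simp
        qed
      next
        case 3
        then have "r' u = y" using wl by (simp add: r'_def)
        then show ?thesis using y 3 rowk[OF l] by simp
      next
        case 4
        have "w u \<noteq> y" using w_inj[of u l'] wl' 4 by auto
        moreover have "w u \<noteq> z" using w_inj[of u l] wl 4 by auto
        ultimately have "r' u = w u" using 4 by (simp add: r'_def)
        then show ?thesis using wrow[OF u] 4 by simp
      qed
    qed
    have r'p: "r' permutes D"
      unfolding r'_def using wp y zD l'D k by (intro permutes_compose) (auto simp: permutes_swap_id)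
    have r'R: "r' \<in> row_group" using r'p r'row by (auto simp: preserving_def)
    have w': "r' \<circ> tr l' k = tr y z \<circ> w" by (simp add: r'_def comp_assoc)
    have r'k: "r' k = z" using wl' by (simp add: r'_def)
    have inv': "inv (tr y z \<circ> w) y = l"
      using permutes_inj[OF wp] wl
      by (metis comp_apply inj_compose inj_on_transpose inv_f_f transpose_apply_second)
    have ww: "w \<circ> tr l k = r" by (simp add: w_def comp_assoc)
    have "\<theta> (l', r') = (l, tr y z \<circ> (tr y z \<circ> w) \<circ> tr l k)"
      by (simp add: \<theta>_def Let_def r'k y_def[symmetric] w' inv')
    also have "tr y z \<circ> (tr y z \<circ> w) \<circ> tr l k = r"
      using ww by (simp add: comp_assoc[symmetric])
    finally have inv2: "\<theta> (\<theta> x) = x" using \<theta>x x_eq by simp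
    have "F (r' \<circ> tr l' k) = - F w"
      unfolding w' F_def by (rule column_sum_tr) (use y zD yz in auto)
    then show ?thesis using inv2 \<theta>x x_eq l'Y r'R by (auto simp: w_def)
  qed
  have "(\<Sum>x\<in>Y \<times> row_group. case x of (l, r) \<Rightarrow> F (r \<circ> tr l k)) = 0"
    by (rule sum_eq_0_sign_reversing[where \<theta> = \<theta>]) (rule main)
  then have "(\<Sum>l\<in>Y. \<Sum>r\<in>row_group. F (r \<circ> tr l k)) = 0"
    by (simp add: sum.cartesian_product)
  then show ?thesis
    unfolding F_def Y_def .
qed

definition content :: "nat \<Rightarrow> real" where
  "content x = real (col x) - real (row x)"

text \<open>
  The points smaller than \<open>k\<close> are the full rows above \<open>k\<close>, each of which contributes \<open>-1\<close> by the Garnir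
  relation, and the points to the left of \<open>k\<close>, each of which contributes \<open>1\<close> since transposing within a
  row permutes the row group.
\<close>

lemma row_col_sum_jm:
  fixes f :: "(nat \<Rightarrow> nat) \<Rightarrow> real"
  assumes D: "D = {1..N}"
    and lex: "\<And>x y. x \<in> D \<Longrightarrow> y \<in> D \<Longrightarrow> x < y \<longleftrightarrow> row x < row y \<or> row x = row y \<and> col x < col y"
    and k: "k \<in> D"
  shows "(\<Sum>l\<in>{1..<k}. \<Sum>r\<in>row_group. \<Sum>c\<in>col_group. of_int (sign c) * f (c \<circ> (r \<circ> tr l k))) =
     content k * (\<Sum>r\<in>row_group. \<Sum>c\<in>col_group. of_int (sign c) * f (c \<circ> r))"
proof -
  define g where "g = (\<lambda>l. \<Sum>r\<in>row_group. \<Sum>c\<in>col_group. of_int (sign c) * f (c \<circ> (r \<circ> tr l k)))"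
  define S where "S = (\<Sum>r\<in>row_group. \<Sum>c\<in>col_group. of_int (sign c) * f (c \<circ> r))"
  let ?row = "\<lambda>i. {l\<in>D. row l = i}"
  have gk: "g k = S" by (simp add: g_def S_def)
  have same: "g l = S" if "l \<in> D" "row l = row k" for l
    unfolding g_def S_def
    using sum_preserving_right[OF tr_preserving[OF that(1) k that(2)], of "\<lambda>r. \<Sum>c\<in>col_group. of_int (sign c) * f (c \<circ> r)"]
    by simp
  have above: "sum g (?row i) = - S" if "1 \<le> i" "i < row k" for i
  proof -
    have "sum g (insert k (?row i)) = 0"
      unfolding g_def by (rule garnir_relation[OF k that])
    then show ?thesis using that finite_D gk by (simp add: sum.insert)
  qed
  have split: "{1..<k} = (\<Union>i\<in>{1..<row k}. ?row i) \<union> {l\<in>D. row l = row k \<and> col l < col k}"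
  proof (rule Set.set_eqI)
    fix l
    have "l \<in> {1..<k} \<longleftrightarrow> l \<in> D \<and> l < k" using k by (auto simp: D)
    also have "\<dots> \<longleftrightarrow> l \<in> D \<and> (row l < row k \<or> row l = row k \<and> col l < col k)" using lex k by blast
    also have "\<dots> \<longleftrightarrow> l \<in> (\<Union>i\<in>{1..<row k}. ?row i) \<union> {l\<in>D. row l = row k \<and> col l < col k}"
      using box_pos[of l] by auto
    finally show "l \<in> {1..<k} \<longleftrightarrow> l \<in> (\<Union>i\<in>{1..<row k}. ?row i) \<union> {l\<in>D. row l = row k \<and> col l < col k}" .
  qed
  have "card {l\<in>D. row l = row k \<and> col l < col k} = card {1..<col k}"
  proof (rule bij_betw_same_card[of col])
    show "bij_betw col {l\<in>D. row l = row k \<and> col l < col k} {1..<col k}"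
      unfolding bij_betw_def
    proof
      show "inj_on col {l\<in>D. row l = row k \<and> col l < col k}"
        by (rule inj_onI) (use box_inj in auto)
      have "\<exists>y\<in>D. row y = row k \<and> col y = j" if "1 \<le> j" "j < col k" for j
        using box_closed[of k "row k" j] k that box_pos[OF k] by auto
      then show "col ` {l\<in>D. row l = row k \<and> col l < col k} = {1..<col k}"
        using box_pos by (fastforce simp: image_iff)
    qed
  qed
  then have cardc: "card {l\<in>D. row l = row k \<and> col l < col k} = col k - 1" by simp
  have "sum g {1..<k} = sum g (\<Union>i\<in>{1..<row k}. ?row i) + sum g {l\<in>D. row l = row k \<and> col l < col k}"
    unfolding split by (rule sum.union_disjoint) (use finite_D in auto)
  also have "sum g (\<Union>i\<in>{1..<row k}. ?row i) = (\<Sum>i\<in>{1..<row k}. sum g (?row i))"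
    by (rule sum.UNION_disjoint) (use finite_D in auto)
  also have "\<dots> = - (real (row k) - 1) * S"
    using box_pos[OF k] by (simp add: above of_nat_diff algebra_simps)
  also have "sum g {l\<in>D. row l = row k \<and> col l < col k} = (real (col k) - 1) * S"
    using box_pos[OF k] cardc by (simp add: same of_nat_diff)
  finally show ?thesis by (simp add: g_def S_def content_def algebra_simps)
qed

end

section \<open>Pairings of a set\<close>

definition relabel :: "('a \<Rightarrow> 'b) \<Rightarrow> 'a set set \<Rightarrow> 'b set set" where
  "relabel w q = (\<lambda>b. w ` b) ` q"

lemma relabel_comp: "relabel (v \<circ> w) q = relabel v (relabel w q)"
  by (simp add: relabel_def image_image image_comp)

lemma relabel_relabel: "relabel v (relabel w q) = relabel (\<lambda>x. v (w x)) q"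
  by (simp add: relabel_def image_image)

lemma relabel_id [simp]: "relabel id q = q" "relabel (\<lambda>x. x) q = q"
  by (simp_all add: relabel_def)

lemma relabel_cong: "(\<And>x. x \<in> \<Union>q \<Longrightarrow> v x = w x) \<Longrightarrow> relabel v q = relabel w q"
  unfolding relabel_def by (intro image_cong refl) auto

definition pairings :: "'a set \<Rightarrow> 'a set set set" where
  "pairings A = {q. disjoint q \<and> (\<forall>b\<in>q. card b = 2) \<and> \<Union>q = A}"

lemma pairings_empty: "pairings {} = {{}}"
proof -
  have "q = {}" if "q \<in> pairings {}" for q :: "'a set set"
    using that by (fastforce simp: pairings_def)
  then show ?thesis by (auto simp: pairings_def)
qed

lemma finite_pairings: "finite A \<Longrightarrow> finite (pairings A)"
  by (rule finite_subset[of _ "Pow (Pow A)"]) (auto simp: pairings_def)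

lemma pairings_subset: "q \<in> pairings A \<Longrightarrow> b \<in> q \<Longrightarrow> b \<subseteq> A"
  by (auto simp: pairings_def)

lemma finite_pairing: "finite A \<Longrightarrow> q \<in> pairings A \<Longrightarrow> finite q"
  by (rule finite_subset[of _ "Pow A"]) (auto simp: pairings_def)

lemma pairings_block_eq: "q \<in> pairings A \<Longrightarrow> b \<in> q \<Longrightarrow> b' \<in> q \<Longrightarrow> x \<in> b \<Longrightarrow> x \<in> b' \<Longrightarrow> b = b'"
  by (auto simp: pairings_def disjoint_def)

lemma pairings_relabel:
  assumes w: "bij_betw w A B" and q: "q \<in> pairings A"
  shows "relabel w q \<in> pairings B"
proof -
  have inj: "inj_on w A" and im: "w ` A = B" using w by (auto simp: bij_betw_def)
  have sub: "b \<subseteq> A" if "b \<in> q" for b using pairings_subset[OF q that] .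
  have "disjoint (relabel w q)"
    unfolding disjoint_def relabel_def
  proof clarsimp
    fix b b' assume b: "b \<in> q" "b' \<in> q" "w ` b \<noteq> w ` b'"
    then have "b \<noteq> b'" by auto
    then have "b \<inter> b' = {}" using q b unfolding pairings_def disjoint_def by blast
    then show "w ` b \<inter> w ` b' = {}" using inj_on_image_Int[OF inj sub[OF b(1)] sub[OF b(2)]] by simp
  qed
  moreover have "card (w ` b) = 2" if "b \<in> q" for b
    using q that card_image[OF inj_on_subset[OF inj sub[OF that]]] by (simp add: pairings_def)
  moreover have "\<Union>(relabel w q) = B"
    using q im by (auto simp: pairings_def relabel_def)
  ultimately show ?thesis by (auto simp: pairings_def relabel_def)
qed

lemma relabel_inverse:
  assumes "bij_betw w A B" "\<Union>q \<subseteq> A"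
  shows "relabel (inv_into A w) (relabel w q) = q"
proof -
  have "relabel (inv_into A w) (relabel w q) = relabel (\<lambda>x. x) q"
    unfolding relabel_relabel using assms
    by (intro relabel_cong) (auto simp: bij_betw_def inv_into_f_f subset_iff)
  then show ?thesis by simp
qed

lemma pairings_relabel_iff:
  assumes w: "w permutes A"
  shows "relabel w q \<in> pairings A \<longleftrightarrow> q \<in> pairings A"
proof
  assume "relabel w q \<in> pairings A"
  then have "relabel (inv w) (relabel w q) \<in> pairings A"
    using permutes_imp_bij[OF permutes_inv[OF w]] by (rule pairings_relabel[rotated])
  then show "q \<in> pairings A"
    using permutes_inv_o[OF w] by (simp flip: relabel_comp)
qed (rule pairings_relabel[OF permutes_imp_bij[OF w]])

lemma relabel_inv:
  assumes "w permutes A"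
  shows "relabel (inv w) (relabel w q) = q" "relabel w (relabel (inv w) q) = q"
  using permutes_inv_o[OF assms] by (simp_all flip: relabel_comp)

lemma pairings_insert:
  assumes "q \<in> pairings A" "u \<notin> A" "v \<notin> A" "u \<noteq> v"
  shows "insert {u, v} q \<in> pairings (insert u (insert v A))"
  using assms by (auto simp: pairings_def disjoint_def card_2_iff)

lemma pairings_remove:
  assumes q: "q \<in> pairings B" and e: "{u, v} \<in> q"
  shows "q - {{u, v}} \<in> pairings (B - {u, v})"
proof -
  have "{u, v} \<inter> b = {}" if "b \<in> q" "b \<noteq> {u, v}" for b
    using pairings_block_eq[OF q that(1) e] that(2) by auto
  then show ?thesis using q e by (fastforce simp: pairings_def disjoint_def)
qed

lemma pairings_partner:
  assumes q: "q \<in> pairings A" and x: "x \<in> A"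
  obtains y where "y \<in> A" "y \<noteq> x" "{x, y} \<in> q" "\<And>z. {x, z} \<in> q \<Longrightarrow> z = y"
proof -
  obtain b where b: "b \<in> q" "x \<in> b" using q x by (auto simp: pairings_def)
  have "card b = 2" using q b by (auto simp: pairings_def)
  then obtain y where y: "b = {x, y}" "y \<noteq> x"
    using b(2) by (metis card_2_iff doubleton_eq_iff insertE singletonD)
  show ?thesis
  proof (rule that[of y])
    show "y \<in> A" using pairings_subset[OF q b(1)] y by auto
    show "y \<noteq> x" "{x, y} \<in> q" using y b by auto
    fix z assume "{x, z} \<in> q"
    then have "{x, z} = {x, y}" using pairings_block_eq[OF q, of "{x,z}" "{x,y}" x] b y by auto
    then show "z = y" using y by (auto simp: doubleton_eq_iff)
  qed
qed

section \<open>The Gram kernel of a projection\<close>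

text \<open>
  For \<open>s = {x, y}\<close> this is the \<open>(x, y)\<close> entry of the projection orthogonal to the constant vectors
  of length \<open>n\<close>. A function of the set of colours needs no ordering of the two end points of a pair.
\<close>

definition kappa :: "nat \<Rightarrow> nat set \<Rightarrow> real" where
  "kappa n s = (if card s = 1 then 1 else 0) - 1 / real n"

definition weight :: "nat \<Rightarrow> 'a set set \<Rightarrow> ('a \<Rightarrow> nat) \<Rightarrow> real" where
  "weight n q f = (\<Prod>b\<in>q. kappa n (f ` b))"

definition gram_kernel :: "nat \<Rightarrow> 'a set \<Rightarrow> 'a set set \<Rightarrow> 'a set set \<Rightarrow> real" where
  "gram_kernel n A p q = (\<Sum>f\<in>A \<rightarrow>\<^sub>E {..<n}. weight n p f * weight n q f)"

lemma kappa_pair: "kappa n {x, y} = (if x = y then 1 else 0) - 1 / real n"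
  by (auto simp: kappa_def card_insert_if)

lemma sum_kappa:
  assumes "x < n"
  shows "(\<Sum>y<n. kappa n {x, y}) = 0"
  using assms by (simp add: kappa_pair sum_subtractf)

lemma kappa_idem:
  assumes "x < n" "z < n"
  shows "(\<Sum>y<n. kappa n {x, y} * kappa n {y, z}) = kappa n {x, z}"
proof -
  have "(\<Sum>y<n. kappa n {x, y} * kappa n {y, z}) =
      (\<Sum>y<n. (if x = y then kappa n {y, z} else 0) - 1 / real n * kappa n {z, y})"
    by (intro sum.cong refl) (auto simp: kappa_pair algebra_simps)
  also have "\<dots> = kappa n {x, z}"
    using assms by (simp add: sum_subtractf sum_kappa flip: sum_distrib_left sum_divide_distrib)
  finally show ?thesis .
qed

lemma kappa_trace: "1 \<le> n \<Longrightarrow> (\<Sum>y<n. \<Sum>x<n. kappa n {x, y} * kappa n {x, y}) = real n - 1"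
proof -
  assume n: "1 \<le> n"
  have "(\<Sum>y<n. \<Sum>x<n. kappa n {x, y} * kappa n {x, y}) = (\<Sum>y<n. kappa n {y, y})"
  proof (rule sum.cong)
    fix y assume "y \<in> {..<n}"
    then show "(\<Sum>x<n. kappa n {x, y} * kappa n {x, y}) = kappa n {y, y}"
      using kappa_idem[of y n y] by (simp add: insert_commute)
  qed simp
  also have "\<dots> = real n - 1" using n by (simp add: kappa_def field_simps)
  finally show ?thesis .
qed

lemma sum_PiE_insert:
  assumes "x \<notin> A"
  shows "(\<Sum>f\<in>insert x A \<rightarrow>\<^sub>E Y. F f) = (\<Sum>f\<in>A \<rightarrow>\<^sub>E Y. \<Sum>y\<in>Y. F (f(x := y)))"
proof -
  have "(\<Sum>f\<in>insert x A \<rightarrow>\<^sub>E Y. F f) = (\<Sum>(y, f)\<in>Y \<times> (A \<rightarrow>\<^sub>E Y). F (f(x := y)))"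
    unfolding PiE_insert_eq
    by (subst sum.reindex[OF inj_combinator[OF assms]]) (auto intro!: sum.cong)
  also have "\<dots> = (\<Sum>f\<in>A \<rightarrow>\<^sub>E Y. \<Sum>y\<in>Y. F (f(x := y)))"
    by (subst sum.swap) (simp add: sum.cartesian_product)
  finally show ?thesis .
qed

lemma weight_insert:
  "finite q \<Longrightarrow> b \<notin> q \<Longrightarrow> weight n (insert b q) f = kappa n (f ` b) * weight n q f"
  by (simp add: weight_def)

lemma weight_cong:
  assumes "\<And>x. x \<in> \<Union>q \<Longrightarrow> f x = g x"
  shows "weight n q f = weight n q g"
  unfolding weight_def
proof (intro prod.cong refl arg_cong[of _ _ "kappa n"])
  fix b assume "b \<in> q" then show "f ` b = g ` b" using assms by (intro image_cong) auto
qed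

lemma weight_upd: "x \<notin> \<Union>q \<Longrightarrow> weight n q (f(x := y)) = weight n q f"
  by (rule weight_cong) auto

lemma weight_relabel:
  assumes "inj_on w A" "\<Union>q \<subseteq> A"
  shows "weight n (relabel w q) f = weight n q (f \<circ> w)"
proof -
  have "inj_on ((`) w) q"
    by (rule inj_on_subset[OF inj_on_image_Pow[OF assms(1)]]) (use assms in auto)
  then show ?thesis unfolding weight_def relabel_def
    by (subst prod.reindex) (simp_all add: image_comp)
qed

lemma gram_kernel_relabel:
  assumes w: "bij_betw w A B" and p: "\<Union>p \<subseteq> A" and q: "\<Union>q \<subseteq> A"
  shows "gram_kernel n B (relabel w p) (relabel w q) = gram_kernel n A p q"
proof -
  have inj: "inj_on w A" and im: "w ` A = B" using w by (auto simp: bij_betw_def)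
  have wt: "weight n (relabel w q) f = weight n q (restrict (f \<circ> w) A)" if "\<Union>q \<subseteq> A" for q f
    unfolding weight_relabel[OF inj that] by (rule weight_cong) (use that in auto)
  show ?thesis
    unfolding gram_kernel_def
  proof (rule sum.reindex_bij_witness[of _ "\<lambda>g. restrict (g \<circ> inv_into A w) B" "\<lambda>f. restrict (f \<circ> w) A"])
    fix f assume f: "f \<in> B \<rightarrow>\<^sub>E {..<n}"
    show "restrict (restrict (f \<circ> w) A \<circ> inv_into A w) B = f"
      using f im by (auto simp: fun_eq_iff restrict_def PiE_def extensional_def inv_into_into f_inv_into_f)
    show "restrict (f \<circ> w) A \<in> A \<rightarrow>\<^sub>E {..<n}" using f im by fastforce
    show "weight n p (restrict (f \<circ> w) A) * weight n q (restrict (f \<circ> w) A) =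
         weight n (relabel w p) f * weight n (relabel w q) f"
      by (simp add: wt p q)
  next
    fix g assume g: "g \<in> A \<rightarrow>\<^sub>E {..<n}"
    show "restrict (restrict (g \<circ> inv_into A w) B \<circ> w) A = g"
      using g im inj by (auto simp: fun_eq_iff restrict_def PiE_def extensional_def inv_into_f_f)
    show "restrict (g \<circ> inv_into A w) B \<in> B \<rightarrow>\<^sub>E {..<n}"
      using g im by (auto simp: PiE_def Pi_def inv_into_into)
  qed
qed

text \<open>
  A pair that is common to both pairings is a closed loop, whose sum is the trace of the projection.
\<close>

lemma gram_kernel_pair:
  assumes n: "1 \<le> n" and u: "u \<notin> A" and v: "v \<notin> A" and uv: "u \<noteq> v"
    and p: "finite p" "\<Union>p \<subseteq> A" and q: "finite q" "\<Union>q \<subseteq> A"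
  shows "gram_kernel n (insert u (insert v A)) (insert {u, v} p) (insert {u, v} q) =
    (real n - 1) * gram_kernel n A p q"
proof -
  have new: "{u, v} \<notin> p" "{u, v} \<notin> q" using u p q by auto
  have up: "weight n s (f(v := y, u := x)) = weight n s f" if "\<Union>s \<subseteq> A" for s f x y
    by (rule weight_cong) (use that u v in auto)
  have "gram_kernel n (insert u (insert v A)) (insert {u, v} p) (insert {u, v} q) =
    (\<Sum>f\<in>A \<rightarrow>\<^sub>E {..<n}. \<Sum>y<n. \<Sum>x<n. (kappa n {x, y} * kappa n {x, y}) * (weight n p f * weight n q f))"
    unfolding gram_kernel_def
    using u v uv
    by (simp add: sum_PiE_insert weight_insert p q new up mult_ac)
  also have "\<dots> = (\<Sum>f\<in>A \<rightarrow>\<^sub>E {..<n}. (real n - 1) * (weight n p f * weight n q f))"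
    by (simp only: kappa_trace[OF n] flip: sum_distrib_right)
  finally show ?thesis by (simp add: gram_kernel_def sum_distrib_left)
qed

text \<open>
  Summing over the colours of \<open>u\<close> and \<open>v\<close> multiplies three copies of the projection along the path
  \<open>l, v, u, a\<close>; by idempotency a single factor for \<open>{l, a}\<close> is left.
\<close>

lemma gram_kernel_merge:
  assumes u: "u \<notin> A" and v: "v \<notin> A" and uv: "u \<noteq> v"
    and p: "finite p" "\<Union>p \<subseteq> A" and q: "finite q" "\<Union>q \<subseteq> A" and la: "{l, a} \<in> q" "l \<noteq> a"
  shows "gram_kernel n (insert u (insert v A)) (insert {l, v} (insert {u, a} (q - {{l, a}}))) (insert {u, v} p) =
    gram_kernel n A q p"
proof -
  define q' where "q' = q - {{l, a}}"
  have q': "finite q'" "\<Union>q' \<subseteq> A" "{l, a} \<notin> q'" "q = insert {l, a} q'"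
    using q la by (auto simp: q'_def)
  have lA: "l \<in> A" "a \<in> A" using q la by auto
  have new: "{u, v} \<notin> p" "{l, v} \<notin> insert {u, a} q'" "{u, a} \<notin> q'"
    using u v uv p q' lA la(2) by (auto simp: doubleton_eq_iff)
  have up: "weight n s (f(v := y, u := x)) = weight n s f" if "\<Union>s \<subseteq> A" for s f x y
    by (rule weight_cong) (use that u v in auto)
  have ne: "l \<noteq> u" "l \<noteq> v" "a \<noteq> u" "a \<noteq> v" using lA u v by auto
  have two: "weight n (insert {l, v} (insert {u, a} q')) g =
      kappa n (g ` {l, v}) * (kappa n (g ` {u, a}) * weight n q' g)" for g
    using q'(1) by (simp only: weight_insert new finite_insert simp_thms)
  have sumk: "(\<Sum>y<n. \<Sum>x<n. kappa n {f l, y} * (kappa n {x, f a} * kappa n {x, y})) = kappa n {f l, f a}"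
    if f: "f \<in> A \<rightarrow>\<^sub>E {..<n}" for f
  proof -
    have b: "f l < n" "f a < n" using f lA by auto
    have "(\<Sum>y<n. \<Sum>x<n. kappa n {f l, y} * (kappa n {x, f a} * kappa n {x, y})) =
        (\<Sum>y<n. kappa n {f l, y} * (\<Sum>x<n. kappa n {y, x} * kappa n {x, f a}))"
      by (simp add: sum_distrib_left mult_ac insert_commute)
    also have "\<dots> = (\<Sum>y<n. kappa n {f l, y} * kappa n {y, f a})"
      using b by (simp add: kappa_idem)
    finally show ?thesis using b by (simp add: kappa_idem)
  qed
  have "gram_kernel n (insert u (insert v A)) (insert {l, v} (insert {u, a} q')) (insert {u, v} p) =
    (\<Sum>f\<in>A \<rightarrow>\<^sub>E {..<n}. \<Sum>y<n. \<Sum>x<n.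
       (kappa n {f l, y} * (kappa n {x, f a} * kappa n {x, y})) * (weight n q' f * weight n p f))"
    unfolding gram_kernel_def
    using u v uv ne
    by (simp add: sum_PiE_insert weight_insert[OF p(1) new(1)] two p q' up mult_ac)
  also have "\<dots> = (\<Sum>f\<in>A \<rightarrow>\<^sub>E {..<n}. kappa n {f l, f a} * (weight n q' f * weight n p f))"
    by (rule sum.cong) (simp_all only: sumk flip: sum_distrib_right)
  also have "\<dots> = gram_kernel n A q p"
    unfolding gram_kernel_def q'(4) by (simp add: weight_insert q' mult_ac)
  finally show ?thesis by (simp add: q'_def)
qed

section \<open>Jucys-Murphy factorisation of the Gram kernel\<close>

text \<open>
  The action of the Jucys-Murphy element, the sum of the transpositions \<open>(l k)\<close> with \<open>l < k\<close>, on
  functions of set systems. Permutations act from the right, \<open>\<phi>\<close> going to \<open>\<phi> \<circ> relabel w\<close>, so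
  an operator that is applied later stands further to the right in the group algebra.
\<close>

definition jm :: "nat \<Rightarrow> (nat set set \<Rightarrow> real) \<Rightarrow> nat set set \<Rightarrow> real" where
  "jm k \<phi> q = (\<Sum>l\<in>{1..<k}. \<phi> (relabel (tr l k) q))"

text \<open>
  Cutting off outside the pairings makes the commutation with permutations and the eigenvalue
  equations hold as equations of functions on all set systems.
\<close>

definition gram_op :: "nat \<Rightarrow> 'a set \<Rightarrow> ('a set set \<Rightarrow> real) \<Rightarrow> 'a set set \<Rightarrow> real" where
  "gram_op n A \<phi> q = (if q \<in> pairings A then \<Sum>p\<in>pairings A. gram_kernel n A q p * \<phi> p else 0)"

definition point_mass :: "'a \<Rightarrow> 'a \<Rightarrow> real" where
  "point_mass p q = (if q = p then 1 else 0)"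

primrec std_pairing :: "nat \<Rightarrow> nat set set" where
  "std_pairing 0 = {}"
| "std_pairing (Suc m) = insert {2 * m + 1, 2 * m + 2} (std_pairing m)"

primrec odd_jm_prod :: "real \<Rightarrow> nat \<Rightarrow> (nat set set \<Rightarrow> real) \<Rightarrow> nat set set \<Rightarrow> real" where
  "odd_jm_prod N 0 \<phi> = \<phi>"
| "odd_jm_prod N (Suc m) \<phi> = (\<lambda>q. N * odd_jm_prod N m \<phi> q + jm (2 * m + 1) (odd_jm_prod N m \<phi>) q)"

lemma atLeastAtMost_double_Suc: "{1..2 * Suc m} = insert (2 * m + 1) (insert (2 * m + 2) {1..2 * m})"
  by auto

lemma std_pairing_pairings: "std_pairing m \<in> pairings {1..2 * m}"
proof (induction m)
  case 0
  show ?case by (simp add: pairings_def)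
next
  case (Suc m)
  show ?case unfolding atLeastAtMost_double_Suc std_pairing.simps
    by (rule pairings_insert[OF Suc]) auto
qed

lemma gram_op_relabel:
  assumes w: "w permutes A"
  shows "gram_op n A (\<lambda>q. \<phi> (relabel w q)) q = gram_op n A \<phi> (relabel w q)"
proof (cases "q \<in> pairings A")
  case True
  have "(\<Sum>p\<in>pairings A. gram_kernel n A q p * \<phi> (relabel w p)) =
      (\<Sum>p\<in>pairings A. gram_kernel n A (relabel w q) p * \<phi> p)"
  proof (rule sum.reindex_bij_witness[of _ "relabel (inv w)" "relabel w"])
    fix p assume p: "p \<in> pairings A"
    show "relabel w p \<in> pairings A" using pairings_relabel_iff[OF w] p by blast
    show "gram_kernel n A (relabel w q) (relabel w p) * \<phi> (relabel w p) = gram_kernel n A q p * \<phi> (relabel w p)"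
      using gram_kernel_relabel[OF permutes_imp_bij[OF w], of q p] True p by (simp add: pairings_def)
  next
    fix p assume p: "p \<in> pairings A"
    show "relabel (inv w) p \<in> pairings A" using pairings_relabel_iff[OF permutes_inv[OF w]] p by blast
  qed (simp_all add: relabel_inv[OF w])
  then show ?thesis using True pairings_relabel_iff[OF w, of q] by (simp add: gram_op_def)
next
  case False
  then show ?thesis using pairings_relabel_iff[OF w, of q] by (simp add: gram_op_def)
qed

lemma gram_op_point_mass:
  assumes "finite A" "p \<in> pairings A"
  shows "gram_op n A (point_mass p) q = (if q \<in> pairings A then gram_kernel n A q p else 0)"
  using assms finite_pairings[OF assms(1)] by (simp add: gram_op_def point_mass_def if_distrib cong: if_cong)

text \<open>
  Embeds functions on the pairings of \<open>{1..2m}\<close> into those on the pairings of \<open>{1..2m+2}\<close>,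
  supported on the pairings that contain the last pair.
\<close>

definition adjoin_pair :: "nat \<Rightarrow> (nat set set \<Rightarrow> real) \<Rightarrow> nat set set \<Rightarrow> real" where
  "adjoin_pair m \<phi> q = (let e = {2 * m + 1, 2 * m + 2} in if e \<in> q then \<phi> (q - {e}) else 0)"

lemma relabel_tr_involutory: "relabel (tr a b) (relabel (tr a b) q) = q"
  by (simp add: relabel_relabel)

lemma mem_relabel_tr: "b \<in> relabel (tr x y) q \<longleftrightarrow> tr x y ` b \<in> q"
proof
  assume "b \<in> relabel (tr x y) q"
  then show "tr x y ` b \<in> q" by (auto simp: relabel_def image_image)
next
  assume "tr x y ` b \<in> q"
  then have "tr x y ` tr x y ` b \<in> relabel (tr x y) q" unfolding relabel_def by (rule imageI)
  then show "b \<in> relabel (tr x y) q" by (simp add: image_image)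
qed

lemma relabel_tr_diff:
  assumes "tr x y ` e = e"
  shows "relabel (tr x y) q - {e} = relabel (tr x y) (q - {e})"
proof (rule Set.set_eqI)
  fix b
  have "tr x y ` (tr x y ` c) = c" for c by (simp add: image_image)
  then have "tr x y ` b = e \<longleftrightarrow> b = e"
    using assms by metis
  then show "b \<in> relabel (tr x y) q - {e} \<longleftrightarrow> b \<in> relabel (tr x y) (q - {e})"
    by (auto simp: mem_relabel_tr)
qed

lemma jm_adjoin_pair:
  assumes "k \<le> 2 * m"
  shows "jm k (adjoin_pair m \<phi>) = adjoin_pair m (jm k \<phi>)"
proof
  fix q
  define e where "e = {2 * m + 1, 2 * m + 2}"
  have fix_e: "tr l k ` e = e" if "l \<in> {1..<k}" for l
    using that assms by (simp add: e_def)
  show "jm k (adjoin_pair m \<phi>) q = adjoin_pair m (jm k \<phi>) q"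
    unfolding jm_def adjoin_pair_def Let_def e_def[symmetric]
    by (auto simp: mem_relabel_tr fix_e relabel_tr_diff intro!: sum.cong sum.neutral)
qed

lemma odd_jm_adjoin_pair: "j \<le> m \<Longrightarrow> odd_jm_prod N j (adjoin_pair m \<phi>) = adjoin_pair m (odd_jm_prod N j \<phi>)"
proof (induction j)
  case (Suc j)
  have IH: "odd_jm_prod N j (adjoin_pair m \<phi>) = adjoin_pair m (odd_jm_prod N j \<phi>)" using Suc by simp
  have "2 * j + 1 \<le> 2 * m" using Suc by simp
  then show ?case
    by (auto simp: fun_eq_iff IH jm_adjoin_pair) (auto simp: adjoin_pair_def Let_def)
qed simp

lemma point_mass_adjoin: "point_mass (std_pairing (Suc m)) = adjoin_pair m (point_mass (std_pairing m))"
proof -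
  have "{2 * m + 1, 2 * m + 2} \<notin> std_pairing m"
    using std_pairing_pairings[of m] pairings_subset[of "std_pairing m" "{1..2*m}" "{2 * m + 1, 2 * m + 2}"] by auto
  then show ?thesis
    by (auto simp: fun_eq_iff point_mass_def adjoin_pair_def Let_def)
qed

text \<open>
  In a pairing \<open>q\<close> the last point \<open>v\<close> has a unique partner \<open>l\<close>. If \<open>l\<close> is its neighbour \<open>u\<close>, the kernel
  splits off a loop, and no transposition \<open>(x u)\<close> keeps the pair \<open>{u, v}\<close>. Otherwise \<open>(l u)\<close> is
  the only transposition that produces this pair, and the remaining pairing is the one that
  summing out \<open>u\<close> and \<open>v\<close> leaves behind.
\<close>

lemma gram_op_std_step:
  assumes n: "1 \<le> n"
  defines "\<chi> \<equiv> \<lambda>m. gram_op n {1..2 * m} (point_mass (std_pairing m))"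
  shows "\<chi> (Suc m) q = (real n - 1) * adjoin_pair m (\<chi> m) q + jm (2 * m + 1) (adjoin_pair m (\<chi> m)) q"
proof -
  define u v where "u = 2 * m + 1" and "v = 2 * m + 2"
  define A where "A = {1..2 * m}"
  define B where "B = {1..2 * Suc m}"
  define P where "P = std_pairing m"
  define e where "e = {u, v}"
  have B: "B = insert u (insert v A)" unfolding B_def A_def u_def v_def by (rule atLeastAtMost_double_Suc)
  have uv: "u \<notin> A" "v \<notin> A" "u \<noteq> v" by (auto simp: u_def v_def A_def)
  have finA: "finite A" "finite B" by (auto simp: A_def B_def)
  have P: "P \<in> pairings A" unfolding P_def A_def by (rule std_pairing_pairings)
  have P': "finite P" "\<Union>P \<subseteq> A" using P finite_pairing[OF finA(1)] by (auto simp: pairings_def)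
  have PS: "std_pairing (Suc m) = insert e P" by (simp add: P_def e_def u_def v_def)
  have \<chi>m: "\<chi> m q = (if q \<in> pairings A then gram_kernel n A q P else 0)" for q
    unfolding \<chi>_def P_def A_def by (rule gram_op_point_mass) (rule finite_atLeastAtMost, rule std_pairing_pairings)
  have \<chi>S: "\<chi> (Suc m) q = (if q \<in> pairings B then gram_kernel n B q (insert e P) else 0)" for q
    unfolding \<chi>_def B_def PS[symmetric] by (rule gram_op_point_mass) (rule finite_atLeastAtMost, rule std_pairing_pairings)
  have lift: "adjoin_pair m (\<chi> m) q = (if e \<in> q then \<chi> m (q - {e}) else 0)" for q
    by (simp add: adjoin_pair_def Let_def e_def u_def v_def)
  have lift_supp: "q \<in> pairings B" if "adjoin_pair m (\<chi> m) q \<noteq> 0" for q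
  proof -
    have e: "e \<in> q" and qe: "q - {e} \<in> pairings A" using that by (auto simp: lift \<chi>m split: if_splits)
    have "insert {u, v} (q - {e}) \<in> pairings B" unfolding B using qe uv by (rule pairings_insert)
    then show ?thesis using e by (simp add: e_def insert_absorb)
  qed
  have jm: "jm (2 * m + 1) (adjoin_pair m (\<chi> m)) q = (\<Sum>l\<in>{1..<u}. adjoin_pair m (\<chi> m) (relabel (tr l u) q))"
    by (simp add: jm_def u_def)
  have perm: "tr l u permutes B" if "l \<in> {1..<u}" for l
    using that by (intro permutes_swap_id) (auto simp: B_def u_def)
  show ?thesis
  proof (cases "q \<in> pairings B")
    case False
    then have "adjoin_pair m (\<chi> m) q = 0" using lift_supp by blast
    moreover have "adjoin_pair m (\<chi> m) (relabel (tr l u) q) = 0" if "l \<in> {1..<u}" for l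
      using lift_supp pairings_relabel_iff[OF perm[OF that]] False by blast
    ultimately show ?thesis using False unfolding jm by (simp add: \<chi>S)
  next
    case q: True
    have vB: "v \<in> B" by (simp add: B)
    obtain l where l: "l \<in> B" "l \<noteq> v" "{v, l} \<in> q" and uniq: "\<And>z. {v, z} \<in> q \<Longrightarrow> z = l"
      using pairings_partner[OF q vB] by blast
    have e_tr: "e \<in> relabel (tr x u) q \<longleftrightarrow> {x, v} \<in> q" if "x \<in> {1..<u}" for x
    proof -
      have "x \<noteq> v" using that by (auto simp: u_def v_def)
      then have "tr x u ` e = {x, v}" using uv by (simp add: e_def)
      then show ?thesis by (simp add: mem_relabel_tr)
    qed
    have e_l: "{x, v} \<in> q \<longleftrightarrow> x = l" for x using uniq[of x] l by (auto simp: insert_commute)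
    have BA: "B - {u, v} = A" using uv by (auto simp: B)
    show ?thesis
    proof (cases "l = u")
      case True
      have eq: "e \<in> q" using l True by (simp add: e_def insert_commute)
      have q': "q - {e} \<in> pairings A" using pairings_remove[OF q, of u v] eq by (simp add: e_def BA)
      have zero: "adjoin_pair m (\<chi> m) (relabel (tr x u) q) = 0" if "x \<in> {1..<u}" for x
        using e_tr[OF that] e_l[of x] that True by (auto simp: lift)
      have qe: "q = insert {u, v} (q - {e})" using eq by (auto simp: e_def)
      have "gram_kernel n B q (insert e P) = (real n - 1) * gram_kernel n A (q - {e}) P"
        unfolding B e_def
        apply (subst qe)
        using gram_kernel_pair[OF n uv, of "q - {e}" P] q' P' finite_pairing[OF finA(1) q']
        by (simp add: pairings_def e_def)
      moreover have Z: "(\<Sum>l\<in>{1..<u}. adjoin_pair m (\<chi> m) (relabel (tr l u) q)) = 0"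
        by (rule sum.neutral) (use zero in blast)
      ultimately show ?thesis using q q' eq unfolding jm Z by (simp add: \<chi>S lift \<chi>m)
    next
      case False
      have lA: "l \<in> A" using l False by (auto simp: B)
      have lu: "l \<in> {1..<u}" using lA by (auto simp: A_def u_def)
      have neq: "e \<notin> q" using e_l[of u] False by (simp add: e_def)
      define q' where "q' = relabel (tr l u) q - {e}"
      have eq': "e \<in> relabel (tr l u) q" using e_tr[OF lu] e_l by simp
      have rq: "relabel (tr l u) q \<in> pairings B" using pairings_relabel_iff[OF perm[OF lu]] q by blast
      have q': "q' \<in> pairings A" using pairings_remove[OF rq, of u v] eq' by (simp add: q'_def e_def BA)
      obtain a where a: "a \<in> A" "a \<noteq> l" "{l, a} \<in> q'" and "\<And>z. {l, z} \<in> q' \<Longrightarrow> z = a"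
        using pairings_partner[OF q' lA] by blast
      have q_eq: "q = insert {l, v} (insert {u, a} (q' - {{l, a}}))"
      proof -
        have "relabel (tr l u) q = insert e (insert {l, a} (q' - {{l, a}}))"
          using eq' a by (auto simp: q'_def)
        then have "q = relabel (tr l u) (insert e (insert {l, a} (q' - {{l, a}})))"
          using relabel_tr_involutory by metis
        also have "\<dots> = insert (tr l u ` e) (insert (tr l u ` {l, a}) (relabel (tr l u) (q' - {{l, a}})))"
          by (simp only: relabel_def image_insert)
        also have "tr l u ` e = {l, v}" using uv l by (simp add: e_def)
        also have "tr l u ` {l, a} = {u, a}"
        proof -
          have "a \<noteq> u" using a uv by auto
          then show ?thesis using a by simp
        qed
        also have "relabel (tr l u) (q' - {{l, a}}) = relabel (\<lambda>x. x) (q' - {{l, a}})"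
        proof (rule relabel_cong)
          fix x assume x: "x \<in> \<Union>(q' - {{l, a}})"
          then have "x \<in> A" using q' by (auto simp: pairings_def)
          moreover have "x \<noteq> l" using x pairings_block_eq[OF q' _ a(3)] by blast
          moreover have "x \<noteq> u" using \<open>x \<in> A\<close> uv by auto
          ultimately show "tr l u x = x" by simp
        qed
        finally show ?thesis by simp
      qed
      have "gram_kernel n B q (insert e P) = gram_kernel n A q' P"
        unfolding B e_def
        apply (subst q_eq)
        using gram_kernel_merge[OF uv P', of q' l a n] q' a finite_pairing[OF finA(1) q']
        by (simp add: pairings_def)
      moreover have T: "(\<Sum>x\<in>{1..<u}. adjoin_pair m (\<chi> m) (relabel (tr x u) q)) = (\<Sum>x\<in>{1..<u}. if x = l then gram_kernel n A q' P else 0)"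
      proof (rule sum.cong)
        fix x assume x: "x \<in> {1..<u}"
        show "adjoin_pair m (\<chi> m) (relabel (tr x u) q) = (if x = l then gram_kernel n A q' P else 0)"
          using e_tr[OF x] e_l[of x] q' by (auto simp: lift \<chi>m q'_def)
      qed simp
      ultimately show ?thesis using q neq lu unfolding jm T by (simp add: \<chi>S lift)
    qed
  qed
qed

text \<open>
  Iterating the step builds every pairing exactly once out of the standard one: this is the
  factorisation of the Gram matrix of the orthogonal group by odd Jucys-Murphy elements.
\<close>

lemma gram_op_std:
  assumes "1 \<le> n"
  shows "gram_op n {1..2 * m} (point_mass (std_pairing m)) = odd_jm_prod (real n - 1) m (point_mass (std_pairing m))"
proof (induction m)
  case 0
  show ?case
    by (auto simp: fun_eq_iff gram_op_def pairings_empty point_mass_def gram_kernel_def weight_def)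
next
  case (Suc m)
  have "odd_jm_prod (real n - 1) m (point_mass (std_pairing (Suc m))) =
      adjoin_pair m (gram_op n {1..2 * m} (point_mass (std_pairing m)))"
    by (simp only: point_mass_adjoin odd_jm_adjoin_pair[OF order_refl] Suc)
  then show ?case
    unfolding odd_jm_prod.simps by (intro ext) (simp only: gram_op_std_step[OF assms])
qed

section \<open>The Young symmetrizer as an eigenvector\<close>

lemma gram_op_linear:
  assumes "finite I"
  shows "gram_op n A (\<lambda>q. \<Sum>i\<in>I. a i * \<phi> i q) q = (\<Sum>i\<in>I. a i * gram_op n A (\<phi> i) q)"
proof -
  have "(\<Sum>p\<in>pairings A. gram_kernel n A q p * (\<Sum>i\<in>I. a i * \<phi> i p)) =
     (\<Sum>p\<in>pairings A. \<Sum>i\<in>I. a i * (gram_kernel n A q p * \<phi> i p))"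
    by (simp add: sum_distrib_left mult_ac)
  also have "\<dots> = (\<Sum>i\<in>I. a i * (\<Sum>p\<in>pairings A. gram_kernel n A q p * \<phi> i p))"
    by (subst sum.swap) (simp add: sum_distrib_left)
  finally show ?thesis by (simp add: gram_op_def)
qed

lemma mem_std_pairing: "b \<in> std_pairing m \<longleftrightarrow> (\<exists>i<m. b = {2 * i + 1, 2 * i + 2})"
  by (induction m) (auto simp: less_Suc_eq)

text \<open>
  Diagrams with rows of even length, numbered in reading order: then each pair of the standard
  pairing is a horizontal domino.
\<close>

locale domino_filling = labelled_diagram +
  fixes m :: nat
  assumes D_eq: "D = {1..2 * m}"
    and lex: "x \<in> D \<Longrightarrow> y \<in> D \<Longrightarrow> x < y \<longleftrightarrow> row x < row y \<or> row x = row y \<and> col x < col y"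
    and domino: "x \<in> D \<Longrightarrow> odd x \<Longrightarrow> row (x + 1) = row x \<and> col (x + 1) = col x + 1 \<and> odd (col x)"
begin

definition rowsum :: "(nat set set \<Rightarrow> real) \<Rightarrow> nat set set \<Rightarrow> real" where
  "rowsum \<phi> q = (\<Sum>r\<in>row_group. \<phi> (relabel r q))"

definition colsum :: "(nat set set \<Rightarrow> real) \<Rightarrow> nat set set \<Rightarrow> real" where
  "colsum \<phi> q = (\<Sum>c\<in>col_group. of_int (sign c) * \<phi> (relabel c q))"

lemma jm_rowsum_colsum:
  assumes "k \<in> D"
  shows "jm k (rowsum (colsum \<phi>)) q = content k * rowsum (colsum \<phi>) q"
  using row_col_sum_jm[OF D_eq lex assms, of "\<lambda>w. \<phi> (relabel w q)"]
  by (simp add: jm_def rowsum_def colsum_def relabel_comp)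

lemma sum_col_group_sign_inv: "(\<Sum>c\<in>col_group. of_int (sign c) * g (inv c)) = (\<Sum>c\<in>col_group. of_int (sign c) * (g c :: real))"
proof -
  have "(\<Sum>c\<in>col_group. of_int (sign c) * g (inv c)) = (\<Sum>c\<in>col_group. of_int (sign (inv c)) * g (inv c))"
  proof (rule sum.cong)
    fix c assume "c \<in> col_group"
    then have "permutation c" by (rule permutation_preserving)
    then show "of_int (sign c) * g (inv c) = of_int (sign (inv c)) * g (inv c)" by (simp add: sign_inverse)
  qed simp
  then show ?thesis using sum_preserving_inv[of "\<lambda>c. of_int (sign c) * g c"] by simp
qed

text \<open>
  The mirror image of \<open>jm_rowsum_colsum\<close> under inversion of permutations: here the Jucys-Murphy element
  stands on the left of the row and column sums.
\<close>

lemma colsum_rowsum_jm: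
  assumes k: "k \<in> D"
  shows "colsum (rowsum (jm k \<phi>)) q = content k * colsum (rowsum \<phi>) q"
proof -
  have inv_crt: "inv (c \<circ> (r \<circ> tr l k)) = tr l k \<circ> (inv r \<circ> inv c)" if "c \<in> col_group" "r \<in> row_group" for c r l
    using that permutes_bij[OF preserving_permutes] permutes_bij[OF preserving_permutes]
    by (simp add: o_inv_distrib bij_comp comp_assoc)
  have inv_cr: "inv (c \<circ> r) = inv r \<circ> inv c" if "c \<in> col_group" "r \<in> row_group" for c r
    using that permutes_bij[OF preserving_permutes] permutes_bij[OF preserving_permutes] by (simp add: o_inv_distrib)
  have "colsum (rowsum (jm k \<phi>)) q =
    (\<Sum>c\<in>col_group. \<Sum>r\<in>row_group. \<Sum>l\<in>{1..<k}. of_int (sign c) * \<phi> (relabel (tr l k \<circ> (r \<circ> c)) q))"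
    by (simp add: colsum_def rowsum_def jm_def sum_distrib_left relabel_comp)
  also have "\<dots> = (\<Sum>l\<in>{1..<k}. \<Sum>r\<in>row_group. \<Sum>c\<in>col_group. of_int (sign c) * \<phi> (relabel (tr l k \<circ> (r \<circ> c)) q))"
  proof -
    let ?g = "\<lambda>c r l. of_int (sign c) * \<phi> (relabel (tr l k \<circ> (r \<circ> c)) q)"
    have "(\<Sum>c\<in>col_group. \<Sum>r\<in>row_group. \<Sum>l\<in>{1..<k}. ?g c r l) = (\<Sum>r\<in>row_group. \<Sum>c\<in>col_group. \<Sum>l\<in>{1..<k}. ?g c r l)"
      by (rule sum.swap)
    also have "\<dots> = (\<Sum>r\<in>row_group. \<Sum>l\<in>{1..<k}. \<Sum>c\<in>col_group. ?g c r l)"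
      by (intro sum.cong refl sum.swap)
    also have "\<dots> = (\<Sum>l\<in>{1..<k}. \<Sum>r\<in>row_group. \<Sum>c\<in>col_group. ?g c r l)"
      by (rule sum.swap)
    finally show ?thesis .
  qed
  also have "\<dots> = (\<Sum>l\<in>{1..<k}. \<Sum>r\<in>row_group. \<Sum>c\<in>col_group. of_int (sign c) * \<phi> (relabel (tr l k \<circ> (inv r \<circ> inv c)) q))"
    by (subst sum_preserving_inv[where h = row, symmetric], subst sum_col_group_sign_inv[symmetric]) (rule refl)
  also have "\<dots> = (\<Sum>l\<in>{1..<k}. \<Sum>r\<in>row_group. \<Sum>c\<in>col_group. of_int (sign c) * \<phi> (relabel (inv (c \<circ> (r \<circ> tr l k))) q))"
    by (intro sum.cong refl) (simp only: inv_crt)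
  also have "\<dots> = content k * (\<Sum>r\<in>row_group. \<Sum>c\<in>col_group. of_int (sign c) * \<phi> (relabel (inv (c \<circ> r)) q))"
    by (rule row_col_sum_jm[OF D_eq lex k])
  also have "(\<Sum>r\<in>row_group. \<Sum>c\<in>col_group. of_int (sign c) * \<phi> (relabel (inv (c \<circ> r)) q)) =
     (\<Sum>r\<in>row_group. \<Sum>c\<in>col_group. of_int (sign c) * \<phi> (relabel (inv r \<circ> inv c) q))"
    by (intro sum.cong refl) (simp only: inv_cr)
  also have "\<dots> = (\<Sum>r\<in>row_group. \<Sum>c\<in>col_group. of_int (sign c) * \<phi> (relabel (r \<circ> c) q))"
    by (subst (2) sum_preserving_inv[where h = row, symmetric], subst sum_col_group_sign_inv[symmetric]) (rule refl)
  also have "\<dots> = colsum (rowsum \<phi>) q"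
    by (subst sum.swap) (simp add: colsum_def rowsum_def relabel_comp sum_distrib_left)
  finally show ?thesis .
qed

lemma colsum_rowsum_odd_jm:
  "j \<le> m \<Longrightarrow> colsum (rowsum (odd_jm_prod N j \<phi>)) q =
     (\<Prod>i<j. N + content (2 * i + 1)) * colsum (rowsum \<phi>) q"
proof (induction j)
  case (Suc j)
  have D: "2 * j + 1 \<in> D" using Suc.prems by (auto simp: D_eq)
  have "colsum (rowsum (odd_jm_prod N (Suc j) \<phi>)) q =
     N * colsum (rowsum (odd_jm_prod N j \<phi>)) q + colsum (rowsum (jm (2 * j + 1) (odd_jm_prod N j \<phi>))) q"
    by (simp add: colsum_def rowsum_def sum.distrib sum_distrib_left algebra_simps)
  also have "\<dots> = (N + content (2 * j + 1)) * colsum (rowsum (odd_jm_prod N j \<phi>)) q"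
    unfolding colsum_rowsum_jm[OF D] by (simp add: algebra_simps)
  finally show ?case using Suc by simp
qed simp

lemma gram_op_rowsum: "gram_op n D (rowsum \<phi>) = rowsum (gram_op n D \<phi>)"
proof
  fix q
  have "gram_op n D (rowsum \<phi>) q = (\<Sum>r\<in>row_group. gram_op n D (\<lambda>q. \<phi> (relabel r q)) q)"
    using gram_op_linear[OF finite_preserving[of row], of n D "\<lambda>_. 1" "\<lambda>r q. \<phi> (relabel r q)" q]
    by (simp add: rowsum_def[abs_def])
  then show "gram_op n D (rowsum \<phi>) q = rowsum (gram_op n D \<phi>) q"
    by (simp add: rowsum_def gram_op_relabel[OF preserving_permutes])
qed

lemma gram_op_colsum: "gram_op n D (colsum \<phi>) = colsum (gram_op n D \<phi>)"
proof
  fix q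
  have "gram_op n D (colsum \<phi>) q = (\<Sum>c\<in>col_group. of_int (sign c) * gram_op n D (\<lambda>q. \<phi> (relabel c q)) q)"
    using gram_op_linear[OF finite_preserving[of col], of n D "\<lambda>c. of_int (sign c)" "\<lambda>r q. \<phi> (relabel r q)" q]
    by (simp add: colsum_def[abs_def])
  then show "gram_op n D (colsum \<phi>) q = colsum (gram_op n D \<phi>) q"
    by (simp add: colsum_def gram_op_relabel[OF preserving_permutes])
qed

definition row_vector :: "nat set set \<Rightarrow> real" where
  "row_vector = rowsum (point_mass (std_pairing m))"

text \<open>
  The row sum on the outside makes this a joint eigenvector of the Jucys-Murphy elements. The inner
  row sum meets the factorisation of the Gram operator at the point mass, which the operator
  reaches because it commutes with all three sums.
\<close>

definition young_vector :: "nat set set \<Rightarrow> real" where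
  "young_vector = rowsum (colsum row_vector)"

lemma gram_op_young_vector:
  assumes "1 \<le> n"
  shows "gram_op n D young_vector q = (\<Prod>i<m. real n - 1 + content (2 * i + 1)) * young_vector q"
proof -
  have "gram_op n D young_vector q = rowsum (colsum (rowsum (odd_jm_prod (real n - 1) m (point_mass (std_pairing m))))) q"
    unfolding young_vector_def row_vector_def gram_op_rowsum gram_op_colsum
    by (simp only: D_eq gram_op_std[OF assms])
  also have "\<dots> = (\<Prod>i<m. real n - 1 + content (2 * i + 1)) * young_vector q"
    unfolding rowsum_def[of "colsum _"] colsum_rowsum_odd_jm[OF order_refl]
    by (simp add: young_vector_def rowsum_def[of "colsum _"] row_vector_def sum_distrib_left)
  finally show ?thesis .
qed

lemma rowsum_support:
  assumes "\<And>q. \<phi> q \<noteq> 0 \<Longrightarrow> q \<in> pairings D" "rowsum \<phi> q \<noteq> 0"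
  shows "q \<in> pairings D"
proof -
  obtain r where "r \<in> row_group" "\<phi> (relabel r q) \<noteq> 0"
    using assms(2) unfolding rowsum_def by (meson sum.neutral)
  then show ?thesis using assms(1) pairings_relabel_iff[OF preserving_permutes] by blast
qed

lemma colsum_support:
  assumes "\<And>q. \<phi> q \<noteq> 0 \<Longrightarrow> q \<in> pairings D" "colsum \<phi> q \<noteq> 0"
  shows "q \<in> pairings D"
proof -
  obtain c where "c \<in> col_group" "of_int (sign c) * \<phi> (relabel c q) \<noteq> 0"
    using assms(2) unfolding colsum_def by (meson sum.neutral)
  then show ?thesis using assms(1) pairings_relabel_iff[OF preserving_permutes] by (metis mult_zero_right)
qed

lemma std_pairing_D: "std_pairing m \<in> pairings D"
  unfolding D_eq by (rule std_pairing_pairings)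

lemma row_vector_support: "row_vector q \<noteq> 0 \<Longrightarrow> q \<in> pairings D"
  unfolding row_vector_def by (erule rowsum_support[rotated]) (auto simp: point_mass_def std_pairing_D split: if_splits)

lemma young_vector_support: "young_vector q \<noteq> 0 \<Longrightarrow> q \<in> pairings D"
  unfolding young_vector_def
  by (erule rowsum_support[rotated], erule colsum_support[rotated], erule row_vector_support)

text \<open>
  Such a \<open>c\<close> moves the two halves of each domino in parallel. With \<open>h\<close> the exchange of the halves and \<open>d\<close>
  the restriction of \<open>c\<close> to the odd columns, \<open>c\<close> is the square of \<open>d \<circ> h\<close>, hence even.
\<close>

lemma sign_row_preserving:
  assumes c: "c \<in> col_group" and rows: "\<And>x. x \<in> D \<Longrightarrow> odd x \<Longrightarrow> row (c x) = row (c (x + 1))"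
  shows "sign c = 1"
proof -
  have cp: "c permutes D" using c by (rule preserving_permutes)
  have cD: "x \<in> D \<Longrightarrow> c x \<in> D" for x using permutes_in_image[OF cp] by auto
  have colc: "x \<in> D \<Longrightarrow> col (c x) = col x" for x using c by (auto simp: preserving_def)
  have succ: "x + 1 \<in> D" if "x \<in> D" "odd x" for x
    using that unfolding D_eq by auto presburger
  have pred: "x - 1 \<in> D" "odd (x - 1)" "x - 1 + 1 = x" if "x \<in> D" "even x" for x
    using that unfolding D_eq by (auto elim!: evenE)
  have par: "odd (col x) \<longleftrightarrow> odd x" if "x \<in> D" for x
  proof (cases "odd x")
    case True
    then show ?thesis using domino[OF that] by simp
  next
    case False
    then show ?thesis using domino[OF pred(1)[OF that] pred(2)[OF that]] pred(3)[OF that] that by simp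
  qed
  have parc: "odd (c x) \<longleftrightarrow> odd x" if "x \<in> D" for x
    using par[OF that] par[OF cD[OF that]] colc[OF that] by simp
  define h where "h = (\<lambda>x. if x \<in> D then if odd x then x + 1 else x - 1 else x)"
  define d where "d = (\<lambda>x. if x \<in> D \<and> odd x then c x else x)"
  have hD: "x \<in> D \<Longrightarrow> h x \<in> D" for x using succ pred by (auto simp: h_def)
  have hh: "h (h x) = x" for x
    using succ[of x] pred[of x] by (auto simp: h_def)
  have h: "h permutes D"
  proof (rule bij_imp_permutes)
    show "bij_betw h D D"
      by (rule bij_betw_byWitness[where f' = h]) (use hD hh in auto)
    show "h x = x" if "x \<notin> D" for x using that by (simp add: h_def)
  qed
  have d: "d permutes D"
  proof (rule bij_imp_permutes)
    have "inj_on d D"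
    proof (rule inj_onI)
      fix x y assume xy: "x \<in> D" "y \<in> D" "d x = d y"
      have "odd (d z) \<longleftrightarrow> odd z" if "z \<in> D" for z
        using parc[OF that] by (cases "odd z") (simp_all add: d_def)
      from this[OF xy(1)] this[OF xy(2)] have "odd x \<longleftrightarrow> odd y" using xy(3) by simp
      then show "x = y" using xy injD[OF permutes_inj[OF cp], of x y] by (cases "odd x") (simp_all add: d_def)
    qed
    moreover have "d ` D \<subseteq> D" using cD by (auto simp: d_def)
    ultimately show "bij_betw d D D"
      using finite_D by (simp add: bij_betw_def endo_inj_surj)
  qed (auto simp: d_def)
  have cd: "c = d \<circ> h \<circ> (d \<circ> h)"
  proof
    fix x
    show "c x = (d \<circ> h \<circ> (d \<circ> h)) x"
    proof (cases "x \<in> D")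
      case False
      then show ?thesis using permutes_not_in[OF cp] by (simp add: h_def d_def)
    next
      case x: True
      show ?thesis
      proof (cases "odd x")
        case True
        then have "h x \<in> D" "even (h x)" using x succ by (auto simp: h_def)
        then have "d (h x) = h x" by (simp add: d_def)
        then show ?thesis using x True hh by (simp add: d_def)
      next
        case False
        define y where "y = x - 1"
        have y: "y \<in> D" "odd y" "x = y + 1" using pred[OF x] False by (auto simp: y_def)
        have "h x = y" using x False by (simp add: h_def y_def)
        then have 1: "d (h x) = c y" using y by (simp add: d_def)
        have cy: "c y \<in> D" "odd (c y)" using cD parc y by auto
        then have 2: "h (c y) = c y + 1" by (simp add: h_def)
        have cy1: "c y + 1 \<in> D" using succ cy by blast
        have "d (c y + 1) = c y + 1" using cy by (simp add: d_def)
        moreover have "c x = c y + 1"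
        proof (rule box_inj)
          show "c x \<in> D" "c y + 1 \<in> D" using cD x cy1 by auto
          show "row (c x) = row (c y + 1)" using rows[OF y(1,2)] domino[OF cy] y by simp
          show "col (c x) = col (c y + 1)"
            using colc[OF x] colc[OF y(1)] domino[OF cy] domino[OF y(1,2)] y by simp
        qed
        ultimately show ?thesis using 1 2 by simp
      qed
    qed
  qed
  have pd: "permutation d" "permutation h"
    using d h finite_D by (auto simp: permutation_permutes)
  have "sign c = sign (d \<circ> h) * sign (d \<circ> h)"
    by (subst cd, rule sign_compose) (use pd in \<open>auto intro: permutation_compose\<close>)
  then show ?thesis by (simp add: sign_idempotent)
qed

lemma row_vector_nonneg: "row_vector q \<ge> 0"
  by (simp add: row_vector_def rowsum_def point_mass_def sum_nonneg)

text \<open>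
  The row vector lives on the pairings with both points of each pair in the same row, so \<open>c\<close> has to map
  dominoes to such pairs.
\<close>

lemma row_vector_col_sign:
  assumes c: "c \<in> col_group" and nz: "row_vector (relabel c (std_pairing m)) \<noteq> 0"
  shows "sign c = 1"
proof (rule sign_row_preserving[OF c])
  fix x assume x: "x \<in> D" "odd x"
  obtain r where r: "r \<in> row_group" and "point_mass (std_pairing m) (relabel r (relabel c (std_pairing m))) \<noteq> 0"
    using nz unfolding row_vector_def rowsum_def by (meson sum.neutral)
  then have eq: "relabel r (relabel c (std_pairing m)) = std_pairing m"
    by (simp add: point_mass_def split: if_splits)
  have x1: "x + 1 \<in> D" using x unfolding D_eq by auto presburger
  have "{x, x + 1} \<in> std_pairing m"
  proof -
    obtain i where i: "x = 2 * i + 1" using x(2) by (rule oddE)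
    then have "i < m" "{x, x + 1} = {2 * i + 1, 2 * i + 2}" using x by (auto simp: D_eq)
    then show ?thesis unfolding mem_std_pairing by blast
  qed
  then have "r ` c ` {x, x + 1} \<in> relabel r (relabel c (std_pairing m))"
    unfolding relabel_def by blast
  then obtain i where i: "i < m" "{r (c x), r (c (x + 1))} = {2 * i + 1, 2 * i + 2}"
    unfolding eq mem_std_pairing by auto
  have "2 * i + 1 \<in> D" using i(1) by (auto simp: D_eq)
  from domino[OF this] have "row (2 * i + 2) = row (2 * i + 1)" by simp
  then have "row (r (c x)) = row (r (c (x + 1)))" using i(2) by (auto simp: doubleton_eq_iff)
  moreover have "c x \<in> D" "c (x + 1) \<in> D" using x x1 permutes_in_image[OF preserving_permutes[OF c]] by auto
  ultimately show "row (c x) = row (c (x + 1))" using r by (auto simp: preserving_def)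
qed

text \<open>
  By \<open>row_vector_col_sign\<close> no term of the signed column sum at the standard pairing is negative, and
  the identity contributes a positive one.
\<close>

lemma colsum_row_vector_pos: "colsum row_vector (std_pairing m) > 0"
proof -
  have "row_vector (std_pairing m) > 0"
  proof -
    have "point_mass (std_pairing m) (relabel id (std_pairing m)) \<le> row_vector (std_pairing m)"
      unfolding row_vector_def rowsum_def
      by (rule member_le_sum[OF id_preserving[of row] _ finite_preserving[of row], of "\<lambda>r. point_mass (std_pairing m) (relabel r (std_pairing m))"])
        (simp add: point_mass_def)
    then show ?thesis by (simp add: point_mass_def)
  qed
  also have "row_vector (std_pairing m) = of_int (sign (id :: nat \<Rightarrow> nat)) * row_vector (relabel id (std_pairing m))" by simp
  also have "\<dots> \<le> colsum row_vector (std_pairing m)"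
    unfolding colsum_def
  proof (rule member_le_sum[OF id_preserving _ finite_preserving])
    fix c assume "c \<in> col_group - {id}"
    then show "0 \<le> of_int (sign c) * row_vector (relabel c (std_pairing m))"
      using row_vector_col_sign[of c] row_vector_nonneg by (cases "row_vector (relabel c (std_pairing m)) = 0") auto
  qed
  finally show ?thesis .
qed

lemma sum_pairings_relabel:
  assumes w: "w permutes D"
  shows "(\<Sum>q\<in>pairings D. g (relabel w q)) = (\<Sum>q\<in>pairings D. g q)"
  by (rule sum.reindex_bij_witness[of _ "relabel (inv w)" "relabel w"])
    (use pairings_relabel_iff[OF w] pairings_relabel_iff[OF permutes_inv[OF w]] in \<open>auto simp: relabel_inv[OF w]\<close>)

lemma colsum_sign:
  assumes d: "d \<in> col_group"
  shows "colsum \<phi> (relabel d q) = of_int (sign d) * colsum \<phi> q"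
proof -
  have "colsum \<phi> q = (\<Sum>c\<in>col_group. of_int (sign (c \<circ> d)) * \<phi> (relabel (c \<circ> d) q))"
    unfolding colsum_def by (rule sum_preserving_right[OF d, symmetric])
  also have "\<dots> = of_int (sign d) * colsum \<phi> (relabel d q)"
    using d by (simp add: colsum_def sign_compose[OF permutation_preserving permutation_preserving] relabel_comp sum_distrib_left mult_ac)
  finally show ?thesis by (simp add: sign_idempotent flip: mult.assoc of_int_mult)
qed

text \<open>
  With \<open>B\<close> the signed column sum and \<open>\<eta>\<close> the row vector, the value is the inner product of \<open>\<eta>\<close> and
  \<open>B \<eta>\<close>. Since \<open>B\<close> is symmetric and a multiple of a projection, it could only vanish together with
  \<open>B \<eta>\<close>, which is positive at the standard pairing.
\<close>

lemma young_vector_nonzero: "young_vector (std_pairing m) \<noteq> 0"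
proof
  assume 0: "young_vector (std_pairing m) = 0"
  let ?B = "colsum row_vector"
  have fin: "finite (pairings D)" using finite_D by (rule finite_pairings)
  have "(\<Sum>q\<in>pairings D. row_vector q * ?B q) =
      (\<Sum>r\<in>row_group. \<Sum>q\<in>pairings D. point_mass (std_pairing m) (relabel r q) * ?B q)"
    unfolding row_vector_def rowsum_def sum_distrib_right by (rule sum.swap)
  also have "\<dots> = (\<Sum>r\<in>row_group. ?B (relabel (inv r) (std_pairing m)))"
  proof (rule sum.cong)
    fix r assume r: "r \<in> row_group"
    have "(\<Sum>q\<in>pairings D. point_mass (std_pairing m) (relabel r q) * ?B q) =
      (\<Sum>q\<in>pairings D. point_mass (std_pairing m) (relabel r (relabel (inv r) q)) * ?B (relabel (inv r) q))"
      by (rule sum_pairings_relabel[OF permutes_inv[OF preserving_permutes[OF r]], symmetric])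
    also have "\<dots> = ?B (relabel (inv r) (std_pairing m))"
      using fin std_pairing_D by (simp add: relabel_inv[OF preserving_permutes[OF r]] point_mass_def if_distrib[of "\<lambda>x. x * _"] cong: if_cong)
    finally show "(\<Sum>q\<in>pairings D. point_mass (std_pairing m) (relabel r q) * ?B q) = ?B (relabel (inv r) (std_pairing m))" .
  qed simp
  also have "\<dots> = young_vector (std_pairing m)"
    unfolding young_vector_def rowsum_def by (rule sum_preserving_inv)
  finally have ip: "(\<Sum>q\<in>pairings D. row_vector q * ?B q) = 0" using 0 by simp
  have "(\<Sum>q\<in>pairings D. ?B q * ?B q) =
      (\<Sum>c\<in>col_group. \<Sum>q\<in>pairings D. of_int (sign c) * row_vector (relabel c q) * ?B q)"
    unfolding colsum_def[of row_vector] sum_distrib_right by (rule sum.swap)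
  also have "\<dots> = (\<Sum>c\<in>col_group. 0)"
  proof (rule sum.cong)
    fix c assume c: "c \<in> col_group"
    have "(\<Sum>q\<in>pairings D. of_int (sign c) * row_vector (relabel c q) * ?B q) =
        (\<Sum>q\<in>pairings D. row_vector (relabel c q) * ?B (relabel c q))"
      by (simp add: colsum_sign[OF c] mult_ac)
    also have "\<dots> = 0"
      using sum_pairings_relabel[OF preserving_permutes[OF c], of "\<lambda>q. row_vector q * ?B q"] ip by simp
    finally show "(\<Sum>q\<in>pairings D. of_int (sign c) * row_vector (relabel c q) * ?B q) = 0" .
  qed simp
  finally have "(\<Sum>q\<in>pairings D. ?B q * ?B q) = 0" by simp
  then have "?B (std_pairing m) * ?B (std_pairing m) = 0"
    using fin std_pairing_D by (subst (asm) sum_nonneg_eq_0_iff) auto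
  then show False using colsum_row_vector_pos by simp
qed

lemma jm_young_vector: "k \<in> D \<Longrightarrow> jm k young_vector q = content k * young_vector q"
  unfolding young_vector_def by (rule jm_rowsum_colsum)

end

section \<open>Diagrams with doubled rows\<close>

lemma young_diagram_finite: "young_diagram l \<Longrightarrow> finite l"
  by (simp add: young_diagram_def)

lemma young_diagram_pos: "young_diagram l \<Longrightarrow> (i, j) \<in> l \<Longrightarrow> 1 \<le> i \<and> 1 \<le> j"
  by (fastforce simp: young_diagram_def)

lemma young_diagram_down:
  "young_diagram l \<Longrightarrow> (i, j) \<in> l \<Longrightarrow> 1 \<le> i' \<Longrightarrow> i' \<le> i \<Longrightarrow> 1 \<le> j' \<Longrightarrow> j' \<le> j \<Longrightarrow> (i', j') \<in> l"
  unfolding young_diagram_def by fast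

lemma young_diagramI:
  assumes "finite l" "\<And>i j. (i, j) \<in> l \<Longrightarrow> 1 \<le> i \<and> 1 \<le> j"
    and "\<And>i j i' j'. (i, j) \<in> l \<Longrightarrow> 1 \<le> i' \<Longrightarrow> i' \<le> i \<Longrightarrow> 1 \<le> j' \<Longrightarrow> j' \<le> j \<Longrightarrow> (i', j') \<in> l"
  shows "young_diagram l"
  unfolding young_diagram_def
proof (intro conjI ballI)
  show "finite l" by (rule assms(1))
  fix b assume b: "b \<in> l"
  obtain i j where ij: "b = (i, j)" by fastforce
  have ijl: "(i, j) \<in> l" using b ij by simp
  have "(i', j') \<in> l" if "1 \<le> i' \<and> i' \<le> i \<and> 1 \<le> j' \<and> j' \<le> j" for i' j'
    using assms(3)[OF ijl, of i' j'] that by blast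
  then show "case b of (i, j) \<Rightarrow> 1 \<le> i \<and> 1 \<le> j \<and>
      (\<forall>i' j'. 1 \<le> i' \<and> i' \<le> i \<and> 1 \<le> j' \<and> j' \<le> j \<longrightarrow> (i', j') \<in> l)"
    using assms(2)[OF ijl] unfolding ij prod.case by blast
qed

lemma finite_row: "young_diagram l \<Longrightarrow> finite {j. (i, j) \<in> l}"
  by (rule finite_subset[of _ "snd ` l"]) (force simp: young_diagram_def)+

lemma row_eq_interval:
  assumes l: "young_diagram l"
  shows "{j. (i, j) \<in> l} = {1..row_length l i}"
proof -
  let ?J = "{j. (i, j) \<in> l}"
  have fin: "finite ?J" using l by (rule finite_row)
  show ?thesis
  proof (cases "?J = {}")
    case True
    then show ?thesis by (auto simp: row_length_def)
  next
    case False
    define M where "M = Max ?J"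
    have M: "(i, M) \<in> l" using Max_in[OF fin False] by (simp add: M_def)
    have "?J = {1..M}"
    proof
      show "?J \<subseteq> {1..M}"
        using Max_ge[OF fin] young_diagram_pos[OF l] by (auto simp: M_def simp del: One_nat_def)
      show "{1..M} \<subseteq> ?J"
        using young_diagram_down[OF l M] young_diagram_pos[OF l M] by auto
    qed
    then show ?thesis by (simp add: row_length_def)
  qed
qed

lemma mem_iff_row_length:
  assumes "young_diagram l"
  shows "(i, j) \<in> l \<longleftrightarrow> 1 \<le> j \<and> j \<le> row_length l i"
  using row_eq_interval[OF assms, of i] by (auto simp: set_eq_iff)

text \<open>
  Each box \<open>(i, j)\<close> becomes the domino of the boxes \<open>(i, 2 * j - 1)\<close> and \<open>(i, 2 * j)\<close>.
\<close>

lemma mem_double_rows: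
  assumes "young_diagram l"
  shows "(i, j) \<in> double_rows l \<longleftrightarrow> 1 \<le> j \<and> (i, (j + 1) div 2) \<in> l"
  unfolding mem_iff_row_length[OF assms] double_rows_def by auto

lemma card_double_rows:
  assumes l: "young_diagram l"
  shows "finite (double_rows l)" "card (double_rows l) = 2 * card l"
proof -
  have eq: "double_rows l = (\<lambda>(i, j). (i, 2 * j)) ` l \<union> (\<lambda>(i, j). (i, 2 * j - 1)) ` l"
  proof
    show "double_rows l \<subseteq> (\<lambda>(i, j). (i, 2 * j)) ` l \<union> (\<lambda>(i, j). (i, 2 * j - 1)) ` l"
    proof
      fix b assume "b \<in> double_rows l"
      then obtain i j where b: "b = (i, j)" "1 \<le> j" "(i, (j + 1) div 2) \<in> l"
        using mem_double_rows[OF l] by (cases b) auto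
      have "j = 2 * ((j + 1) div 2) \<or> j = 2 * ((j + 1) div 2) - 1" using b(2) by presburger
      then show "b \<in> (\<lambda>(i, j). (i, 2 * j)) ` l \<union> (\<lambda>(i, j). (i, 2 * j - 1)) ` l"
        using b by (force simp: image_iff)
    qed
    show "(\<lambda>(i, j). (i, 2 * j)) ` l \<union> (\<lambda>(i, j). (i, 2 * j - 1)) ` l \<subseteq> double_rows l"
      using young_diagram_pos[OF l] by (fastforce simp: mem_double_rows[OF l])
  qed
  have fin: "finite l" using l by (rule young_diagram_finite)
  show "finite (double_rows l)" unfolding eq using fin by simp
  have "card (double_rows l) = card ((\<lambda>(i, j). (i, 2 * j)) ` l) + card ((\<lambda>(i, j). (i, 2 * j - 1)) ` l)"
    unfolding eq
  proof (rule card_Un_disjoint)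
    have "2 * j \<noteq> 2 * j' - 1" if "(i, j) \<in> l" "(i', j') \<in> l" for i j i' j'
      using young_diagram_pos[OF l that(1)] young_diagram_pos[OF l that(2)] by presburger
    then show "(\<lambda>(i, j). (i, 2 * j)) ` l \<inter> (\<lambda>(i, j). (i, 2 * j - 1)) ` l = {}"
      by auto
  qed (use fin in auto)
  also have "card ((\<lambda>(i, j). (i, 2 * j)) ` l) = card l"
    by (rule card_image) (auto simp: inj_on_def)
  also have "card ((\<lambda>(i, j). (i, 2 * j - 1)) ` l) = card l"
  proof (rule card_image, rule inj_onI)
    fix x y assume xy: "x \<in> l" "y \<in> l"
      and eq: "(case x of (i, j) \<Rightarrow> (i, 2 * j - 1)) = (case y of (i, j) \<Rightarrow> (i, 2 * j - 1))"
    obtain i j where x: "x = (i, j)" by fastforce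
    obtain i' j' where y: "y = (i', j')" by fastforce
    have "1 \<le> j" "1 \<le> j'" using young_diagram_pos[OF l] xy x y by blast+
    moreover have "i = i'" "2 * j - 1 = 2 * j' - 1" using eq x y by simp_all
    ultimately show "x = y" using x y by simp
  qed
  finally show "card (double_rows l) = 2 * card l" by simp
qed

lemma young_diagram_double_rows:
  assumes l: "young_diagram l"
  shows "young_diagram (double_rows l)"
proof (rule young_diagramI)
  fix i j assume ij: "(i, j) \<in> double_rows l"
  then have m: "1 \<le> j" "(i, (j + 1) div 2) \<in> l" using mem_double_rows[OF l] by auto
  show "1 \<le> i \<and> 1 \<le> j" using m young_diagram_pos[OF l m(2)] by simp
  fix i' j' assume "1 \<le> i'" "i' \<le> i" "1 \<le> j'" "j' \<le> j"
  then show "(i', j') \<in> double_rows l"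
    using young_diagram_down[OF l m(2), of i' "(j' + 1) div 2"] mem_double_rows[OF l] by auto
qed (rule card_double_rows[OF l])

section \<open>Standard tableaux and their contents\<close>

definition box_of :: "(nat \<times> nat) set \<Rightarrow> (nat \<times> nat \<Rightarrow> nat) \<Rightarrow> nat \<Rightarrow> nat \<times> nat" where
  "box_of l T = inv_into l T"

definition label_content :: "(nat \<times> nat) set \<Rightarrow> (nat \<times> nat \<Rightarrow> nat) \<Rightarrow> nat \<Rightarrow> real" where
  "label_content l T k = real (snd (box_of l T k)) - real (fst (box_of l T k))"

locale tableau =
  fixes l :: "(nat \<times> nat) set" and T :: "nat \<times> nat \<Rightarrow> nat"
  assumes young: "young_diagram l" and syt: "T \<in> standard_young_tableaux l"
begin

lemma T_bij: "bij_betw T l {1..card l}"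
  using syt by (simp add: standard_young_tableaux_def)

lemma T_ext: "T \<in> extensional l"
  using syt by (simp add: standard_young_tableaux_def)

lemma T_range: "b \<in> l \<Longrightarrow> T b \<in> {1..card l}"
  using T_bij by (auto simp: bij_betw_def)

lemma box_mem: "k \<in> {1..card l} \<Longrightarrow> box_of l T k \<in> l"
  using T_bij unfolding box_of_def bij_betw_def by (metis inv_into_into)

lemma T_box: "k \<in> {1..card l} \<Longrightarrow> T (box_of l T k) = k"
  using T_bij unfolding box_of_def bij_betw_def by (metis f_inv_into_f)

lemma box_T: "b \<in> l \<Longrightarrow> box_of l T (T b) = b"
  using T_bij unfolding box_of_def bij_betw_def by (simp add: inv_into_f_f)

lemma boxes_image: "l = box_of l T ` {1..card l}"
proof
  show "l \<subseteq> box_of l T ` {1..card l}"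
  proof
    fix b assume "b \<in> l"
    then show "b \<in> box_of l T ` {1..card l}" using box_T T_range by (metis image_eqI)
  qed
  show "box_of l T ` {1..card l} \<subseteq> l" using box_mem by auto
qed

lemma T_row_mono: "(i, j + d) \<in> l \<Longrightarrow> 1 \<le> j \<Longrightarrow> T (i, j) \<le> T (i, j + d)"
proof (induction d)
  case (Suc d)
  have "(i, j + d) \<in> l"
    using young_diagram_down[OF young Suc.prems(1), of i "j + d"] young_diagram_pos[OF young Suc.prems(1)]
      Suc.prems(2) by simp
  moreover have "T (i, j + d) < T (i, j + d + 1)"
    using syt calculation Suc.prems(1) by (simp add: standard_young_tableaux_def)
  ultimately show ?case using Suc by simp
qed simp

lemma T_col_mono: "(i + d, j) \<in> l \<Longrightarrow> 1 \<le> i \<Longrightarrow> T (i, j) \<le> T (i + d, j)"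
proof (induction d)
  case (Suc d)
  have "(i + d, j) \<in> l"
    using young_diagram_down[OF young Suc.prems(1), of "i + d" j] young_diagram_pos[OF young Suc.prems(1)]
      Suc.prems(2) by simp
  moreover have "T (i + d, j) < T (i + d + 1, j)"
    using syt calculation Suc.prems(1) by (simp add: standard_young_tableaux_def)
  ultimately show ?case using Suc by simp
qed simp

lemma T_mono:
  assumes b: "(i, j) \<in> l" and b': "(i', j') \<in> l" and le: "i \<le> i'" "j \<le> j'"
  shows "T (i, j) \<le> T (i', j')"
proof -
  have pos: "1 \<le> i" "1 \<le> j" using young_diagram_pos[OF young b] by auto
  have mid: "(i, j') \<in> l" using young_diagram_down[OF young b', of i j'] pos le by auto
  obtain d where d: "j' = j + d" using le(2) le_Suc_ex by blast
  obtain e where e: "i' = i + e" using le(1) le_Suc_ex by blast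
  have "T (i, j) \<le> T (i, j')" using T_row_mono[of i j d] mid pos d by simp
  also have "\<dots> \<le> T (i', j')" using T_col_mono[of i e j'] b' pos e by simp
  finally show ?thesis .
qed

lemma T_inj: "b \<in> l \<Longrightarrow> b' \<in> l \<Longrightarrow> T b = T b' \<Longrightarrow> b = b'"
  using T_bij by (auto simp: bij_betw_def inj_on_def)

lemma T_strict_mono:
  assumes "(i, j) \<in> l" "(i', j') \<in> l" "i \<le> i'" "j \<le> j'" "(i, j) \<noteq> (i', j')"
  shows "T (i, j) < T (i', j')"
  using T_mono[OF assms(1-4)] T_inj[OF assms(1,2)] assms(5) by linarith

end

text \<open>
  Suppose the smaller labels agree. Two boxes of equal content lie on one diagonal, so if the boxes of
  \<open>k\<close> differed, the upper one would belong to both diagrams. In the diagram with the lower box its label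
  is below \<open>k\<close>, and it would have to be the same in the other diagram, where it is \<open>k\<close>.
\<close>

lemma boxes_eq_if_contents_eq:
  assumes t: "tableau l T" and t': "tableau l' T'" and card: "card l = card l'"
    and eq: "\<And>k. k \<in> {1..card l} \<Longrightarrow> label_content l T k = label_content l' T' k"
  shows "k \<in> {1..card l} \<Longrightarrow> box_of l T k = box_of l' T' k"
proof (induction k rule: less_induct)
  case (less k)
  have aux: False
    if t: "tableau l T" and t': "tableau l' T'" and card: "card l = card l'"
      and k: "k \<in> {1..card l}" and IH: "\<And>x. x < k \<Longrightarrow> x \<in> {1..card l} \<Longrightarrow> box_of l T x = box_of l' T' x"
      and c: "label_content l T k = label_content l' T' k" and lt: "fst (box_of l T k) < fst (box_of l' T' k)"
    for l T l' T'
  proof -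
    interpret t: tableau l T by fact
    interpret t': tableau l' T' by fact
    obtain i j where b: "box_of l T k = (i, j)" by fastforce
    obtain i' j' where b': "box_of l' T' k = (i', j')" by fastforce
    have bl: "(i, j) \<in> l" using t.box_mem[OF k] b by simp
    have bl': "(i', j') \<in> l'" using t'.box_mem[of k] k card b' by simp
    have "real j - real i = real j' - real i'" "i < i'" using c lt by (auto simp: label_content_def b b')
    then have jj: "j < j'" by linarith
    have bin: "(i, j) \<in> l'"
      using young_diagram_down[OF t'.young bl', of i j] young_diagram_pos[OF t.young bl] jj \<open>i < i'\<close> by simp
    have "T' (i, j) < T' (i', j')"
      using t'.T_strict_mono[OF bin bl'] jj \<open>i < i'\<close> by auto
    also have "T' (i', j') = k" using t'.T_box[of k] k card b' by simp
    finally have lt': "T' (i, j) < k" .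
    have r: "T' (i, j) \<in> {1..card l}" using t'.T_range[OF bin] card by simp
    have "box_of l T (T' (i, j)) = box_of l' T' (T' (i, j))" using IH[OF lt' r] .
    also have "\<dots> = (i, j)" by (rule t'.box_T[OF bin])
    finally have "T' (i, j) = T (i, j)" using t.T_box[OF r] by simp
    also have "T (i, j) = k" using t.T_box[OF k] b by simp
    finally show False using lt' by simp
  qed
  have "\<not> fst (box_of l T k) < fst (box_of l' T' k)"
    using aux[OF t t' card less.prems _ eq[OF less.prems]] less.IH by blast
  moreover have "\<not> fst (box_of l' T' k) < fst (box_of l T k)"
    using aux[OF t' t card[symmetric] _ _ eq[OF less.prems, symmetric]] less.IH less.prems card by auto
  ultimately have "fst (box_of l T k) = fst (box_of l' T' k)" by simp
  moreover from this have "snd (box_of l T k) = snd (box_of l' T' k)"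
    using eq[OF less.prems] by (simp add: label_content_def)
  ultimately show ?case by (simp add: prod_eq_iff)
qed

lemma tableau_eq_if_contents_eq:
  assumes t: "tableau l T" and t': "tableau l' T'" and card: "card l = card l'"
    and eq: "\<And>k. k \<in> {1..card l} \<Longrightarrow> label_content l T k = label_content l' T' k"
  shows "l = l' \<and> T = T'"
proof -
  interpret t: tableau l T by fact
  interpret t': tableau l' T' by fact
  have box: "box_of l T k = box_of l' T' k" if "k \<in> {1..card l}" for k
    using boxes_eq_if_contents_eq[OF assms that] .
  have im: "l = box_of l T ` {1..card l}" "l' = box_of l' T' ` {1..card l'}"
    by (rule t.boxes_image, rule t'.boxes_image)
  have ll: "l = l'" using im box card by (metis (no_types, lifting) image_cong)
  have "T b = T' b" for b
  proof (cases "b \<in> l")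
    case True
    have "box_of l' T' (T b) = b" using box[OF t.T_range[OF True]] t.box_T[OF True] by simp
    then show ?thesis using t'.T_box[of "T b"] t.T_range[OF True] card by simp
  next
    case False
    then show ?thesis using extensional_arb[OF t.T_ext False] extensional_arb[OF t'.T_ext, of b] ll by simp
  qed
  then show ?thesis using ll by auto
qed

section \<open>The eigenvector of a row-ordered tableau\<close>

text \<open>
  The Gram eigenvalue \<open>g\<close> is a parameter of its own since it depends on the shape only, while the
  Jucys-Murphy eigenvalues tell the tableaux of one shape apart.
\<close>

definition tableau_vector :: "nat \<Rightarrow> nat \<Rightarrow> real \<Rightarrow> (nat \<times> nat) set \<Rightarrow> (nat \<times> nat \<Rightarrow> nat)
    \<Rightarrow> (nat set set \<Rightarrow> real) \<Rightarrow> bool" where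
  "tableau_vector n m g l T v \<longleftrightarrow> (\<forall>q. v q \<noteq> 0 \<longrightarrow> q \<in> pairings {1..2 * m}) \<and> (\<exists>q. v q \<noteq> 0) \<and>
     (\<forall>k\<in>{1..2 * m}. \<forall>q. jm k v q = label_content l T k * v q) \<and>
     (\<forall>q. gram_op n {1..2 * m} v q = g * v q)"

text \<open>
  The assumption on rows says that the tableau is numbered in reading order. Then odd labels sit in odd
  columns, the two halves of a domino carry consecutive labels, and the box \<open>(i, 2 * j - 1)\<close> of an
  odd label contributes \<open>n - 1 + (2 * j - 1 - i) = n + 2 * j - i - 2\<close>.
\<close>

lemma row_tableau_vector:
  assumes l: "young_diagram l" and T: "tableau (double_rows l) T" and n: "1 \<le> n"
    and rows: "\<And>b b'. b \<in> double_rows l \<Longrightarrow> b' \<in> double_rows l \<Longrightarrow> fst b < fst b' \<Longrightarrow> T b < T b'"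
  shows "\<exists>v. tableau_vector n (card l) (f_content (real n) l) (double_rows l) T v"
proof -
  define m where "m = card l"
  define \<mu> where "\<mu> = double_rows l"
  interpret tableau \<mu> T using T by (simp add: \<mu>_def)
  have card\<mu>: "card \<mu> = 2 * m" using card_double_rows[OF l] by (simp add: \<mu>_def m_def)
  define D where "D = {1..2 * m}"
  define row col where "row = fst \<circ> box_of \<mu> T" and "col = snd \<circ> box_of \<mu> T"
  have bm: "(row x, col x) \<in> \<mu>" if "x \<in> D" for x
    using box_mem[of x] that by (simp add: D_def card\<mu> row_def col_def)
  have Tb: "T (row x, col x) = x" if "x \<in> D" for x
    using T_box[of x] that by (simp add: D_def card\<mu> row_def col_def)
  have TD: "T b \<in> D" "row (T b) = fst b" "col (T b) = snd b" if "b \<in> \<mu>" for b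
    using T_range[OF that] box_T[OF that] by (simp_all add: D_def card\<mu> row_def col_def)
  have lex1: "x < y" if "x \<in> D" "y \<in> D" "row x < row y \<or> row x = row y \<and> col x < col y" for x y
  proof (cases "row x < row y")
    case True
    then show ?thesis using rows[of "(row x, col x)" "(row y, col y)"] bm Tb that by (simp add: \<mu>_def)
  next
    case False
    then have "T (row x, col x) < T (row y, col y)"
      using T_strict_mono[OF bm[OF that(1)] bm[OF that(2)]] that by auto
    then show ?thesis unfolding Tb[OF that(1)] Tb[OF that(2)] .
  qed
  have inj: "x = y" if "x \<in> D" "y \<in> D" "row x = row y" "col x = col y" for x y
  proof -
    have "T (row x, col x) = T (row y, col y)" using that by simp
    then show ?thesis unfolding Tb[OF that(1)] Tb[OF that(2)] .
  qed
  have lex: "x < y \<longleftrightarrow> row x < row y \<or> row x = row y \<and> col x < col y" if "x \<in> D" "y \<in> D" for x y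
    using lex1[of x y] lex1[of y x] inj[of x y] that
    by (cases "row x" "row y" rule: linorder_cases; cases "col x" "col y" rule: linorder_cases) auto
  have pos: "1 \<le> row x \<and> 1 \<le> col x" if "x \<in> D" for x
    using young_diagram_pos[OF young bm[OF that]] .
  have succ: "y + 1 \<in> D \<and> row (y + 1) = row y \<and> col (y + 1) = col y + 1" if y: "y \<in> D" "odd (col y)" for y
  proof -
    have b': "(row y, col y + 1) \<in> \<mu>"
      using bm[OF y(1)] y(2) unfolding \<mu>_def mem_double_rows[OF l] by (auto elim!: oddE)
    define z where "z = T (row y, col y + 1)"
    have z: "z \<in> D" "row z = row y" "col z = col y + 1" using TD[OF b'] by (auto simp: z_def)
    have yz: "y < z" using lex[OF y(1) z(1)] z by simp
    then have y1: "y + 1 \<in> D" using y(1) z(1) by (auto simp: D_def)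
    have "\<not> y + 1 < z"
    proof
      assume "y + 1 < z"
      then have 1: "row (y + 1) < row z \<or> row (y + 1) = row z \<and> col (y + 1) < col z" using lex[OF y1 z(1)] by simp
      have 2: "row y < row (y + 1) \<or> row y = row (y + 1) \<and> col y < col (y + 1)" using lex[OF y(1) y1] by simp
      have 3: "row z = row y" "col z = col y + 1" using z by simp_all
      show False using 1 2 unfolding 3 by (cases "row (y + 1)" "row y" rule: linorder_cases) simp_all
    qed
    then have "z = y + 1" using yz by simp
    then show ?thesis using z by simp
  qed
  have pred: "y - 1 \<in> D \<and> 1 < y \<and> row (y - 1) = row y \<and> col (y - 1) + 1 = col y" if y: "y \<in> D" "even (col y)" for y
  proof -
    have b': "(row y, col y - 1) \<in> \<mu>"
      using young_diagram_down[OF young bm[OF y(1)], of "row y" "col y - 1"] pos[OF y(1)] y(2)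
      by (auto elim!: evenE)
    define z where "z = T (row y, col y - 1)"
    have z: "z \<in> D" "row z = row y" "col z = col y - 1" using TD[OF b'] by (auto simp: z_def)
    have oz: "odd (col z)" "col z + 1 = col y" using z pos[OF y(1)] y(2) by (auto elim!: evenE)
    have "z + 1 = y" using succ[OF z(1) oz(1)] inj[of "z + 1" y] z y oz by auto
    then show ?thesis using z oz by (auto simp: D_def)
  qed
  \<comment> \<open>if \<open>2 * i + 3\<close> had an even column, \<open>2 * i + 2\<close> would have an odd one; but by induction it is
    the right half of a domino\<close>
  have odd_col: "odd (col (2 * i + 1))" if "2 * i + 1 \<in> D" for i
    using that
  proof (induction i)
    case 0
    then show ?case using pred[of 1] by auto
  next
    case (Suc i)
    have x: "2 * i + 1 \<in> D" using Suc.prems by (auto simp: D_def)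
    have o: "odd (col (2 * i + 1))" using Suc.IH[OF x] .
    have e: "even (col (2 * i + 2))" using succ[OF x o] o by simp
    show ?case
    proof
      assume "even (col (2 * Suc i + 1))"
      then have "even (col (2 * i + 2) + 1)" using pred[OF Suc.prems] by simp
      then show False using e by simp
    qed
  qed
  have ef: "domino_filling D row col m"
  proof
    show "finite D" "D = {1..2 * m}" by (simp_all add: D_def)
    fix x y i j
    show "x \<in> D \<Longrightarrow> y \<in> D \<Longrightarrow> row x = row y \<Longrightarrow> col x = col y \<Longrightarrow> x = y" by (rule inj)
    show "x \<in> D \<Longrightarrow> 1 \<le> row x \<and> 1 \<le> col x" by (rule pos)
    show "x \<in> D \<Longrightarrow> y \<in> D \<Longrightarrow> (x < y) = (row x < row y \<or> row x = row y \<and> col x < col y)" by (rule lex)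
    show "\<exists>y\<in>D. row y = i \<and> col y = j" if "x \<in> D" "1 \<le> i" "i \<le> row x" "1 \<le> j" "j \<le> col x"
      using TD[of "(i, j)"] young_diagram_down[OF young bm[OF that(1)] that(2-)] by auto
    show "row (x + 1) = row x \<and> col (x + 1) = col x + 1 \<and> odd (col x)" if x: "x \<in> D" "odd x"
    proof -
      obtain i where "x = 2 * i + 1" using x(2) by (rule oddE)
      then have "odd (col x)" using odd_col x(1) by simp
      then show ?thesis using succ[OF x(1)] by simp
    qed
  qed
  interpret ef: domino_filling D row col m by (rule ef)
  have "bij_betw (\<lambda>i. (row (2 * i + 1), (col (2 * i + 1) + 1) div 2)) {..<m} l"
  proof -
    let ?h = "\<lambda>i. (row (2 * i + 1), (col (2 * i + 1) + 1) div 2)"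
    have D1: "2 * i + 1 \<in> D" if "i < m" for i using that by (auto simp: D_def)
    have inj_h: "inj_on ?h {..<m}"
    proof (rule inj_onI)
      fix i j assume ij: "i \<in> {..<m}" "j \<in> {..<m}" "?h i = ?h j"
      have "odd (col (2 * i + 1))" "odd (col (2 * j + 1))" using odd_col D1 ij by auto
      then have "col (2 * i + 1) = col (2 * j + 1)" using ij(3) by (auto elim!: oddE)
      then have "2 * i + 1 = 2 * j + 1" using inj[of "2 * i + 1" "2 * j + 1"] D1 ij by auto
      then show "i = j" by simp
    qed
    moreover have "?h ` {..<m} \<subseteq> l" using bm D1 by (auto simp: \<mu>_def mem_double_rows[OF l])
    moreover have "card (?h ` {..<m}) = card l" using card_image[OF inj_h] by (simp add: m_def)
    ultimately show ?thesis
      unfolding bij_betw_def using card_subset_eq[OF young_diagram_finite[OF l]] by blast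
  qed
  then have "f_content (real n) l =
    (\<Prod>i<m. real n + 2 * real ((col (2 * i + 1) + 1) div 2) - real (row (2 * i + 1)) - 2)"
    unfolding f_content_def by (subst prod.reindex_bij_betw[symmetric]) (assumption, simp)
  also have "\<dots> = (\<Prod>i<m. real n - 1 + ef.content (2 * i + 1))"
  proof (rule prod.cong)
    fix i assume "i \<in> {..<m}"
    then have "odd (col (2 * i + 1))" by (intro odd_col) (auto simp: D_def)
    then obtain j where "col (2 * i + 1) = 2 * j + 1" by (rule oddE)
    then show "real n + 2 * real ((col (2 * i + 1) + 1) div 2) - real (row (2 * i + 1)) - 2 =
        real n - 1 + ef.content (2 * i + 1)"
      by (simp add: ef.content_def)
  qed simp
  finally have g: "f_content (real n) l = (\<Prod>i<m. real n - 1 + ef.content (2 * i + 1))" .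
  have cont: "ef.content k = label_content \<mu> T k" for k
    by (subst ef.content_def) (simp add: label_content_def row_def col_def)
  have "tableau_vector n m (f_content (real n) l) \<mu> T ef.young_vector"
    unfolding tableau_vector_def
    using ef.young_vector_support ef.young_vector_nonzero ef.jm_young_vector ef.gram_op_young_vector[OF n] g cont
    unfolding D_def by auto
  then show ?thesis unfolding m_def \<mu>_def by blast
qed

section \<open>Intertwiners between tableaux of the same shape\<close>

lemma comp_tr: "bij w \<Longrightarrow> w \<circ> tr a b = tr (w a) (w b) \<circ> w"
  by (auto simp: fun_eq_iff Transposition.transpose_def bij_def inj_eq)

lemma relabel_tr_conj: "relabel (tr a b) (relabel (tr x y) q) = relabel (tr x y) (relabel (tr (tr x y a) (tr x y b)) q)"
proof -
  have "tr x y \<circ> tr (tr x y a) (tr x y b) = tr a b \<circ> tr x y"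
    using comp_tr[of "tr x y" "tr x y a" "tr x y b"] by simp
  then show ?thesis by (simp flip: relabel_comp)
qed

text \<open>
  The relations of the degenerate affine Hecke algebra between a simple transposition and the
  Jucys-Murphy elements.
\<close>

lemma jm_swap:
  fixes k :: nat
  assumes "1 \<le> k"
  defines "s \<equiv> tr k (k + 1)"
  shows "jm k (\<lambda>q. \<phi> (relabel s q)) q = jm (k + 1) \<phi> (relabel s q) - \<phi> q"
    and "jm (k + 1) (\<lambda>q. \<phi> (relabel s q)) q = jm k \<phi> (relabel s q) + \<phi> q"
    and "l \<noteq> k \<Longrightarrow> l \<noteq> k + 1 \<Longrightarrow> jm l (\<lambda>q. \<phi> (relabel s q)) q = jm l \<phi> (relabel s q)"
proof -
  have set: "{1..<k + 1} = insert k {1..<k}" using assms by auto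
  have c1: "relabel (tr l (k + 1)) (relabel s q) = relabel s (relabel (tr l k) q)" if "l \<in> {1..<k}" for l q
    unfolding s_def using that relabel_tr_conj[of l "k + 1" k "k + 1" q] by simp
  have c2: "relabel (tr l k) (relabel s q) = relabel s (relabel (tr l (k + 1)) q)" if "l \<in> {1..<k}" for l q
    unfolding s_def using that relabel_tr_conj[of l k k "k + 1" q] by simp
  show "jm k (\<lambda>q. \<phi> (relabel s q)) q = jm (k + 1) \<phi> (relabel s q) - \<phi> q"
    unfolding jm_def set using c1 by (simp add: s_def relabel_tr_involutory)
  show "jm (k + 1) (\<lambda>q. \<phi> (relabel s q)) q = jm k \<phi> (relabel s q) + \<phi> q"
    unfolding jm_def set using c2 by (simp add: s_def relabel_tr_involutory)
  assume l: "l \<noteq> k" "l \<noteq> k + 1"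
  have sl: "s l = l" using l by (simp add: s_def)
  have "jm l \<phi> (relabel s q) = (\<Sum>j\<in>{1..<l}. \<phi> (relabel s (relabel (tr (s j) l) q)))"
    unfolding jm_def
  proof (rule sum.cong)
    fix j
    show "\<phi> (relabel (tr j l) (relabel s q)) = \<phi> (relabel s (relabel (tr (s j) l) q))"
      using relabel_tr_conj[of j l k "k + 1" q] sl by (simp add: s_def)
  qed simp
  also have "\<dots> = (\<Sum>j\<in>{1..<l}. \<phi> (relabel s (relabel (tr j l) q)))"
  proof (rule sum.reindex_bij_betw[of s])
    have "s permutes {1..<l}" if "k < l"
      unfolding s_def using assms that l by (intro permutes_swap_id) auto
    moreover have "s j = j" if "\<not> k < l" "j \<in> {1..<l}" for j
      using that l by (auto simp: s_def)
    ultimately show "bij_betw s {1..<l} {1..<l}"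
      using bij_betw_cong[of "{1..<l}" s id "{1..<l}"] by (cases "k < l") (auto simp: permutes_imp_bij)
  qed
  finally show "jm l (\<lambda>q. \<phi> (relabel s q)) q = jm l \<phi> (relabel s q)"
    unfolding jm_def by simp
qed

lemma jm_diff_scale: "jm k (\<lambda>q. \<phi> q - \<psi> q / a) q = jm k \<phi> q - jm k \<psi> q / a"
  by (simp add: jm_def sum_subtractf sum_divide_distrib)

text \<open>
  Young's intertwiner: \<open>w\<close> is \<open>v\<close> acted on by the transposition \<open>(k k+1)\<close> minus \<open>1 / (b - a)\<close>. It exchanges
  the eigenvalues at \<open>k\<close> and \<open>k + 1\<close>. If \<open>w\<close> were zero, the transposition would act on \<open>v\<close> as
  \<open>1 / (b - a)\<close>; being an involution, it would force \<open>b - a\<close> to be \<open>1\<close> or \<open>-1\<close>.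
\<close>

lemma swap_tableau_vector:
  assumes v: "tableau_vector n m g l T' v" and k: "1 \<le> k" "k + 1 \<le> 2 * m"
    and a: "label_content l T' k = a" and b: "label_content l T' (k + 1) = b" and ab: "1 < \<bar>b - a\<bar>"
    and swap: "label_content l T k = b" "label_content l T (k + 1) = a"
      "\<And>x. x \<in> {1..2 * m} \<Longrightarrow> x \<noteq> k \<Longrightarrow> x \<noteq> k + 1 \<Longrightarrow> label_content l T x = label_content l T' x"
  shows "\<exists>w. tableau_vector n m g l T w"
proof -
  define s where "s = tr k (k + 1)"
  define w where "w = (\<lambda>q. v (relabel s q) - v q / (b - a))"
  have ne: "b - a \<noteq> 0" using ab by auto
  have s: "s permutes {1..2 * m}" unfolding s_def using k by (intro permutes_swap_id) auto
  have ss: "relabel s (relabel s q) = q" for q by (simp add: s_def relabel_tr_involutory)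
  have supp: "v q \<noteq> 0 \<Longrightarrow> q \<in> pairings {1..2 * m}" for q using v by (auto simp: tableau_vector_def)
  obtain q0 where q0: "v q0 \<noteq> 0" using v by (auto simp: tableau_vector_def)
  have jmv: "jm x v q = label_content l T' x * v q" if "x \<in> {1..2 * m}" for x q
    using v that by (auto simp: tableau_vector_def)
  have kin: "k \<in> {1..2 * m}" "k + 1 \<in> {1..2 * m}" using k by auto
  have "\<exists>q. w q \<noteq> 0"
  proof (rule ccontr)
    assume "\<not> ?thesis"
    then have eq: "v (relabel s q) = v q / (b - a)" for q by (simp add: w_def)
    have "v q0 = v q0 / (b - a) / (b - a)" using eq[of "relabel s q0"] eq[of q0] ss[of q0] by simp
    moreover have "v q0 / (b - a) / (b - a) * ((b - a) * (b - a)) = v q0" using ne by simp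
    ultimately have "v q0 * ((b - a) * (b - a)) = v q0" by metis
    then have "(b - a) * (b - a) = 1" using q0 by simp
    then have "b - a = 1 \<or> b - a = - 1" by (simp only: square_eq_1_iff)
    then show False using ab by auto
  qed
  moreover have "w q \<noteq> 0 \<Longrightarrow> q \<in> pairings {1..2 * m}" for q
    using supp[of q] supp[of "relabel s q"] pairings_relabel_iff[OF s, of q]
    by (cases "v q = 0"; cases "v (relabel s q) = 0") (simp_all add: w_def)
  moreover have "gram_op n {1..2 * m} w q = g * w q" for q
  proof -
    have gv: "gram_op n {1..2 * m} v q = g * v q" for q using v by (auto simp: tableau_vector_def)
    have "gram_op n {1..2 * m} w q = gram_op n {1..2 * m} (\<lambda>q. \<Sum>i\<in>{True, False}.
        (if i then 1 else - 1 / (b - a)) * (if i then v (relabel s q) else v q)) q"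
      by (simp add: w_def)
    also have "\<dots> = (\<Sum>i\<in>{True, False}. (if i then 1 else - 1 / (b - a)) *
        gram_op n {1..2 * m} (\<lambda>q. if i then v (relabel s q) else v q) q)"
      by (rule gram_op_linear) simp
    also have "\<dots> = gram_op n {1..2 * m} (\<lambda>q. v (relabel s q)) q - gram_op n {1..2 * m} v q / (b - a)"
      by simp
    also have "\<dots> = g * w q"
      unfolding gram_op_relabel[OF s] gv by (simp add: w_def algebra_simps)
    finally show ?thesis .
  qed
  moreover have "jm x w q = label_content l T x * w q" if x: "x \<in> {1..2 * m}" for x q
  proof -
    consider "x = k" | "x = k + 1" | "x \<noteq> k" "x \<noteq> k + 1" by blast
    then show ?thesis
    proof cases
      case 1
      have "jm k w q = b * v (relabel s q) - v q - a * v q / (b - a)"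
        using jm_swap(1)[OF k(1), of v q] jmv[OF kin(1)] jmv[OF kin(2)] b
        by (simp add: w_def jm_diff_scale a s_def)
      also have "\<dots> = b * w q" using ne by (simp add: w_def field_simps)
      finally show ?thesis using 1 swap by simp
    next
      case 2
      have "jm (k + 1) w q = a * v (relabel s q) + v q - b * v q / (b - a)"
        using jm_swap(2)[OF k(1), of v q] jmv[OF kin(1)] jmv[OF kin(2)] b
        by (simp add: w_def jm_diff_scale a s_def)
      also have "\<dots> = a * w q" using ne by (simp add: w_def field_simps)
      finally show ?thesis using 2 swap by simp
    next
      case 3
      have "jm x w q = label_content l T' x * w q"
        using jm_swap(3)[OF k(1) 3, of v q] jmv[OF x]
        by (simp add: w_def jm_diff_scale s_def algebra_simps)
      then show ?thesis using swap(3)[OF x 3] by simp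
    qed
  qed
  ultimately show ?thesis unfolding tableau_vector_def by blast
qed

text \<open>
  If the rows of the labels do not increase weakly, some \<open>k + 1\<close> lies in a higher row than \<open>k\<close>. It then lies
  strictly to the right as well, so the contents differ by at least 2, and exchanging the two
  labels gives a tableau closer to reading order. The sum in the induction weights each row index
  by the number of labels still to come, and decreases under the exchange.
\<close>

lemma exists_tableau_vector:
  assumes l: "young_diagram l" and n: "1 \<le> n" and T: "T \<in> standard_young_tableaux (double_rows l)"
  shows "\<exists>v. tableau_vector n (card l) (f_content (real n) l) (double_rows l) T v"
  using T
proof (induction "\<Sum>b\<in>double_rows l. (2 * card l - T b) * fst b" arbitrary: T rule: less_induct)
  case less
  define m where "m = card l"
  define \<mu> where "\<mu> = double_rows l"
  have y\<mu>: "young_diagram \<mu>" using young_diagram_double_rows[OF l] by (simp add: \<mu>_def)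
  interpret tableau \<mu> T using less.prems y\<mu> by unfold_locales (simp_all add: \<mu>_def)
  have card\<mu>: "card \<mu> = 2 * m" and fin\<mu>: "finite \<mu>" using card_double_rows[OF l] by (simp_all add: \<mu>_def m_def)
  have tab: "tableau (double_rows l) T" using tableau_axioms by (simp add: \<mu>_def)
  let ?row = "\<lambda>k. fst (box_of \<mu> T k)"
  show ?case
  proof (cases "\<exists>k. 1 \<le> k \<and> k + 1 \<le> 2 * m \<and> ?row (k + 1) < ?row k")
    case False
    have mono: "1 \<le> x \<Longrightarrow> x + d \<le> 2 * m \<Longrightarrow> ?row x \<le> ?row (x + d)" for x d
    proof (induction d)
      case (Suc d)
      have "1 \<le> x + d \<and> x + d + 1 \<le> 2 * m" using Suc.prems by simp
      then have "\<not> ?row (x + d + 1) < ?row (x + d)" using False by blast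
      moreover have "?row x \<le> ?row (x + d)" using Suc by simp
      ultimately show ?case by simp
    qed simp
    show ?thesis
    proof (rule row_tableau_vector[OF l tab n])
      fix b b' assume b: "b \<in> double_rows l" "b' \<in> double_rows l" "fst b < fst b'"
      then have bm: "b \<in> \<mu>" "b' \<in> \<mu>" by (simp_all add: \<mu>_def)
      show "T b < T b'"
      proof (rule ccontr)
        assume "\<not> T b < T b'"
        then obtain d where "T b = T b' + d" using le_Suc_ex by (metis not_less)
        then have "?row (T b') \<le> ?row (T b)"
          using mono[of "T b'" d] T_range[OF bm(1)] T_range[OF bm(2)] card\<mu> by simp
        then show False using box_T[OF bm(1)] box_T[OF bm(2)] b(3) by simp
      qed
    qed
  next
    case True
    then obtain k where k: "1 \<le> k" "k + 1 \<le> 2 * m" and desc: "?row (k + 1) < ?row k" by blast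
    define b1 b2 where "b1 = box_of \<mu> T k" and "b2 = box_of \<mu> T (k + 1)"
    obtain i1 j1 where ij1: "b1 = (i1, j1)" by fastforce
    obtain i2 j2 where ij2: "b2 = (i2, j2)" by fastforce
    have kr: "k \<in> {1..card \<mu>}" "k + 1 \<in> {1..card \<mu>}" using k card\<mu> by auto
    have b12: "b1 \<in> \<mu>" "b2 \<in> \<mu>" "T b1 = k" "T b2 = k + 1"
      using box_mem[OF kr(1)] box_mem[OF kr(2)] T_box[OF kr(1)] T_box[OF kr(2)] by (simp_all add: b1_def b2_def)
    have ii: "i2 < i1" using desc ij1 ij2 by (simp add: b1_def b2_def)
    \<comment> \<open>otherwise \<open>k + 1\<close> would lie weakly above and to the left of \<open>k\<close>\<close>
    have jj: "j1 < j2"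
    proof (rule ccontr)
      assume "\<not> j1 < j2"
      then have "T b2 \<le> T b1" using T_mono[of i2 j2 i1 j1] b12 ii ij1 ij2 by simp
      then show False using b12 by simp
    qed
    define s where "s = tr k (k + 1)"
    define T' where "T' = restrict (s \<circ> T) \<mu>"
    have sp: "s permutes {1..card \<mu>}" unfolding s_def by (rule permutes_swap_id[OF kr])
    have s_less: "s x < s y" if "x < y" "\<not> (x = k \<and> y = k + 1)" for x y
      using that by (auto simp: s_def Transposition.transpose_def)
    have T'_less: "T' b < T' b'" if "b \<in> \<mu>" "b' \<in> \<mu>" "T b < T b'" "fst b \<le> fst b'" for b b'
    proof -
      have "\<not> (T b = k \<and> T b' = k + 1)"
        using that b12 T_inj[of b b1] T_inj[of b' b2] ii ij1 ij2 by auto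
      then show ?thesis using s_less[OF that(3)] that by (simp add: T'_def)
    qed
    have T'_syt: "T' \<in> standard_young_tableaux \<mu>"
    proof -
      have "bij_betw (s \<circ> T) \<mu> {1..card \<mu>}"
        using T_bij permutes_imp_bij[OF sp] by (rule bij_betw_trans)
      then have "bij_betw T' \<mu> {1..card \<mu>}"
        by (rule bij_betw_cong[THEN iffD1, rotated]) (simp add: T'_def)
      moreover have "T' \<in> extensional \<mu>" by (simp add: T'_def)
      ultimately show ?thesis
        using syt T'_less by (simp add: standard_young_tableaux_def)
    qed
    interpret t': tableau \<mu> T' using T'_syt y\<mu> by unfold_locales
    have box': "box_of \<mu> T' x = box_of \<mu> T (s x)" if x: "x \<in> {1..card \<mu>}" for x
    proof -
      have sx: "s x \<in> {1..card \<mu>}" using x permutes_in_image[OF sp] by blast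
      have "T' (box_of \<mu> T (s x)) = x"
        using box_mem[OF sx] T_box[OF sx] by (simp add: T'_def s_def)
      then show ?thesis using t'.box_T[OF box_mem[OF sx]] by simp
    qed
    have b12ne: "b1 \<noteq> b2" using b12 by auto
    have meas: "(\<Sum>b\<in>double_rows l. (2 * card l - T' b) * fst b) < (\<Sum>b\<in>double_rows l. (2 * card l - T b) * fst b)"
    proof -
      define \<nu> where "\<nu> = \<mu> - {b1, b2}"
      have \<mu>eq: "\<mu> = insert b1 (insert b2 \<nu>)" "finite \<nu>" "b1 \<notin> insert b2 \<nu>" "b2 \<notin> \<nu>"
        using b12 fin\<mu> b12ne by (auto simp: \<nu>_def)
      have same: "T' b = T b" if "b \<in> \<nu>" for b
      proof -
        have "b \<in> \<mu>" "b \<noteq> b1" "b \<noteq> b2" using that by (auto simp: \<nu>_def)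
        then have "b \<in> \<mu>" "T b \<noteq> k" "T b \<noteq> k + 1" using b12 T_inj[of b b1] T_inj[of b b2] by auto
        then show ?thesis by (simp add: T'_def s_def)
      qed
      have T'b: "T' b1 = k + 1" "T' b2 = k" using b12 by (simp_all add: T'_def s_def)
      define d where "d = 2 * m - (k + 1)"
      have d: "2 * m - k = Suc d" "2 * m - Suc k = d" using k by (simp_all add: d_def)
      have e1: "(\<Sum>b\<in>\<mu>. (2 * m - T' b) * fst b) = d * i1 + (Suc d * i2 + (\<Sum>b\<in>\<nu>. (2 * m - T b) * fst b))"
        unfolding \<mu>eq(1) using \<mu>eq(2-) T'b same d by (simp add: ij1 ij2 del: mult_Suc)
      have e2: "(\<Sum>b\<in>\<mu>. (2 * m - T b) * fst b) = Suc d * i1 + (d * i2 + (\<Sum>b\<in>\<nu>. (2 * m - T b) * fst b))"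
        unfolding \<mu>eq(1) using \<mu>eq(2-) b12 d by (simp add: ij1 ij2 del: mult_Suc)
      show ?thesis
        using e1 e2 ii by (simp add: \<mu>_def m_def)
    qed
    obtain v where v: "tableau_vector n m (f_content (real n) l) \<mu> T' v"
      using less.hyps[OF meas] T'_syt by (auto simp: \<mu>_def m_def)
    have lc: "label_content \<mu> T' x = label_content \<mu> T (s x)" if "x \<in> {1..2 * m}" for x
      using box'[of x] that card\<mu> by (simp add: label_content_def)
    have "\<exists>w. tableau_vector n m (f_content (real n) l) \<mu> T w"
    proof (rule swap_tableau_vector[OF v k])
      show "label_content \<mu> T' k = label_content \<mu> T (k + 1)" using lc[of k] k by (simp add: s_def)
      show "label_content \<mu> T' (k + 1) = label_content \<mu> T k" using lc[of "k + 1"] k by (simp add: s_def)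
      show "label_content \<mu> T x = label_content \<mu> T' x" if "x \<in> {1..2 * m}" "x \<noteq> k" "x \<noteq> k + 1" for x
        using lc[OF that(1)] that by (simp add: s_def)
      have "label_content \<mu> T k = real j1 - real i1" "label_content \<mu> T (k + 1) = real j2 - real i2"
        using ij1 ij2 by (simp_all add: label_content_def b1_def b2_def)
      then show "1 < \<bar>label_content \<mu> T k - label_content \<mu> T (k + 1)\<bar>" using ii jj by linarith
    qed simp_all
    then show ?thesis by (simp add: \<mu>_def m_def)
  qed
qed

section \<open>Counting standard tableaux with even rows\<close>

definition corners :: "(nat \<times> nat) set \<Rightarrow> (nat \<times> nat) set" where
  "corners l = {c \<in> l. young_diagram (l - {c})}"

definition addable :: "(nat \<times> nat) set \<Rightarrow> (nat \<times> nat) set" where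
  "addable l = {b. b \<notin> l \<and> young_diagram (insert b l)}"

lemma young_diagram_Int: "young_diagram l \<Longrightarrow> young_diagram l' \<Longrightarrow> young_diagram (l \<inter> l')"
  by (rule young_diagramI) (use young_diagram_finite young_diagram_pos young_diagram_down in blast)+

lemma young_diagram_Un: "young_diagram l \<Longrightarrow> young_diagram l' \<Longrightarrow> young_diagram (l \<union> l')"
  by (rule young_diagramI) (use young_diagram_finite young_diagram_pos young_diagram_down in blast)+

lemma corners_iff:
  assumes l: "young_diagram l"
  shows "(i, j) \<in> corners l \<longleftrightarrow> (i, j) \<in> l \<and> (i + 1, j) \<notin> l \<and> (i, j + 1) \<notin> l"
proof
  assume c: "(i, j) \<in> corners l"
  then have y: "young_diagram (l - {(i, j)})" and m: "(i, j) \<in> l" by (auto simp: corners_def)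
  have "(i', j') \<notin> l - {(i, j)}" if "i \<le> i'" "j \<le> j'" for i' j'
    using young_diagram_down[OF y, of i' j' i j] that young_diagram_pos[OF l m] by auto
  from this[of "i + 1" j] this[of i "j + 1"]
  show "(i, j) \<in> l \<and> (i + 1, j) \<notin> l \<and> (i, j + 1) \<notin> l" using m by auto
next
  assume c: "(i, j) \<in> l \<and> (i + 1, j) \<notin> l \<and> (i, j + 1) \<notin> l"
  then have pos: "1 \<le> i" "1 \<le> j" using young_diagram_pos[OF l] by auto
  have "young_diagram (l - {(i, j)})"
  proof (rule young_diagramI)
    show "finite (l - {(i, j)})" using young_diagram_finite[OF l] by simp
    fix a b assume ab: "(a, b) \<in> l - {(i, j)}"
    show "1 \<le> a \<and> 1 \<le> b" using young_diagram_pos[OF l] ab by blast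
    fix a' b' assume le: "1 \<le> a'" "a' \<le> a" "1 \<le> b'" "b' \<le> b"
    have "(a', b') \<noteq> (i, j)"
    proof
      assume eq: "(a', b') = (i, j)"
      then have "i + 1 \<le> a \<or> j + 1 \<le> b" using ab le by auto
      then show False
        using young_diagram_down[OF l, of a b "i + 1" j] young_diagram_down[OF l, of a b i "j + 1"]
          c ab le eq pos by auto
    qed
    then show "(a', b') \<in> l - {(i, j)}" using young_diagram_down[OF l, of a b a' b'] ab le by auto
  qed
  then show "(i, j) \<in> corners l" using c by (simp add: corners_def)
qed

lemma addable_iff:
  assumes l: "young_diagram l"
  shows "(i, j) \<in> addable l \<longleftrightarrow> (i, j) \<notin> l \<and> 1 \<le> i \<and> 1 \<le> j \<and>
    (i = 1 \<or> (i - 1, j) \<in> l) \<and> (j = 1 \<or> (i, j - 1) \<in> l)"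
proof
  assume a: "(i, j) \<in> addable l"
  then have y: "young_diagram (insert (i, j) l)" and m: "(i, j) \<notin> l" by (auto simp: addable_def)
  have pos: "1 \<le> i \<and> 1 \<le> j" using young_diagram_pos[OF y] by blast
  moreover have "(i - 1, j) \<in> l" if "i \<noteq> 1"
  proof -
    have "(i - 1, j) \<in> insert (i, j) l"
      by (rule young_diagram_down[OF y, of i j]) (use pos that in auto)
    moreover have "(i - 1, j) \<noteq> (i, j)" using pos by auto
    ultimately show ?thesis by blast
  qed
  moreover have "(i, j - 1) \<in> l" if "j \<noteq> 1"
  proof -
    have "(i, j - 1) \<in> insert (i, j) l"
      by (rule young_diagram_down[OF y, of i j]) (use pos that in auto)
    moreover have "(i, j - 1) \<noteq> (i, j)" using pos by auto
    ultimately show ?thesis by blast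
  qed
  ultimately show "(i, j) \<notin> l \<and> 1 \<le> i \<and> 1 \<le> j \<and>
    (i = 1 \<or> (i - 1, j) \<in> l) \<and> (j = 1 \<or> (i, j - 1) \<in> l)" using m by auto
next
  assume a: "(i, j) \<notin> l \<and> 1 \<le> i \<and> 1 \<le> j \<and> (i = 1 \<or> (i - 1, j) \<in> l) \<and> (j = 1 \<or> (i, j - 1) \<in> l)"
  have "young_diagram (insert (i, j) l)"
  proof (rule young_diagramI)
    show "finite (insert (i, j) l)" using young_diagram_finite[OF l] by simp
    fix a' b' assume ab: "(a', b') \<in> insert (i, j) l"
    then show "1 \<le> a' \<and> 1 \<le> b'" using young_diagram_pos[OF l] a by blast
    fix a'' b'' assume le: "1 \<le> a''" "a'' \<le> a'" "1 \<le> b''" "b'' \<le> b'"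
    show "(a'', b'') \<in> insert (i, j) l"
    proof (cases "(a', b') = (i, j)")
      case False
      then show ?thesis using young_diagram_down[OF l, of a' b' a'' b''] ab le by auto
    next
      case True
      consider "(a'', b'') = (i, j)" | "a'' < i" | "b'' < j" using True le by force
      then show ?thesis
      proof cases
        case 2
        then have "(i - 1, j) \<in> l" using a le by auto
        then show ?thesis using young_diagram_down[OF l, of "i - 1" j a'' b''] le True 2 by auto
      next
        case 3
        then have "(i, j - 1) \<in> l" using a le by auto
        then show ?thesis using young_diagram_down[OF l, of i "j - 1" a'' b''] le True 3 by auto
      qed simp
    qed
  qed
  then show "(i, j) \<in> addable l" using a by (simp add: addable_def)
qed

lemma finite_corners: "young_diagram l \<Longrightarrow> finite (corners l)"
  using young_diagram_finite by (auto simp: corners_def)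

text \<open>
  The row below a corner admits a new box, and apart from the first row every row that admits one
  arises in this way.
\<close>

lemma addable_card_corners:
  assumes l: "young_diagram l"
  shows "finite (addable l)" "card (addable l) = card (corners l) + 1"
proof -
  define r where "r = row_length l"
  define I where "I = {i. 1 \<le> i \<and> r (i + 1) < r i}"
  have mem: "(i, j) \<in> l \<longleftrightarrow> 1 \<le> j \<and> j \<le> r i" for i j
    unfolding r_def by (rule mem_iff_row_length[OF l])
  have pos: "1 \<le> i" if "1 \<le> r i" for i using young_diagram_pos[OF l, of i 1] mem that by blast
  have anti: "r (i + 1) \<le> r i" if "1 \<le> i" for i
  proof (cases "r (i + 1) = 0")
    case False
    then have "(i + 1, r (i + 1)) \<in> l" unfolding mem by simp
    then have "(i, r (i + 1)) \<in> l" using young_diagram_down[OF l, of "i + 1" "r (i + 1)" i] that False by simp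
    then show ?thesis unfolding mem by simp
  qed simp
  have cor: "corners l = (\<lambda>i. (i, r i)) ` I"
  proof -
    have "(i, j) \<in> corners l \<longleftrightarrow> (i, j) \<in> (\<lambda>i. (i, r i)) ` I" for i j
      using pos[of i] unfolding corners_iff[OF l] mem I_def by (auto simp: image_iff)
    then show ?thesis by auto
  qed
  have add: "addable l = insert (1, r 1 + 1) ((\<lambda>i. (i + 1, r (i + 1) + 1)) ` I)"
  proof -
    have "(i, j) \<in> addable l \<longleftrightarrow> (i, j) \<in> insert (1, r 1 + 1) ((\<lambda>i. (i + 1, r (i + 1) + 1)) ` I)" for i j
    proof -
      consider "i = 0" | "i = 1" | i' where "i = i' + 1" "1 \<le> i'"
        by (metis One_nat_def Suc_eq_plus1 Suc_leI gr0I not0_implies_Suc)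
      then show ?thesis
      proof cases
        case 1
        then show ?thesis unfolding addable_iff[OF l] by auto
      next
        case 2
        show ?thesis unfolding addable_iff[OF l] mem I_def 2 by (auto simp: image_iff)
      next
        case 3
        show ?thesis unfolding addable_iff[OF l] mem I_def 3(1) using 3(2) anti[OF 3(2)] by (auto simp: image_iff)
      qed
    qed
    then show ?thesis by auto
  qed
  have finI: "finite I"
  proof (rule finite_subset)
    show "I \<subseteq> fst ` l"
    proof
      fix i assume "i \<in> I"
      then have "(i, r i) \<in> l" unfolding mem by (auto simp: I_def)
      then show "i \<in> fst ` l" by force
    qed
  qed (use young_diagram_finite[OF l] in simp)
  show "finite (addable l)" unfolding add using finI by simp
  have "card (addable l) = card ((\<lambda>i. (i + 1, r (i + 1) + 1)) ` I) + 1"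
    unfolding add using finI by (subst card_insert_disjoint) (auto simp: I_def)
  also have "card ((\<lambda>i. (i + 1, r (i + 1) + 1)) ` I) = card I" by (rule card_image) (auto simp: inj_on_def)
  also have "card I = card (corners l)" unfolding cor by (rule card_image[symmetric]) (auto simp: inj_on_def)
  finally show "card (addable l) = card (corners l) + 1" .
qed

lemma finite_syt: "finite l \<Longrightarrow> finite (standard_young_tableaux l)"
proof (rule finite_subset)
  show "standard_young_tableaux l \<subseteq> l \<rightarrow>\<^sub>E {1..card l}"
    by (auto simp: standard_young_tableaux_def PiE_def bij_betw_def)
qed (simp add: finite_PiE)

text \<open>
  The largest label of a standard tableau sits in a corner.
\<close>

lemma num_SYT_branching:
  assumes l: "young_diagram l" and ne: "l \<noteq> {}"
  shows "num_SYT l = (\<Sum>c\<in>corners l. num_SYT (l - {c}))"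
proof -
  define N where "N = card l"
  have fin: "finite l" using l by (rule young_diagram_finite)
  have N: "N \<ge> 1" using fin ne by (simp add: N_def Suc_le_eq card_gt_0_iff)
  define X where "X = (SIGMA c:corners l. standard_young_tableaux (l - {c}))"
  define F where "F = (\<lambda>(c, S :: nat \<times> nat \<Rightarrow> nat). S(c := N))"
  have sub: "tableau (l - {c}) S" "c \<in> l" "card (l - {c}) = N - 1" if "(c, S) \<in> X" for c S
    using that fin by (auto simp: X_def corners_def tableau_def N_def)
  have inj: "inj_on F X"
  proof (rule inj_onI, clarify)
    fix c S c' S' assume x: "(c, S) \<in> X" "(c', S') \<in> X" "F (c, S) = F (c', S')"
    interpret s: tableau "l - {c}" S by (rule sub[OF x(1)])
    interpret s': tableau "l - {c'}" S' by (rule sub[OF x(2)])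
    have eq: "S(c := N) = S'(c' := N)" using x by (simp add: F_def)
    have cc: "c = c'"
    proof (rule ccontr)
      assume "c \<noteq> c'"
      then have "S' c = N" using fun_cong[OF eq, of c] by simp
      moreover have "S' c \<in> {1..N - 1}" using s'.T_range[of c] sub[OF x(2)] sub(2)[OF x(1)] \<open>c \<noteq> c'\<close> by auto
      ultimately show False using N by simp
    qed
    have "S b = S' b" for b
    proof (cases "b = c")
      case True
      then show ?thesis using extensional_arb[OF s.T_ext, of b] extensional_arb[OF s'.T_ext, of b] cc by simp
    next
      case False
      then show ?thesis using fun_cong[OF eq, of b] cc by simp
    qed
    then show "c = c' \<and> S = S'" using cc by auto
  qed
  have img: "F ` X = standard_young_tableaux l"
  proof
    show "F ` X \<subseteq> standard_young_tableaux l"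
    proof clarify
      fix c S assume x: "(c, S) \<in> X"
      interpret s: tableau "l - {c}" S by (rule sub[OF x])
      have c: "c \<in> l" "card (l - {c}) = N - 1" using sub[OF x] by auto
      have less: "S b < N" if "b \<in> l" "b \<noteq> c" for b using s.T_range[of b] that c N by auto
      define U where "U = S(c := N)"
      have U: "U c = N" "\<And>b. b \<noteq> c \<Longrightarrow> U b = S b" by (simp_all add: U_def)
      have "bij_betw U (l - {c}) {1..N - 1}"
        using s.T_bij c(2) bij_betw_cong[of "l - {c}" U S "{1..N - 1}"] U by simp
      then have "bij_betw U (l - {c} \<union> {c}) ({1..N - 1} \<union> {U c})"
        using N U(1) by (intro notIn_Un_bij_betw) auto
      moreover have "l - {c} \<union> {c} = l" "{1..N - 1} \<union> {U c} = {1..N}" using c N U(1) by auto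
      ultimately have bij: "bij_betw U l {1..N}" by simp
      have ext: "U \<in> extensional l" using s.T_ext c(1) by (auto simp: U_def extensional_def)
      have cc: "c \<in> corners l" using x by (simp add: X_def)
      have "U (i, j) < U (i, j + 1)" if ij: "(i, j) \<in> l" "(i, j + 1) \<in> l" for i j
      proof -
        have nc: "(i, j) \<noteq> c" using cc ij corners_iff[OF l, of i j] by auto
        show ?thesis
        proof (cases "(i, j + 1) = c")
          case True
          then show ?thesis using U less[OF ij(1) nc] nc by simp
        next
          case False
          then show ?thesis using U(2)[OF nc] U(2)[OF False] s.syt nc ij
            by (simp add: standard_young_tableaux_def)
        qed
      qed
      moreover have "U (i, j) < U (i + 1, j)" if ij: "(i, j) \<in> l" "(i + 1, j) \<in> l" for i j
      proof -
        have nc: "(i, j) \<noteq> c" using cc ij corners_iff[OF l, of i j] by auto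
        show ?thesis
        proof (cases "(i + 1, j) = c")
          case True
          then show ?thesis using U less[OF ij(1) nc] nc by simp
        next
          case False
          then show ?thesis using U(2)[OF nc] U(2)[OF False] s.syt nc ij
            by (simp add: standard_young_tableaux_def)
        qed
      qed
      ultimately have "U \<in> standard_young_tableaux l"
        using bij ext unfolding standard_young_tableaux_def N_def by blast
      then show "F (c, S) \<in> standard_young_tableaux l" by (simp add: F_def U_def)
    qed
    show "standard_young_tableaux l \<subseteq> F ` X"
    proof
      fix T assume T: "T \<in> standard_young_tableaux l"
      interpret t: tableau l T using l T by unfold_locales
      define c where "c = box_of l T N"
      have Nr: "N \<in> {1..card l}" using N by (simp add: N_def)
      have c: "c \<in> l" "T c = N" unfolding c_def using t.box_mem[OF Nr] t.T_box[OF Nr] by auto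
      obtain i j where ij: "c = (i, j)" by fastforce
      have top: "(i', j') \<notin> l" if "i \<le> i'" "j \<le> j'" "(i', j') \<noteq> c" for i' j'
      proof
        assume "(i', j') \<in> l"
        then show False
          using t.T_strict_mono[of i j i' j'] t.T_range[of "(i', j')"] that c ij by (auto simp: N_def)
      qed
      have cc: "c \<in> corners l" unfolding ij corners_iff[OF l] using c top ij by auto
      define S where "S = restrict T (l - {c})"
      have card1: "card (l - {c}) = N - 1" using c fin by (simp add: N_def)
      have "bij_betw T (l - {c}) ({1..N} - {N})"
        using t.T_bij c N by (auto simp: bij_betw_def inj_on_def N_def)
      moreover have "{1..N} - {N} = {1..card (l - {c})}" unfolding card1 using N by auto
      ultimately have "bij_betw S (l - {c}) {1..card (l - {c})}"
        using bij_betw_cong[of "l - {c}" S T "{1..card (l - {c})}"] by (simp add: S_def)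
      moreover have "S \<in> extensional (l - {c})" by (simp add: S_def)
      ultimately have "S \<in> standard_young_tableaux (l - {c})"
        using T by (simp add: standard_young_tableaux_def S_def)
      then have "(c, S) \<in> X" using cc by (simp add: X_def)
      moreover have "F (c, S) = T"
        using c t.T_ext by (auto simp: F_def S_def fun_eq_iff restrict_def extensional_def)
      ultimately show "T \<in> F ` X" by (metis image_eqI)
    qed
  qed
  have "num_SYT l = card X" using card_image[OF inj] img by (simp add: num_SYT_def)
  also have "\<dots> = (\<Sum>c\<in>corners l. num_SYT (l - {c}))"
    unfolding X_def num_SYT_def using finite_corners[OF l] fin by (subst card_SigmaI) (auto intro: finite_syt)
  finally show ?thesis .
qed

text \<open>
  Young's lattice is a differential poset: adding one box and removing a different one commute, and
  there is one more way to add a box than to remove one. Both families of pairs of boxes are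
  compared after expanding the sums by \<open>num_SYT_branching\<close> and by the induction hypothesis.
\<close>

lemma num_SYT_up:
  assumes "young_diagram l"
  shows "(\<Sum>b\<in>addable l. num_SYT (insert b l)) = (card l + 1) * num_SYT l"
  using assms
proof (induction "card l" arbitrary: l)
  case (0 l)
  then have l0: "l = {}" using young_diagram_finite by auto
  have "(i, j) \<in> addable l \<longleftrightarrow> (i, j) = (1, 1)" for i j
    using addable_iff[OF 0(2), of i j] unfolding l0 by auto
  then have add: "addable l = {(1, 1)}" by auto
  have y1: "young_diagram {(1, 1)}" using add l0 by (auto simp: addable_def)
  have "corners {(1, 1)} = {(1, 1)}" using 0(2) l0 by (auto simp: corners_def)
  then have "num_SYT {(1, 1)} = num_SYT {}" using num_SYT_branching[OF y1] by simp
  then show ?case using add l0 by simp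
next
  case (Suc N l)
  note l = Suc.prems
  have fin: "finite l" using l by (rule young_diagram_finite)
  have ne: "l \<noteq> {}" using Suc.hyps(2) by auto
  define X where "X = (SIGMA b:addable l. corners (insert b l) - {b})"
  define Y where "Y = (SIGMA c:corners l. addable (l - {c}) - {c})"
  have fadd: "finite (addable l)" by (rule addable_card_corners[OF l])
  have yadd: "young_diagram (insert b l)" "b \<notin> l" if "b \<in> addable l" for b using that by (auto simp: addable_def)
  have ycor: "young_diagram (l - {c})" "c \<in> l" if "c \<in> corners l" for c using that by (auto simp: corners_def)
  \<comment> \<open>the diagrams are closed under intersection and union\<close>
  have XY: "(b, c) \<in> X \<longleftrightarrow> (c, b) \<in> Y" for b c
  proof
    assume "(b, c) \<in> X"
    then have b: "b \<notin> l" "young_diagram (insert b l)" and c: "c \<in> l" "c \<noteq> b" "young_diagram (insert b l - {c})"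
      by (auto simp: X_def addable_def corners_def)
    have "l - {c} = l \<inter> (insert b l - {c})" using b by auto
    then have "young_diagram (l - {c})" using young_diagram_Int[OF l c(3)] by simp
    moreover have "insert b (l - {c}) = insert b l - {c}" using c by auto
    ultimately show "(c, b) \<in> Y" using b c by (auto simp: Y_def addable_def corners_def)
  next
    assume "(c, b) \<in> Y"
    then have b: "b \<notin> l" "b \<noteq> c" "young_diagram (insert b (l - {c}))" and c: "c \<in> l" "young_diagram (l - {c})"
      by (auto simp: Y_def addable_def corners_def)
    have "insert b l = l \<union> insert b (l - {c})" by auto
    then have "young_diagram (insert b l)" using young_diagram_Un[OF l b(3)] by simp
    moreover have "insert b (l - {c}) = insert b l - {c}" using b by auto
    ultimately show "(b, c) \<in> X" using b c by (auto simp: X_def addable_def corners_def)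
  qed
  have "(\<Sum>b\<in>addable l. num_SYT (insert b l)) =
      (\<Sum>b\<in>addable l. num_SYT l + (\<Sum>c\<in>corners (insert b l) - {b}. num_SYT (insert b l - {c})))"
  proof (rule sum.cong)
    fix b assume b: "b \<in> addable l"
    have bc: "b \<in> corners (insert b l)" using yadd[OF b] l by (simp add: corners_def)
    show "num_SYT (insert b l) = num_SYT l + (\<Sum>c\<in>corners (insert b l) - {b}. num_SYT (insert b l - {c}))"
    proof -
      have "num_SYT (insert b l) = (\<Sum>c\<in>corners (insert b l). num_SYT (insert b l - {c}))"
        by (rule num_SYT_branching[OF yadd(1)[OF b]]) simp
      also have "\<dots> = num_SYT (insert b l - {b}) + (\<Sum>c\<in>corners (insert b l) - {b}. num_SYT (insert b l - {c}))"
        by (rule sum.remove[OF finite_corners[OF yadd(1)[OF b]] bc])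
      also have "insert b l - {b} = l" using yadd(2)[OF b] by simp
      finally show ?thesis .
    qed
  qed simp
  also have "\<dots> = card (addable l) * num_SYT l + (\<Sum>(b, c)\<in>X. num_SYT (insert b l - {c}))"
    unfolding X_def using fadd finite_corners[OF yadd(1)]
    by (subst sum.Sigma[symmetric]) (auto simp: sum.distrib)
  also have "(\<Sum>(b, c)\<in>X. num_SYT (insert b l - {c})) = (\<Sum>(c, b)\<in>Y. num_SYT (insert b (l - {c})))"
  proof (rule sum.reindex_bij_witness[of _ "\<lambda>(c, b). (b, c)" "\<lambda>(b, c). (c, b)"])
    fix x assume "x \<in> X"
    then obtain b c where x: "x = (b, c)" and "c \<noteq> b" by (auto simp: X_def)
    then have "insert b (l - {c}) = insert b l - {c}" by auto
    then show "(case case x of (b, c) \<Rightarrow> (c, b) of (c, b) \<Rightarrow> num_SYT (insert b (l - {c}))) =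
       (case x of (b, c) \<Rightarrow> num_SYT (insert b l - {c}))"
      by (simp only: x prod.case)
  qed (use XY in auto)
  finally have 1: "(\<Sum>b\<in>addable l. num_SYT (insert b l)) =
      card (addable l) * num_SYT l + (\<Sum>(c, b)\<in>Y. num_SYT (insert b (l - {c})))" .
  have "Suc N * num_SYT l = (\<Sum>c\<in>corners l. Suc N * num_SYT (l - {c}))"
    using num_SYT_branching[OF l ne] by (simp only: sum_distrib_left)
  also have "\<dots> = (\<Sum>c\<in>corners l. num_SYT l + (\<Sum>b\<in>addable (l - {c}) - {c}. num_SYT (insert b (l - {c}))))"
  proof (rule sum.cong)
    fix c assume c: "c \<in> corners l"
    have cardc: "N = card (l - {c})" using Suc.hyps(2) ycor[OF c] fin by simp
    have "c \<in> addable (l - {c})" using ycor[OF c] l by (simp add: addable_def insert_absorb)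
    then have "(\<Sum>b\<in>addable (l - {c}). num_SYT (insert b (l - {c}))) =
       num_SYT (insert c (l - {c})) + (\<Sum>b\<in>addable (l - {c}) - {c}. num_SYT (insert b (l - {c})))"
      by (intro sum.remove addable_card_corners[OF ycor(1)[OF c]])
    moreover have "insert c (l - {c}) = l" using ycor[OF c] by auto
    ultimately show "Suc N * num_SYT (l - {c}) =
        num_SYT l + (\<Sum>b\<in>addable (l - {c}) - {c}. num_SYT (insert b (l - {c})))"
      using Suc.hyps(1)[OF cardc ycor(1)[OF c]] cardc[symmetric] by simp
  qed simp
  also have "\<dots> = card (corners l) * num_SYT l + (\<Sum>(c, b)\<in>Y. num_SYT (insert b (l - {c})))"
    unfolding Y_def using finite_corners[OF l] addable_card_corners(1)[OF ycor(1)]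
    by (subst sum.Sigma[symmetric]) (auto simp: sum.distrib)
  finally have 2: "Suc N * num_SYT l =
      card (corners l) * num_SYT l + (\<Sum>(c, b)\<in>Y. num_SYT (insert b (l - {c})))" .
  show ?case
    using 1 2 addable_card_corners(2)[OF l] Suc.hyps(2)[symmetric] by (simp add: algebra_simps)
qed

definition shapes :: "nat \<Rightarrow> (nat \<times> nat) set set" where
  "shapes m = {l. young_diagram l \<and> card l = m}"

lemma finite_shapes: "finite (shapes m)"
  by (rule finite_subset[OF _ finite_young_diagrams[of "2 * m"]]) (auto simp: shapes_def)

lemma corners_double_rows:
  assumes l: "young_diagram l"
  shows "corners (double_rows l) = (\<lambda>(i, j). (i, 2 * j)) ` corners l"
proof -
  have "(i, j) \<in> corners (double_rows l) \<longleftrightarrow> even j \<and> (i, j div 2) \<in> corners l" for i j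
    unfolding corners_iff[OF young_diagram_double_rows[OF l]] corners_iff[OF l] mem_double_rows[OF l]
    using young_diagram_pos[OF l, of i "j div 2"]
    by (cases "even j") (auto elim!: evenE oddE)
  then show ?thesis by (force simp: image_iff elim!: evenE)
qed

lemma addable_double_rows:
  assumes l: "young_diagram l"
  shows "addable (double_rows l) = (\<lambda>(i, j). (i, 2 * j - 1)) ` addable l"
proof -
  have *: "(i, j) \<in> addable (double_rows l) \<longleftrightarrow> odd j \<and> (i, (j + 1) div 2) \<in> addable l" for i j
  proof (cases "even j")
    case True
    then obtain j' where "j = 2 * j'" by (rule evenE)
    then show ?thesis
      unfolding addable_iff[OF young_diagram_double_rows[OF l]] mem_double_rows[OF l] by (cases j') auto
  next
    case False
    then obtain j' where j': "j = 2 * j' + 1" by (rule oddE)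
    show ?thesis
      unfolding addable_iff[OF young_diagram_double_rows[OF l]] addable_iff[OF l] mem_double_rows[OF l] j'
      by (cases "j' = 0") auto
  qed
  have pos: "1 \<le> j" if "(i, j) \<in> addable l" for i j using that addable_iff[OF l] by blast
  show ?thesis
  proof
    show "addable (double_rows l) \<subseteq> (\<lambda>(i, j). (i, 2 * j - 1)) ` addable l"
    proof clarify
      fix i j assume "(i, j) \<in> addable (double_rows l)"
      then have "odd j" "(i, (j + 1) div 2) \<in> addable l" using * by auto
      moreover have "j = 2 * ((j + 1) div 2) - 1" using \<open>odd j\<close> by (auto elim!: oddE)
      ultimately show "(i, j) \<in> (\<lambda>(i, j). (i, 2 * j - 1)) ` addable l" by (force simp: image_iff)
    qed
    show "(\<lambda>(i, j). (i, 2 * j - 1)) ` addable l \<subseteq> addable (double_rows l)"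
    proof clarify
      fix i j assume a: "(i, j) \<in> addable l"
      then have "odd (2 * j - 1)" "(2 * j - 1 + 1) div 2 = j" using pos[OF a] by auto
      then show "(i, 2 * j - 1) \<in> addable (double_rows l)" using * a by simp
    qed
  qed
qed

text \<open>
  Removing a box from a diagram with even rows and adding a box to one both lead to the diagrams with
  exactly one odd row.
\<close>

lemma double_rows_remove_corner:
  assumes l: "young_diagram l" and c: "(i, j) \<in> corners l"
  shows "double_rows l - {(i, 2 * j)} = insert (i, 2 * j - 1) (double_rows (l - {(i, j)}))"
proof -
  have yl: "young_diagram (l - {(i, j)})" "(i, j) \<in> l" using c by (auto simp: corners_def)
  have j: "1 \<le> j" using young_diagram_pos[OF l yl(2)] by simp
  have "(a, b) \<in> double_rows l - {(i, 2 * j)} \<longleftrightarrow> (a, b) \<in> insert (i, 2 * j - 1) (double_rows (l - {(i, j)}))" for a b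
  proof -
    have "(b + 1) div 2 = j \<longleftrightarrow> b = 2 * j \<or> b = 2 * j - 1" using j by presburger
    then show ?thesis using yl(2) j by (auto simp: mem_double_rows[OF l] mem_double_rows[OF yl(1)])
  qed
  then show ?thesis by auto
qed

definition sum_SYT_double :: "nat \<Rightarrow> nat" where
  "sum_SYT_double m = (\<Sum>l\<in>shapes m. num_SYT (double_rows l))"

text \<open>
  By \<open>double_rows_remove_corner\<close> the shapes that remain after deleting the largest label are those
  obtained by adding a box to a diagram of \<open>2 * m\<close> boxes with even rows, to which \<open>num_SYT_up\<close>
  applies.
\<close>

lemma sum_SYT_double_Suc: "sum_SYT_double (Suc m) = (2 * m + 1) * sum_SYT_double m"
proof -
  define X where "X = (SIGMA l:shapes (Suc m). corners l)"
  define Y where "Y = (SIGMA l:shapes m. addable l)"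
  let ?f = "\<lambda>l c. num_SYT (double_rows l - {(fst c, 2 * snd c)})"
  let ?g = "\<lambda>l b. num_SYT (insert (fst b, 2 * snd b - 1) (double_rows l))"
  have "sum_SYT_double (Suc m) = (\<Sum>l\<in>shapes (Suc m). \<Sum>c\<in>corners l. ?f l c)"
    unfolding sum_SYT_double_def
  proof (rule sum.cong)
    fix l assume "l \<in> shapes (Suc m)"
    then have l: "young_diagram l" "card l = Suc m" by (auto simp: shapes_def)
    have ne: "double_rows l \<noteq> {}" using card_double_rows[OF l(1)] l(2) by auto
    have inj: "inj_on (\<lambda>(i, j). (i, 2 * j)) (corners l)" by (auto simp: inj_on_def)
    show "num_SYT (double_rows l) = (\<Sum>c\<in>corners l. ?f l c)"
      using num_SYT_branching[OF young_diagram_double_rows[OF l(1)] ne]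
      unfolding corners_double_rows[OF l(1)] sum.reindex[OF inj]
      by (simp add: case_prod_unfold)
  qed simp
  also have "\<dots> = (\<Sum>(l, c)\<in>X. ?f l c)"
    unfolding X_def by (rule sum.Sigma) (simp add: finite_shapes, auto simp: shapes_def finite_corners)
  also have "\<dots> = (\<Sum>(l, b)\<in>Y. ?g l b)"
  proof (rule sum.reindex_bij_witness[of _ "\<lambda>(l, b). (insert b l, b)" "\<lambda>(l, c). (l - {c}, c)"])
    fix x assume "x \<in> X"
    then obtain l c where x: "x = (l, c)" and l: "young_diagram l" "card l = Suc m" and c: "c \<in> corners l"
      by (auto simp: X_def shapes_def)
    have cl: "c \<in> l" "young_diagram (l - {c})" using c by (auto simp: corners_def)
    then have ins: "insert c (l - {c}) = l" by auto
    show "(case case x of (l, c) \<Rightarrow> (l - {c}, c) of (l, b) \<Rightarrow> (insert b l, b)) = x" using x ins by simp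
    show "(case x of (l, c) \<Rightarrow> (l - {c}, c)) \<in> Y"
      using x l cl ins young_diagram_finite[OF l(1)] by (auto simp: Y_def shapes_def addable_def)
    show "(case case x of (l, c) \<Rightarrow> (l - {c}, c) of (l, b) \<Rightarrow> ?g l b) = (case x of (l, c) \<Rightarrow> ?f l c)"
      using double_rows_remove_corner[OF l(1), of "fst c" "snd c"] c x by simp
  next
    fix y assume "y \<in> Y"
    then obtain l b where y: "y = (l, b)" and l: "young_diagram l" "card l = m" and b: "b \<in> addable l"
      by (auto simp: Y_def shapes_def)
    have bl: "b \<notin> l" "young_diagram (insert b l)" using b by (auto simp: addable_def)
    show "(case case y of (l, b) \<Rightarrow> (insert b l, b) of (l, c) \<Rightarrow> (l - {c}, c)) = y" using y bl by simp
    show "(case y of (l, b) \<Rightarrow> (insert b l, b)) \<in> X"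
      using y l bl young_diagram_finite[OF l(1)] by (auto simp: X_def shapes_def corners_def)
  qed
  also have "\<dots> = (\<Sum>l\<in>shapes m. \<Sum>b\<in>addable l. ?g l b)"
    unfolding Y_def by (rule sum.Sigma[symmetric]) (simp add: finite_shapes, auto simp: shapes_def addable_card_corners)
  also have "\<dots> = (\<Sum>l\<in>shapes m. (2 * m + 1) * num_SYT (double_rows l))"
  proof (rule sum.cong)
    fix l assume "l \<in> shapes m"
    then have l: "young_diagram l" "card l = m" by (auto simp: shapes_def)
    have inj: "inj_on (\<lambda>(i, j). (i, 2 * j - 1)) (addable l)"
    proof (rule inj_onI)
      fix x y assume xy: "x \<in> addable l" "y \<in> addable l"
        and eq: "(case x of (i, j) \<Rightarrow> (i, 2 * j - 1)) = (case y of (i, j) \<Rightarrow> (i, 2 * j - 1))"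
      obtain i j where x: "x = (i, j)" by fastforce
      obtain i' j' where y: "y = (i', j')" by fastforce
      have "1 \<le> j" "1 \<le> j'" using addable_iff[OF l(1)] xy x y by blast+
      moreover have "i = i'" "2 * j - 1 = 2 * j' - 1" using eq x y by simp_all
      ultimately show "x = y" using x y by simp
    qed
    have "(\<Sum>b\<in>addable (double_rows l). num_SYT (insert b (double_rows l))) = (2 * m + 1) * num_SYT (double_rows l)"
      using num_SYT_up[OF young_diagram_double_rows[OF l(1)]] card_double_rows[OF l(1)] l(2) by simp
    then show "(\<Sum>b\<in>addable l. ?g l b) = (2 * m + 1) * num_SYT (double_rows l)"
      unfolding addable_double_rows[OF l(1)] sum.reindex[OF inj] by (simp add: case_prod_unfold)
  qed simp
  finally show ?thesis by (simp only: sum_SYT_double_def sum_distrib_left)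
qed

text \<open>
  The partner of the last point is arbitrary, and exchanging it with the last but one point leaves a
  pairing of the remaining points.
\<close>

lemma card_pairings_Suc: "card (pairings {1..2 * Suc m}) = (2 * m + 1) * card (pairings {1..2 * m})"
proof -
  define u v where "u = 2 * m + 1" and "v = 2 * m + 2"
  define A where "A = {1..2 * m}"
  define B where "B = {1..2 * Suc m}"
  define e where "e = {u, v}"
  define F where "F = (\<lambda>(l, q). relabel (tr l u) (insert e q))"
  have B: "B = insert u (insert v A)" unfolding B_def A_def u_def v_def by (rule atLeastAtMost_double_Suc)
  have uv: "u \<notin> A" "v \<notin> A" "u \<noteq> v" by (auto simp: u_def v_def A_def)
  have perm: "tr l u permutes B" if "l \<in> {1..u}" for l
    using that by (intro permutes_swap_id) (auto simp: B_def u_def)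
  have e_tr: "e \<in> relabel (tr l u) Q \<longleftrightarrow> {v, l} \<in> Q" if "l \<in> {1..u}" for l Q
  proof -
    have "l \<noteq> v" using that by (auto simp: u_def v_def)
    then have "tr l u ` e = {v, l}" using uv by (auto simp: e_def)
    then show ?thesis by (simp add: mem_relabel_tr)
  qed
  have F_mem: "F (l, q) \<in> pairings B" if "l \<in> {1..u}" "q \<in> pairings A" for l q
  proof -
    have "insert e q \<in> pairings B" unfolding B e_def by (rule pairings_insert[OF that(2) uv])
    then show ?thesis unfolding F_def prod.case using pairings_relabel_iff[OF perm[OF that(1)]] by blast
  qed
  have F_inv: "relabel (tr l u) (F (l, q)) = insert e q" for l q
    by (simp add: F_def relabel_tr_involutory)
  have F_partner: "{v, l} \<in> F (l, q)" if "l \<in> {1..u}" for l q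
    using e_tr[OF that, of "F (l, q)"] F_inv by simp
  have e_notin: "e \<notin> q" if "q \<in> pairings A" for q
    using pairings_subset[OF that, of e] uv by (auto simp: e_def)
  have "inj_on F ({1..u} \<times> pairings A)"
  proof (rule inj_onI, clarify)
    fix l q l' q' assume l: "l \<in> {1..u}" "l' \<in> {1..u}" and q: "q \<in> pairings A" "q' \<in> pairings A"
      and eq: "F (l, q) = F (l', q')"
    have "{v, l} = {v, l'}"
      using pairings_block_eq[OF F_mem[OF l(1) q(1)], of "{v, l}" "{v, l'}" v]
        F_partner[OF l(1), of q] F_partner[OF l(2), of q'] eq by simp
    then have ll: "l = l'" using l by (auto simp: doubleton_eq_iff u_def v_def)
    then have "insert e q = insert e q'" using F_inv[of l q] F_inv[of l' q'] eq by simp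
    then show "l = l' \<and> q = q'" using ll e_notin[OF q(1)] e_notin[OF q(2)] by (metis Diff_insert_absorb)
  qed
  moreover have "F ` ({1..u} \<times> pairings A) = pairings B"
  proof
    show "F ` ({1..u} \<times> pairings A) \<subseteq> pairings B" using F_mem by auto
    show "pairings B \<subseteq> F ` ({1..u} \<times> pairings A)"
    proof
      fix Q assume Q: "Q \<in> pairings B"
      have "v \<in> B" by (simp add: B)
      then obtain l where l: "l \<in> B" "l \<noteq> v" "{v, l} \<in> Q" using pairings_partner[OF Q] by metis
      have lu: "l \<in> {1..u}" using l by (auto simp: B_def u_def v_def)
      have e: "e \<in> relabel (tr l u) Q" using e_tr[OF lu] l by simp
      have R: "relabel (tr l u) Q \<in> pairings B" using pairings_relabel_iff[OF perm[OF lu]] Q by blast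
      define q where "q = relabel (tr l u) Q - {e}"
      have "B - {u, v} = A" using uv by (auto simp: B)
      then have q: "q \<in> pairings A" using pairings_remove[OF R, of u v] e by (simp add: q_def e_def)
      have "insert e q = relabel (tr l u) Q" using e by (auto simp: q_def)
      then have "F (l, q) = Q" by (simp add: F_def relabel_tr_involutory)
      then show "Q \<in> F ` ({1..u} \<times> pairings A)" using lu q by (metis SigmaI image_eqI)
    qed
  qed
  ultimately have "card (pairings B) = card ({1..u} \<times> pairings A)" using card_image by fastforce
  then show ?thesis by (simp only: card_cartesian_product B_def A_def u_def card_atLeastAtMost) simp
qed

lemma card_pairings: "card (pairings {1..2 * m}) = sum_SYT_double m"
proof (induction m)
  case 0
  have "shapes 0 = {{}}"
    using young_diagram_finite by (auto simp: shapes_def young_diagram_def)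
  moreover have "double_rows {} = {}" by (auto simp: double_rows_def row_length_def)
  ultimately show ?case by (simp add: pairings_empty sum_SYT_double_def num_SYT_empty)
next
  case (Suc m)
  then show ?case by (simp only: card_pairings_Suc sum_SYT_double_Suc)
qed

section \<open>Determinants and independence of eigenvectors\<close>

text \<open>
  If a permutation contributes to the Leibniz formula, it never increases \<open>r\<close>; since it preserves the
  sum of \<open>r\<close>, it fixes every point. A rank function avoids ordering the index set.
\<close>

lemma det_unitriangular:
  fixes M :: "nat \<Rightarrow> nat \<Rightarrow> real" and r :: "nat \<Rightarrow> nat"
  assumes off: "\<And>i j. i < N \<Longrightarrow> j < N \<Longrightarrow> i \<noteq> j \<Longrightarrow> M i j \<noteq> 0 \<Longrightarrow> r j < r i"
    and diag: "\<And>i. i < N \<Longrightarrow> M i i = 1"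
  shows "det (mat N N (\<lambda>(i, j). M i j)) = 1"
proof -
  have zero: "(\<Prod>i = 0..<N. M i (p i)) = 0" if p: "p permutes {0..<N}" and ne: "p \<noteq> id" for p
  proof (rule ccontr)
    assume nz: "(\<Prod>i = 0..<N. M i (p i)) \<noteq> 0"
    have pin: "p i < N" if "i < N" for i using permutes_in_image[OF p, of i] that by simp
    have nz1: "M i (p i) \<noteq> 0" if "i < N" for i using nz that by (auto simp: prod_zero_iff)
    have le: "r (p i) \<le> r i" if "i < N" for i
      using off[OF that pin[OF that]] nz1[OF that] by (cases "i = p i") auto
    have sum_eq: "(\<Sum>i\<in>{0..<N}. r (p i)) = (\<Sum>i\<in>{0..<N}. r i)"
      using sum.reindex_bij_betw[OF permutes_imp_bij[OF p]] .
    obtain x where x: "p x \<noteq> x" using ne by (auto simp: fun_eq_iff)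
    then have xN: "x < N" using permutes_not_in[OF p, of x] by auto
    have "r (p x) < r x" using off[OF xN pin[OF xN]] nz1[OF xN] x by auto
    then have "(\<Sum>i\<in>{0..<N}. r (p i)) < (\<Sum>i\<in>{0..<N}. r i)"
      using le xN by (intro sum_strict_mono_ex1) auto
    then show False using sum_eq by simp
  qed
  have "det (mat N N (\<lambda>(i, j). M i j)) = (\<Sum>p\<in>{p. p permutes {0..<N}}. signof p * (\<Prod>i = 0..<N. M i (p i)))"
    by (subst det_def'[of _ N]) (auto intro!: sum.cong prod.cong arg_cong2[of _ _ _ _ "(*)"]
        simp: permutes_in_image[of _ "{0..<N}"])
  also have "\<dots> = (\<Sum>p\<in>{id}. signof p * (\<Prod>i = 0..<N. M i (p i)))"
    by (rule sum.mono_neutral_right) (auto simp: finite_permutations permutes_id zero)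
  also have "\<dots> = 1" by (simp add: diag)
  finally show ?thesis .
qed

text \<open>
  With the eigenvectors as columns of \<open>V\<close> and the diagonal matrix \<open>G\<close> of eigenvalues, \<open>KM * V = V * G\<close>
  with \<open>det V\<close> nonzero.
\<close>

lemma det_eigenbasis:
  fixes K :: "'a \<Rightarrow> 'a \<Rightarrow> real" and v :: "'b \<Rightarrow> 'a \<Rightarrow> real"
  assumes xs: "distinct xs" and Y: "finite Y" "card Y = length xs"
    and eig: "\<And>y x. y \<in> Y \<Longrightarrow> x \<in> set xs \<Longrightarrow> (\<Sum>x'\<in>set xs. K x x' * v y x') = g y * v y x"
    and indep: "\<And>a. (\<And>x. x \<in> set xs \<Longrightarrow> (\<Sum>y\<in>Y. a y * v y x) = 0) \<Longrightarrow> \<forall>y\<in>Y. a y = 0"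
  shows "det (mat (length xs) (length xs) (\<lambda>(i, j). K (xs ! i) (xs ! j))) = (\<Prod>y\<in>Y. g y)"
proof -
  define N where "N = length xs"
  obtain ys where ys: "set ys = Y" "distinct ys" using finite_distinct_list[OF Y(1)] by blast
  have lys: "length ys = N" using distinct_card[OF ys(2)] ys(1) Y(2) by (simp add: N_def)
  have bx: "bij_betw (\<lambda>i. xs ! i) {0..<N} (set xs)"
    using bij_betw_nth[OF xs, of "{0..<N}"] by (simp add: N_def atLeast0LessThan)
  have by': "bij_betw (\<lambda>i. ys ! i) {0..<N} Y"
    using bij_betw_nth[OF ys(2), of "{0..<N}" Y] ys(1) lys by (simp add: atLeast0LessThan)
  have yin: "ys ! i \<in> Y" if "i < N" for i using ys(1) lys that nth_mem by metis
  have xin: "xs ! i \<in> set xs" if "i < N" for i using that by (simp add: N_def)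
  define KM where "KM = mat N N (\<lambda>(i, j). K (xs ! i) (xs ! j))"
  define V where "V = mat N N (\<lambda>(i, j). v (ys ! j) (xs ! i))"
  define G where "G = mat N N (\<lambda>(i, j). if i = j then g (ys ! i) else 0)"
  have carr: "KM \<in> carrier_mat N N" "V \<in> carrier_mat N N" "G \<in> carrier_mat N N"
    by (simp_all add: KM_def V_def G_def)
  have "KM * V = V * G"
  proof (rule eq_matI)
    fix i j assume "i < dim_row (V * G)" "j < dim_col (V * G)"
    then have ij: "i < N" "j < N" using carr by auto
    have "(KM * V) $$ (i, j) = (\<Sum>t\<in>{0..<N}. K (xs ! i) (xs ! t) * v (ys ! j) (xs ! t))"
      using ij by (simp add: KM_def V_def scalar_prod_def)
    also have "\<dots> = (\<Sum>x\<in>set xs. K (xs ! i) x * v (ys ! j) x)"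
      by (rule sum.reindex_bij_betw[OF bx])
    also have "\<dots> = g (ys ! j) * v (ys ! j) (xs ! i)" by (rule eig[OF yin[OF ij(2)] xin[OF ij(1)]])
    also have "\<dots> = (V * G) $$ (i, j)"
      using ij by (simp add: V_def G_def scalar_prod_def if_distrib[of "\<lambda>x. _ * x"] cong: if_cong)
    finally show "(KM * V) $$ (i, j) = (V * G) $$ (i, j)" .
  qed (use carr in auto)
  then have "det KM * det V = det V * det G"
    using det_mult[OF carr(1,2)] det_mult[OF carr(2,3)] by metis
  moreover have "det V \<noteq> 0"
  proof
    assume "det V = 0"
    then obtain w where w: "w \<in> carrier_vec N" "w \<noteq> 0\<^sub>v N" "V *\<^sub>v w = 0\<^sub>v N"
      using det_0_iff_vec_prod_zero[OF carr(2)] by blast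
    define a where "a = (\<lambda>y. w $ (inv_into {0..<N} (\<lambda>i. ys ! i) y))"
    have a: "a (ys ! j) = w $ j" if "j < N" for j
      using that by' by (simp add: a_def bij_betw_def inv_into_f_f)
    have "(\<Sum>y\<in>Y. a y * v y x) = 0" if x: "x \<in> set xs" for x
    proof -
      obtain i where i: "i < N" "x = xs ! i" using x by (auto simp: in_set_conv_nth N_def)
      have "(\<Sum>y\<in>Y. a y * v y x) = (\<Sum>j\<in>{0..<N}. a (ys ! j) * v (ys ! j) x)"
        by (rule sum.reindex_bij_betw[OF by', symmetric])
      also have "\<dots> = (V *\<^sub>v w) $ i"
        using i w(1) by (simp add: V_def a scalar_prod_def mult.commute)
      finally show ?thesis using w(3) i by simp
    qed
    from indep[OF this] have "w $ j = 0" if "j < N" for j using a[OF that] yin[OF that] by auto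
    then have "w = 0\<^sub>v N" using w(1) by (intro eq_vecI) auto
    then show False using w(2) by simp
  qed
  ultimately have "det KM = det G" by simp
  also have "det G = prod_list (diag_mat G)"
    by (rule det_upper_triangular[OF _ carr(3)]) (auto simp: G_def upper_triangular_def)
  also have "\<dots> = (\<Prod>i\<in>{0..<N}. g (ys ! i))"
    by (simp add: prod_list_diag_prod G_def)
  also have "\<dots> = (\<Prod>y\<in>Y. g y)" by (rule prod.reindex_bij_betw[OF by'])
  finally show ?thesis by (simp add: KM_def N_def)
qed

text \<open>
  Applying \<open>L k - c z k\<close> to a relation removes the vector \<open>v z\<close> and multiplies the coefficient of \<open>v y\<close>
  by \<open>c y k - c z k\<close>, which is nonzero for a suitable \<open>k\<close>.
\<close>

lemma joint_eigenvectors_independent: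
  fixes v :: "'y \<Rightarrow> 'q \<Rightarrow> real" and L :: "'k \<Rightarrow> ('q \<Rightarrow> real) \<Rightarrow> 'q \<Rightarrow> real"
  assumes lin: "\<And>k Y a q. finite Y \<Longrightarrow> L k (\<lambda>q. \<Sum>y\<in>Y. a y * v y q) q = (\<Sum>y\<in>Y. a y * L k (v y) q)"
    and Y: "finite Y"
    and eig: "\<And>y k q. y \<in> Y \<Longrightarrow> k \<in> I \<Longrightarrow> L k (v y) q = c y k * v y q"
    and nz: "\<And>y. y \<in> Y \<Longrightarrow> \<exists>q. v y q \<noteq> 0"
    and sep: "\<And>y z. y \<in> Y \<Longrightarrow> z \<in> Y \<Longrightarrow> y \<noteq> z \<Longrightarrow> \<exists>k\<in>I. c y k \<noteq> c z k"
    and zero: "\<And>q. (\<Sum>y\<in>Y. a y * v y q) = 0"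
  shows "\<forall>y\<in>Y. a y = 0"
  using Y eig nz sep zero
proof (induction Y arbitrary: a rule: finite_induct)
  case (insert z Y)
  have aY: "a y = 0" if y: "y \<in> Y" for y
  proof -
    have "y \<noteq> z" using insert.hyps y by auto
    then obtain k where k: "k \<in> I" "c y k \<noteq> c z k" using insert.prems(3)[of y z] y by auto
    have "(\<Sum>x\<in>Y. (a x * (c x k - c z k)) * v x q) = 0" for q
    proof -
      have zf: "(\<lambda>q. \<Sum>x\<in>insert z Y. a x * v x q) = (\<lambda>q. 0)" using insert.prems(4) by auto
      have "(\<Sum>x\<in>insert z Y. a x * (c x k * v x q)) = (\<Sum>x\<in>insert z Y. a x * L k (v x) q)"
        using insert.prems(1)[OF _ k(1)] by (intro sum.cong) auto
      also have "\<dots> = L k (\<lambda>q. 0) q"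
        using lin[of "insert z Y" k a q] insert.hyps zf by simp
      also have "\<dots> = 0" using lin[of "{}" k a q] by simp
      finally have 1: "(\<Sum>x\<in>insert z Y. a x * (c x k * v x q)) = 0" .
      have "c z k * (\<Sum>x\<in>insert z Y. a x * v x q) = 0" using insert.prems(4) by simp
      then have 2: "(\<Sum>x\<in>insert z Y. a x * (c z k * v x q)) = 0" by (simp only: sum_distrib_left mult_ac)
      have "(\<Sum>x\<in>insert z Y. (a x * (c x k - c z k)) * v x q) =
          (\<Sum>x\<in>insert z Y. a x * (c x k * v x q)) - (\<Sum>x\<in>insert z Y. a x * (c z k * v x q))"
        unfolding sum_subtractf[symmetric] by (rule sum.cong) (simp_all add: algebra_simps)
      then have "(\<Sum>x\<in>insert z Y. (a x * (c x k - c z k)) * v x q) = 0" using 1 2 by simp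
      then show ?thesis using insert.hyps by simp
    qed
    from insert.IH[OF _ _ _ this] have "\<forall>x\<in>Y. a x * (c x k - c z k) = 0"
      using insert.prems(1-3) by blast
    then show ?thesis using y k by auto
  qed
  obtain q where q: "v z q \<noteq> 0" using insert.prems(2) by auto
  have "(\<Sum>x\<in>Y. a x * v x q) = 0" by (rule sum.neutral) (use aY in simp)
  then have "a z * v z q = 0" using insert.prems(4)[of q] insert.hyps by simp
  then show ?case using aY q by auto
qed simp

section \<open>Joins of partitions and colourings\<close>

definition constant_on :: "('a \<Rightarrow> 'b) \<Rightarrow> 'a set set \<Rightarrow> bool" where
  "constant_on f P \<longleftrightarrow> (\<forall>b\<in>P. \<forall>x\<in>b. \<forall>y\<in>b. f x = f y)"

lemma card_constant_on:
  assumes A: "finite A" and R: "partition_on A R"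
  shows "card {f \<in> A \<rightarrow>\<^sub>E {..<n}. constant_on f R} = n ^ card R"
proof -
  have finR: "finite R" using finite_elements[OF A R] .
  have un: "\<Union>R = A" "disjoint R" and ne: "\<And>b. b \<in> R \<Longrightarrow> b \<noteq> {}" using R by (auto simp: partition_on_def)
  define blk where "blk = (\<lambda>x. THE b. b \<in> R \<and> x \<in> b)"
  have blk_eq: "blk x = b" if "b \<in> R" "x \<in> b" for x b
    unfolding blk_def using that un(2) by (intro the_equality) (auto simp: disjoint_def)
  have blk: "blk x \<in> R \<and> x \<in> blk x" if x: "x \<in> A" for x
  proof -
    obtain b where "b \<in> R" "x \<in> b" using x un(1) by auto
    then show ?thesis using blk_eq by simp
  qed
  define h where "h = (\<lambda>g :: 'a set \<Rightarrow> nat. restrict (\<lambda>x. g (blk x)) A)"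
  have inj: "inj_on h (R \<rightarrow>\<^sub>E {..<n})"
  proof (rule inj_onI)
    fix g g' assume g: "g \<in> R \<rightarrow>\<^sub>E {..<n}" "g' \<in> R \<rightarrow>\<^sub>E {..<n}" and eq: "h g = h g'"
    show "g = g'"
    proof (rule PiE_ext[OF g])
      fix b assume b: "b \<in> R"
      then obtain x where x: "x \<in> b" using ne by auto
      then have "x \<in> A" using b un(1) by auto
      then show "g b = g' b" using fun_cong[OF eq, of x] blk_eq[OF b x] by (simp add: h_def)
    qed
  qed
  have img: "h ` (R \<rightarrow>\<^sub>E {..<n}) = {f \<in> A \<rightarrow>\<^sub>E {..<n}. constant_on f R}"
  proof
    show "h ` (R \<rightarrow>\<^sub>E {..<n}) \<subseteq> {f \<in> A \<rightarrow>\<^sub>E {..<n}. constant_on f R}"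
    proof clarify
      fix g assume g: "g \<in> R \<rightarrow>\<^sub>E {..<n}"
      have "h g \<in> A \<rightarrow>\<^sub>E {..<n}" using g blk by (auto simp: h_def PiE_def Pi_def)
      moreover have "constant_on (h g) R"
        unfolding constant_on_def
      proof (intro ballI)
        fix b x y assume b: "b \<in> R" "x \<in> b" "y \<in> b"
        then have "x \<in> A" "y \<in> A" using un(1) by auto
        then show "h g x = h g y" using blk_eq[OF b(1,2)] blk_eq[OF b(1,3)] by (simp add: h_def)
      qed
      ultimately show "h g \<in> A \<rightarrow>\<^sub>E {..<n} \<and> constant_on (h g) R" ..
    qed
    show "{f \<in> A \<rightarrow>\<^sub>E {..<n}. constant_on f R} \<subseteq> h ` (R \<rightarrow>\<^sub>E {..<n})"
    proof clarify
      fix f assume f: "f \<in> A \<rightarrow>\<^sub>E {..<n}" and c: "constant_on f R"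
      define g where "g = restrict (\<lambda>b. f (SOME x. x \<in> b)) R"
      have some: "(SOME x. x \<in> b) \<in> b" if "b \<in> R" for b using ne[OF that] by (auto intro: someI_ex)
      have "g \<in> R \<rightarrow>\<^sub>E {..<n}" using f some un(1) by (auto simp: g_def PiE_def Pi_def)
      moreover have "h g = f"
      proof
        fix x
        show "h g x = f x"
        proof (cases "x \<in> A")
          case True
          have "f (SOME y. y \<in> blk x) = f x"
            using c blk[OF True] some[of "blk x"] unfolding constant_on_def by blast
          then show ?thesis using True blk[OF True] by (simp add: h_def g_def)
        next
          case False
          then show ?thesis using f by (auto simp: h_def PiE_def extensional_def)
        qed
      qed
      ultimately show "f \<in> h ` (R \<rightarrow>\<^sub>E {..<n})" by blast
    qed
  qed
  have "card {f \<in> A \<rightarrow>\<^sub>E {..<n}. constant_on f R} = card (R \<rightarrow>\<^sub>E {..<n})"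
    using card_image[OF inj] img by simp
  then show ?thesis using finR by (simp add: card_PiE)
qed

lemma constant_on_refines: "refines A P S \<Longrightarrow> constant_on f S \<Longrightarrow> constant_on f P"
  unfolding refines_def constant_on_def by blast

text \<open>
  The level sets of \<open>f\<close> form a partition, and \<open>f\<close> is constant on the blocks of \<open>P\<close> exactly if \<open>P\<close> refines
  this partition; so the join can be used through its universal property only.
\<close>

lemma constant_on_join:
  assumes P: "partition_on A P" and Q: "partition_on A Q"
  shows "constant_on f (partition_join A P Q) \<longleftrightarrow> constant_on f P \<and> constant_on f Q"
proof
  assume "constant_on f (partition_join A P Q)"
  then show "constant_on f P \<and> constant_on f Q"
    using partition_join_lub(1,2)[OF P Q] constant_on_refines by blast
next
  assume c: "constant_on f P \<and> constant_on f Q"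
  define S where "S = (\<lambda>x. {y \<in> A. f y = f x}) ` A"
  have S: "partition_on A S"
    by (rule partition_onI) (auto simp: S_def disjnt_def)
  have ref: "refines A X S" if X: "partition_on A X" and cX: "constant_on f X" for X
    unfolding refines_def
  proof (intro conjI X S ballI)
    fix b assume b: "b \<in> X"
    have "b \<noteq> {}" using X b by (auto simp: partition_on_def)
    then obtain x where x: "x \<in> b" by blast
    have sub: "b \<subseteq> A" using X b by (auto simp: partition_on_def)
    have "b \<subseteq> {y \<in> A. f y = f x}" using cX b x sub unfolding constant_on_def by blast
    then show "\<exists>Y\<in>S. b \<subseteq> Y" using x sub by (auto simp: S_def)
  qed
  have "constant_on f S" by (auto simp: constant_on_def S_def)
  then show "constant_on f (partition_join A P Q)"
    using constant_on_refines[OF partition_join_lub(3)[OF P Q ref[OF P] ref[OF Q]]] c by blast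
qed

definition delta_weight :: "'a set set \<Rightarrow> ('a \<Rightarrow> nat) \<Rightarrow> real" where
  "delta_weight M f = (\<Prod>b\<in>M. if card (f ` b) = 1 then 1 else 0)"

definition two_blocks :: "'a set set \<Rightarrow> 'a set set" where
  "two_blocks \<pi> = {b \<in> \<pi>. card b = 2}"

text \<open>
  Singletons impose no condition on a colouring.
\<close>

lemma delta_weight_two_blocks:
  assumes fin: "finite \<pi>" and \<pi>: "\<And>b. b \<in> \<pi> \<Longrightarrow> card b = 1 \<or> card b = 2"
  shows "delta_weight (two_blocks \<pi>) f = (if constant_on f \<pi> then 1 else 0)"
proof -
  have const: "card (f ` b) = 1 \<longleftrightarrow> (\<forall>x\<in>b. \<forall>y\<in>b. f x = f y)" if b: "b \<in> \<pi>" for b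
  proof -
    obtain x where x: "x \<in> b" using \<pi>[OF b] by (metis all_not_in_conv card.empty zero_neq_numeral zero_neq_one)
    show ?thesis
    proof
      assume "card (f ` b) = 1"
      then obtain z where z: "f ` b = {z}" by (auto simp: card_1_singleton_iff)
      have "f x = z" if "x \<in> b" for x using imageI[OF that, of f] unfolding z by simp
      then show "\<forall>x\<in>b. \<forall>y\<in>b. f x = f y" by simp
    next
      assume "\<forall>x\<in>b. \<forall>y\<in>b. f x = f y"
      then have "f ` b = {f x}" using x by blast
      then show "card (f ` b) = 1" by simp
    qed
  qed
  have single: "\<forall>x\<in>b. \<forall>y\<in>b. f x = f y" if "b \<in> \<pi>" "card b \<noteq> 2" for b
    using \<pi>[OF that(1)] that(2) by (auto simp: card_1_singleton_iff)
  have "constant_on f \<pi> \<longleftrightarrow> (\<forall>b\<in>two_blocks \<pi>. card (f ` b) = 1)"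
  proof -
    have "constant_on f \<pi> \<longleftrightarrow> (\<forall>b\<in>\<pi>. card (f ` b) = 1)"
      unfolding constant_on_def by (rule ball_cong[OF refl]) (rule const[symmetric])
    also have "\<dots> \<longleftrightarrow> (\<forall>b\<in>two_blocks \<pi>. card (f ` b) = 1)"
    proof (intro iffI ballI)
      fix b assume b: "b \<in> \<pi>" and two: "\<forall>b\<in>two_blocks \<pi>. card (f ` b) = 1"
      show "card (f ` b) = 1"
      proof (cases "card b = 2")
        case True
        then have "b \<in> two_blocks \<pi>" using b by (simp add: two_blocks_def)
        then show ?thesis using two by simp
      next
        case False
        show ?thesis unfolding const[OF b] by (rule single[OF b False])
      qed
    qed (simp add: two_blocks_def)
    finally show ?thesis .
  qed
  then show ?thesis
    using fin by (auto simp: delta_weight_def two_blocks_def intro: prod.neutral)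
qed

lemma power_card_join:
  assumes "\<pi> \<in> P_b k" "\<sigma> \<in> P_b k"
  shows "real n ^ card (partition_join {1..k} \<pi> \<sigma>) =
    (\<Sum>f\<in>{1..k} \<rightarrow>\<^sub>E {..<n}. delta_weight (two_blocks \<pi>) f * delta_weight (two_blocks \<sigma>) f)"
proof -
  have P: "partition_on {1..k} \<pi>" "partition_on {1..k} \<sigma>" using assms by (auto simp: P_b_def)
  have fin: "finite \<pi>" "finite \<sigma>" using P finite_elements by blast+
  have pj: "partition_on {1..k} (partition_join {1..k} \<pi> \<sigma>)"
    using partition_join_lub(1)[OF P] by (simp add: refines_def)
  have finF: "finite ({1..k} \<rightarrow>\<^sub>E {..<n})" by (rule finite_PiE) auto
  have "real n ^ card (partition_join {1..k} \<pi> \<sigma>) =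
      real (card {f \<in> {1..k} \<rightarrow>\<^sub>E {..<n}. constant_on f (partition_join {1..k} \<pi> \<sigma>)})"
    using card_constant_on[OF _ pj, of n] by simp
  also have "\<dots> = (\<Sum>f\<in>{1..k} \<rightarrow>\<^sub>E {..<n}. if constant_on f (partition_join {1..k} \<pi> \<sigma>) then 1 else 0)"
    using finF by (simp add: sum.If_cases Int_def)
  also have "\<dots> = (\<Sum>f\<in>{1..k} \<rightarrow>\<^sub>E {..<n}. delta_weight (two_blocks \<pi>) f * delta_weight (two_blocks \<sigma>) f)"
  proof (rule sum.cong)
    fix f
    have "delta_weight (two_blocks \<pi>) f = (if constant_on f \<pi> then 1 else 0)"
      using assms by (intro delta_weight_two_blocks fin) (auto simp: P_b_def)
    moreover have "delta_weight (two_blocks \<sigma>) f = (if constant_on f \<sigma> then 1 else 0)"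
      using assms by (intro delta_weight_two_blocks fin) (auto simp: P_b_def)
    ultimately show "(if constant_on f (partition_join {1..k} \<pi> \<sigma>) then 1 else 0) =
        delta_weight (two_blocks \<pi>) f * delta_weight (two_blocks \<sigma>) f"
      unfolding constant_on_join[OF P] by simp
  qed simp
  finally show ?thesis .
qed

section \<open>Matchings and the unitriangular change of basis\<close>

definition matchings :: "'a set \<Rightarrow> 'a set set set" where
  "matchings A = {M. disjoint M \<and> (\<forall>b\<in>M. card b = 2) \<and> \<Union>M \<subseteq> A}"

lemma matchings_subset: "M \<in> matchings A \<Longrightarrow> M' \<subseteq> M \<Longrightarrow> M' \<in> matchings A"
  unfolding matchings_def disjoint_def by blast

lemma finite_matchings: "finite A \<Longrightarrow> finite (matchings A)"
  by (rule finite_subset[of _ "Pow (Pow A)"]) (auto simp: matchings_def)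

lemma finite_matching: "finite A \<Longrightarrow> M \<in> matchings A \<Longrightarrow> finite M"
  by (rule finite_subset[of _ "Pow A"]) (auto simp: matchings_def)

lemma pairings_matchings: "A \<subseteq> B \<Longrightarrow> pairings A \<subseteq> matchings B"
  by (auto simp: matchings_def pairings_def)

lemma matching_pairings: "M \<in> matchings B \<Longrightarrow> M \<in> pairings (\<Union>M)"
  by (auto simp: matchings_def pairings_def)

lemma card_Union_pairing:
  assumes "finite A" "q \<in> pairings A"
  shows "card A = 2 * card q"
proof -
  have "card (\<Union>q) = (\<Sum>b\<in>q. card b)"
    using assms by (intro card_Union_disjoint) (auto simp: pairings_def intro: card_ge_0_finite)
  then show ?thesis using assms by (simp add: pairings_def)
qed

lemma two_blocks_bij: "bij_betw two_blocks (P_b k) (matchings {1..k})"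
  and card_P_b_two_blocks: "\<pi> \<in> P_b k \<Longrightarrow> 2 * card \<pi> - k = k - card (\<Union>(two_blocks \<pi>))"
proof -
  define ext where "ext = (\<lambda>M. M \<union> (\<lambda>x. {x}) ` ({1..k} - \<Union>M))"
  have ext_two: "ext (two_blocks \<pi>) = \<pi>" and tb: "two_blocks \<pi> \<in> matchings {1..k}" if \<pi>: "\<pi> \<in> P_b k" for \<pi>
  proof -
    have p: "disjoint \<pi>" "\<Union>\<pi> = {1..k}" and c: "\<And>b. b \<in> \<pi> \<Longrightarrow> card b = 1 \<or> card b = 2"
      using \<pi> by (auto simp: P_b_def partition_on_def)
    have meet: "b = b'" if "b \<in> \<pi>" "b' \<in> \<pi>" "x \<in> b" "x \<in> b'" for b b' x
      using p(1) that by (auto simp: disjoint_def)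
    show "two_blocks \<pi> \<in> matchings {1..k}"
      using p by (auto simp: two_blocks_def matchings_def disjoint_def)
    show "ext (two_blocks \<pi>) = \<pi>"
    proof
      show "ext (two_blocks \<pi>) \<subseteq> \<pi>"
      proof
        fix b assume "b \<in> ext (two_blocks \<pi>)"
        then consider "b \<in> two_blocks \<pi>" | x where "b = {x}" "x \<in> {1..k}" "x \<notin> \<Union>(two_blocks \<pi>)"
          by (auto simp: ext_def)
        then show "b \<in> \<pi>"
        proof cases
          case 2
          then obtain b' where b': "b' \<in> \<pi>" "x \<in> b'" using p(2) by blast
          then have "card b' = 1" using c[OF b'(1)] 2 by (auto simp: two_blocks_def)
          then have "b' = {x}" using b' by (auto simp: card_1_singleton_iff)
          then show ?thesis using b' 2 by simp
        qed (simp add: two_blocks_def)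
      qed
      show "\<pi> \<subseteq> ext (two_blocks \<pi>)"
      proof
        fix b assume b: "b \<in> \<pi>"
        show "b \<in> ext (two_blocks \<pi>)"
        proof (cases "card b = 2")
          case True
          then show ?thesis using b by (simp add: ext_def two_blocks_def)
        next
          case False
          then obtain x where x: "b = {x}" using c[OF b] by (auto simp: card_1_singleton_iff)
          have "x \<notin> \<Union>(two_blocks \<pi>)"
          proof
            assume "x \<in> \<Union>(two_blocks \<pi>)"
            then obtain b' where b': "b' \<in> \<pi>" "card b' = 2" "x \<in> b'" by (auto simp: two_blocks_def)
            then have "b = b'" using meet[OF b b'(1), of x] x by simp
            then show False using b' False by simp
          qed
          moreover have "x \<in> {1..k}" using b x p(2) by blast
          ultimately show ?thesis using x by (auto simp: ext_def)
        qed
      qed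
    qed
  qed
  have two_ext: "two_blocks (ext M) = M" and ext_P: "ext M \<in> P_b k" if M: "M \<in> matchings {1..k}" for M
  proof -
    show "two_blocks (ext M) = M"
      using M by (auto simp: two_blocks_def ext_def matchings_def)
    have "partition_on {1..k} (ext M)"
      using M by (intro partition_onI) (auto simp: ext_def matchings_def disjoint_def disjnt_def)
    then show "ext M \<in> P_b k" using M by (auto simp: P_b_def ext_def matchings_def)
  qed
  show "bij_betw two_blocks (P_b k) (matchings {1..k})"
    by (rule bij_betw_byWitness[where f' = ext]) (use ext_two tb two_ext ext_P in auto)
  assume \<pi>: "\<pi> \<in> P_b k"
  define M where "M = two_blocks \<pi>"
  have M: "M \<in> matchings {1..k}" using tb[OF \<pi>] by (simp add: M_def)
  have UM: "\<Union>M \<subseteq> {1..k}" using M by (auto simp: matchings_def)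
  have finM: "finite M" using finite_matching[OF _ M] by simp
  have cardU: "card (\<Union>M) = 2 * card M"
    using card_Union_pairing[OF finite_subset[OF UM] matching_pairings[OF M]] by simp
  have "card \<pi> = card (ext M)" using ext_two[OF \<pi>] by (simp add: M_def)
  also have "\<dots> = card M + card ((\<lambda>x. {x}) ` ({1..k} - \<Union>M))"
    unfolding ext_def using M finM by (intro card_Un_disjoint) (auto simp: matchings_def)
  also have "card ((\<lambda>x. {x}) ` ({1..k} - \<Union>M)) = card ({1..k} - \<Union>M)"
    by (rule card_image) simp
  also have "\<dots> = k - card (\<Union>M)" using UM by (simp add: card_Diff_subset finite_subset)
  finally have "card \<pi> = card M + (k - card (\<Union>M))" .
  moreover have "card (\<Union>M) \<le> k" using card_mono[OF _ UM] by simp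
  ultimately show "2 * card \<pi> - k = k - card (\<Union>(two_blocks \<pi>))" using cardU by (simp add: M_def)
qed

text \<open>
  Expanding the product of \<open>[f x = f y] - 1/n\<close> over the pairs of a matching keeps the pairs of \<open>M'\<close> and
  splits each of the others into two singletons.
\<close>

definition split_coeff :: "nat \<Rightarrow> 'a set set \<Rightarrow> 'a set set \<Rightarrow> real" where
  "split_coeff n M M' = (if M' \<subseteq> M then (- 1 / real n) ^ card (M - M') else 0)"

lemma weight_eq_sum_split:
  assumes A: "finite A" and M: "M \<in> matchings A"
  shows "weight n M f = (\<Sum>M'\<in>matchings A. split_coeff n M M' * delta_weight M' f)"
proof -
  have fin: "finite M" using finite_matching[OF A M] .
  have "weight n M f = (\<Prod>b\<in>M. (if card (f ` b) = 1 then 1 else 0) + (- 1 / real n))"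
    by (simp add: weight_def kappa_def)
  also have "\<dots> = (\<Sum>M'\<in>Pow M. (\<Prod>b\<in>M'. if card (f ` b) = 1 then 1 else 0) * (\<Prod>b\<in>M - M'. - 1 / real n))"
    using fin by (rule prod_add)
  also have "\<dots> = (\<Sum>M'\<in>Pow M. split_coeff n M M' * delta_weight M' f)"
    by (rule sum.cong) (simp_all add: split_coeff_def delta_weight_def)
  also have "\<dots> = (\<Sum>M'\<in>matchings A. split_coeff n M M' * delta_weight M' f)"
    by (rule sum.mono_neutral_left) (use finite_matchings[OF A] matchings_subset[OF M] in \<open>auto simp: split_coeff_def\<close>)
  finally show ?thesis .
qed

lemma gram_kernel_split:
  assumes A: "finite A" and M: "M \<in> matchings A" and N: "N \<in> matchings A"
  shows "gram_kernel n A M N = (\<Sum>M'\<in>matchings A. \<Sum>N'\<in>matchings A.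
    split_coeff n M M' * (\<Sum>f\<in>A \<rightarrow>\<^sub>E {..<n}. delta_weight M' f * delta_weight N' f) * split_coeff n N N')"
proof -
  have "gram_kernel n A M N = (\<Sum>f\<in>A \<rightarrow>\<^sub>E {..<n}. \<Sum>M'\<in>matchings A. \<Sum>N'\<in>matchings A.
     split_coeff n M M' * (delta_weight M' f * delta_weight N' f) * split_coeff n N N')"
    unfolding gram_kernel_def weight_eq_sum_split[OF A M] weight_eq_sum_split[OF A N]
    by (simp add: sum_product mult_ac)
  also have "\<dots> = (\<Sum>M'\<in>matchings A. \<Sum>f\<in>A \<rightarrow>\<^sub>E {..<n}. \<Sum>N'\<in>matchings A.
     split_coeff n M M' * (delta_weight M' f * delta_weight N' f) * split_coeff n N N')"
    by (rule sum.swap)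
  also have "\<dots> = (\<Sum>M'\<in>matchings A. \<Sum>N'\<in>matchings A. \<Sum>f\<in>A \<rightarrow>\<^sub>E {..<n}.
     split_coeff n M M' * (delta_weight M' f * delta_weight N' f) * split_coeff n N N')"
    by (intro sum.cong refl sum.swap)
  finally show ?thesis by (simp only: sum_distrib_left sum_distrib_right)
qed

lemma gram_kernel_commute: "gram_kernel n A p q = gram_kernel n A q p"
  by (simp add: gram_kernel_def mult.commute)

text \<open>
  The colour of \<open>x\<close> occurs in a single factor \<open>kappa\<close>, whose sum over this colour is \<open>0\<close>.
\<close>

lemma gram_kernel_uncovered:
  assumes A: "finite A" and M: "M \<in> matchings A" and N: "N \<in> matchings A"
    and x: "x \<in> \<Union>M" "x \<notin> \<Union>N"
  shows "gram_kernel n A M N = 0"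
proof -
  have xA: "x \<in> A" using x M by (auto simp: matchings_def)
  obtain y where y: "y \<noteq> x" "{x, y} \<in> M" and yA: "y \<in> \<Union>M"
    using pairings_partner[OF matching_pairings[OF M] x(1)] by metis
  have finM: "finite M" using finite_matching[OF A M] .
  define M' where "M' = M - {{x, y}}"
  have M': "M = insert {x, y} M'" "{x, y} \<notin> M'" "finite M'" using y finM by (auto simp: M'_def)
  have xM': "x \<notin> \<Union>M'"
  proof
    assume "x \<in> \<Union>M'"
    then obtain b where b: "b \<in> M" "b \<noteq> {x, y}" "x \<in> b" by (auto simp: M'_def)
    then show False using pairings_block_eq[OF matching_pairings[OF M] b(1) y(2) b(3)] by simp
  qed
  have yA': "y \<in> A - {x}" using yA y M by (auto simp: matchings_def)
  have "gram_kernel n (insert x (A - {x})) M N =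
      (\<Sum>f\<in>A - {x} \<rightarrow>\<^sub>E {..<n}. \<Sum>z<n. weight n M (f(x := z)) * weight n N (f(x := z)))"
    unfolding gram_kernel_def by (rule sum_PiE_insert) simp
  also have "\<dots> = (\<Sum>f\<in>A - {x} \<rightarrow>\<^sub>E {..<n}. (\<Sum>z<n. kappa n {f y, z}) * (weight n M' f * weight n N f))"
  proof (rule sum.cong)
    fix f
    have "weight n M (f(x := z)) * weight n N (f(x := z)) = kappa n {f y, z} * (weight n M' f * weight n N f)" for z
      using weight_upd[OF xM', of n f z] weight_upd[OF x(2), of n f z] weight_insert[OF M'(3,2), of n "f(x := z)"] y
      by (simp add: M'(1) insert_commute)
    then show "(\<Sum>z<n. weight n M (f(x := z)) * weight n N (f(x := z))) =
        (\<Sum>z<n. kappa n {f y, z}) * (weight n M' f * weight n N f)"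
      by (simp only: sum_distrib_right)
  qed simp
  also have "\<dots> = 0"
  proof (rule sum.neutral, rule ballI)
    fix f assume "f \<in> A - {x} \<rightarrow>\<^sub>E {..<n}"
    then have "f y < n" using yA' by auto
    then show "(\<Sum>z<n. kappa n {f y, z}) * (weight n M' f * weight n N f) = 0" by (simp add: sum_kappa)
  qed
  finally show ?thesis using xA by (simp add: insert_absorb)
qed

text \<open>
  The colours of the points outside \<open>A\<close> are free.
\<close>

lemma gram_kernel_extend:
  assumes "finite B" "A \<inter> B = {}" "\<Union>p \<subseteq> A" "\<Union>q \<subseteq> A"
  shows "gram_kernel n (A \<union> B) p q = real n ^ card B * gram_kernel n A p q"
  using assms
proof (induction B rule: finite_induct)
  case (insert x B)
  have x: "x \<notin> A \<union> B" "x \<notin> \<Union>p" "x \<notin> \<Union>q" using insert by auto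
  have "gram_kernel n (insert x (A \<union> B)) p q =
      (\<Sum>f\<in>A \<union> B \<rightarrow>\<^sub>E {..<n}. \<Sum>z<n. weight n p (f(x := z)) * weight n q (f(x := z)))"
    unfolding gram_kernel_def by (rule sum_PiE_insert[OF x(1)])
  also have "\<dots> = real n * gram_kernel n (A \<union> B) p q"
    by (simp add: weight_upd[OF x(2)] weight_upd[OF x(3)] gram_kernel_def sum_distrib_left)
  finally show ?case using insert by simp
qed simp

section \<open>The eigenbasis on the pairings of an interval\<close>

definition tableaux_pairs :: "nat \<Rightarrow> ((nat \<times> nat) set \<times> (nat \<times> nat \<Rightarrow> nat)) set" where
  "tableaux_pairs m = (SIGMA l:shapes m. standard_young_tableaux (double_rows l))"

lemma tableaux_pairsD:
  assumes "(l, T) \<in> tableaux_pairs m"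
  shows "young_diagram l" "card l = m" "T \<in> standard_young_tableaux (double_rows l)"
    "tableau (double_rows l) T"
  using assms young_diagram_double_rows by (auto simp: tableaux_pairs_def shapes_def tableau_def)

lemma finite_tableaux_pairs: "finite (tableaux_pairs m)"
  unfolding tableaux_pairs_def
  by (rule finite_SigmaI[OF finite_shapes]) (auto simp: shapes_def intro!: finite_syt card_double_rows)

lemma card_tableaux_pairs: "card (tableaux_pairs m) = sum_SYT_double m"
  unfolding tableaux_pairs_def sum_SYT_double_def num_SYT_def
  by (rule card_SigmaI[OF finite_shapes]) (auto simp: shapes_def intro!: finite_syt card_double_rows)

lemma inj_double_rows:
  assumes "young_diagram l" "young_diagram l'" "double_rows l = double_rows l'"
  shows "l = l'"
proof -
  have "(i, j) \<in> l \<longleftrightarrow> (i, 2 * j) \<in> double_rows l" if "young_diagram l" for l i j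
    using mem_double_rows[OF that] young_diagram_pos[OF that] by auto
  then have "(i, j) \<in> l \<longleftrightarrow> (i, j) \<in> l'" for i j using assms by metis
  then show ?thesis by auto
qed

definition eigenvector :: "nat \<Rightarrow> nat \<Rightarrow> (nat \<times> nat) set \<times> (nat \<times> nat \<Rightarrow> nat) \<Rightarrow> nat set set \<Rightarrow> real" where
  "eigenvector n m y = (SOME v. tableau_vector n m (f_content (real n) (fst y)) (double_rows (fst y)) (snd y) v)"

lemma eigenvector:
  assumes n: "1 \<le> n" and y: "(l, T) \<in> tableaux_pairs m"
  shows "tableau_vector n m (f_content (real n) l) (double_rows l) T (eigenvector n m (l, T))"
proof -
  have "\<exists>v. tableau_vector n m (f_content (real n) l) (double_rows l) T v"
    using exists_tableau_vector[OF tableaux_pairsD(1)[OF y] n tableaux_pairsD(3)[OF y]]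
    unfolding tableaux_pairsD(2)[OF y] .
  then show ?thesis unfolding eigenvector_def fst_conv snd_conv by (rule someI_ex)
qed

lemma jm_sum:
  assumes "finite Y"
  shows "jm k (\<lambda>q. \<Sum>y\<in>Y. a y * v y q) q = (\<Sum>y\<in>Y. a y * jm k (v y) q)"
  unfolding jm_def sum_distrib_left by (rule sum.swap)

lemma eigenvectors_independent:
  assumes n: "1 \<le> n" and zero: "\<And>q. q \<in> pairings {1..2 * m} \<Longrightarrow> (\<Sum>y\<in>tableaux_pairs m. a y * eigenvector n m y q) = 0"
  shows "\<forall>y\<in>tableaux_pairs m. a y = 0"
proof (rule joint_eigenvectors_independent[where L = jm and I = "{1..2 * m}" and v = "eigenvector n m"
      and c = "\<lambda>y. label_content (double_rows (fst y)) (snd y)"])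
  have tv: "tableau_vector n m (f_content (real n) (fst y)) (double_rows (fst y)) (snd y) (eigenvector n m y)"
    if "y \<in> tableaux_pairs m" for y
    using eigenvector[OF n, of "fst y" "snd y" m] that by simp
  show "finite (tableaux_pairs m)" by (rule finite_tableaux_pairs)
  show "jm k (\<lambda>q. \<Sum>y\<in>Y. a y * eigenvector n m y q) q = (\<Sum>y\<in>Y. a y * jm k (eigenvector n m y) q)"
    if "finite Y" for k Y a q using that by (rule jm_sum)
  show "jm k (eigenvector n m y) q = label_content (double_rows (fst y)) (snd y) k * eigenvector n m y q"
    if "y \<in> tableaux_pairs m" "k \<in> {1..2 * m}" for y k q
    using tv[OF that(1)] that(2) unfolding tableau_vector_def by blast
  show "\<exists>q. eigenvector n m y q \<noteq> 0" if "y \<in> tableaux_pairs m" for y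
    using tv[OF that] unfolding tableau_vector_def by blast
  show "(\<Sum>y\<in>tableaux_pairs m. a y * eigenvector n m y q) = 0" for q
  proof (cases "q \<in> pairings {1..2 * m}")
    case False
    then have "eigenvector n m y q = 0" if "y \<in> tableaux_pairs m" for y
      using tv[OF that] unfolding tableau_vector_def by blast
    then show ?thesis by simp
  qed (rule zero)
  show "\<exists>k\<in>{1..2 * m}. label_content (double_rows (fst y)) (snd y) k \<noteq> label_content (double_rows (fst z)) (snd z) k"
    if yz: "y \<in> tableaux_pairs m" "z \<in> tableaux_pairs m" "y \<noteq> z" for y z
  proof (rule ccontr)
    assume neg: "\<not> ?thesis"
    obtain l T where y: "y = (l, T)" by fastforce
    obtain l' T' where z: "z = (l', T')" by fastforce
    note Y = tableaux_pairsD[OF yz(1)[unfolded y]] and Z = tableaux_pairsD[OF yz(2)[unfolded z]]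
    have card: "card (double_rows l) = 2 * m" "card (double_rows l') = 2 * m"
      using card_double_rows(2)[OF Y(1)] card_double_rows(2)[OF Z(1)] Y(2) Z(2) by auto
    have "double_rows l = double_rows l' \<and> T = T'"
      by (rule tableau_eq_if_contents_eq[OF Y(4) Z(4)]) (use neg card y z in auto)
    then show False using inj_double_rows[OF Y(1) Z(1)] yz(3) y z by simp
  qed
qed

section \<open>The eigenbasis on all matchings\<close>

definition relabelling :: "nat set \<Rightarrow> nat \<Rightarrow> nat" where
  "relabelling A = (SOME h. bij_betw h A {1..card A})"

lemma relabelling: "finite A \<Longrightarrow> bij_betw (relabelling A) A {1..card A}"
  unfolding relabelling_def by (rule someI_ex[OF finite_same_card_bij]) simp_all

definition global_index :: "nat \<Rightarrow> (nat set \<times> (nat \<times> nat) set \<times> (nat \<times> nat \<Rightarrow> nat)) set" where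
  "global_index k = (SIGMA A:{A. A \<subseteq> {1..k} \<and> even (card A)}. tableaux_pairs (card A div 2))"

text \<open>
  The eigenvectors on the pairings of \<open>A\<close>, transported along an arbitrary numbering of \<open>A\<close> and extended
  by \<open>0\<close> to the matchings with another support.
\<close>

definition global_vector :: "nat \<Rightarrow> nat set \<times> (nat \<times> nat) set \<times> (nat \<times> nat \<Rightarrow> nat) \<Rightarrow> nat set set \<Rightarrow> real" where
  "global_vector n y M = (if \<Union>M = fst y
     then eigenvector n (card (fst y) div 2) (snd y) (relabel (relabelling (fst y)) M) else 0)"

lemma pairings_relabelling:
  assumes A: "finite A" "even (card A)"
  shows "bij_betw (relabel (relabelling A)) (pairings A) (pairings {1..2 * (card A div 2)})"
proof -
  define h where "h = relabelling A"
  have h: "bij_betw h A {1..2 * (card A div 2)}" using relabelling[OF A(1)] A(2) by (simp add: h_def)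
  have hi: "bij_betw (inv_into A h) {1..2 * (card A div 2)} A" using bij_betw_inv_into[OF h] .
  have "bij_betw (relabel h) (pairings A) (pairings {1..2 * (card A div 2)})"
  proof (rule bij_betw_byWitness[where f' = "relabel (inv_into A h)"])
    show "\<forall>q\<in>pairings A. relabel (inv_into A h) (relabel h q) = q"
      using relabel_inverse[OF h] by (auto simp: pairings_def)
    show "\<forall>q\<in>pairings {1..2 * (card A div 2)}. relabel h (relabel (inv_into A h) q) = q"
    proof
      fix q assume q: "q \<in> pairings {1..2 * (card A div 2)}"
      have "relabel h (relabel (inv_into A h) q) = relabel (\<lambda>x. x) q"
        unfolding relabel_relabel
      proof (rule relabel_cong)
        fix x assume x: "x \<in> \<Union>q"
        have "\<Union>q = h ` A" using q h by (simp add: pairings_def bij_betw_def)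
        then have "x \<in> h ` A" using x by blast
        then show "h (inv_into A h x) = x" by (rule f_inv_into_f)
      qed
      then show "relabel h (relabel (inv_into A h) q) = q" by simp
    qed
    show "relabel h ` pairings A \<subseteq> pairings {1..2 * (card A div 2)}" using pairings_relabel[OF h] by auto
    show "relabel (inv_into A h) ` pairings {1..2 * (card A div 2)} \<subseteq> pairings A"
      using pairings_relabel[OF hi] by auto
  qed
  then show ?thesis by (simp add: h_def)
qed

text \<open>
  The pairings of \<open>A\<close> are as numerous as the eigenvectors with support \<open>A\<close>. This gives both the number
  of all eigenvectors and the total exponent of \<open>n\<close>.
\<close>

lemma sum_matchings_by_support:
  fixes F :: "nat set \<Rightarrow> nat"
  shows "(\<Sum>M\<in>matchings {1..k}. F (\<Union>M)) =
    (\<Sum>A\<in>{A. A \<subseteq> {1..k} \<and> even (card A)}. card (tableaux_pairs (card A div 2)) * F A)"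
proof -
  let ?I = "{A. A \<subseteq> {1..k} \<and> even (card A)}"
  have eq: "matchings {1..k} = (\<Union>A\<in>?I. pairings A)"
  proof
    show "matchings {1..k} \<subseteq> (\<Union>A\<in>?I. pairings A)"
    proof
      fix M assume M: "M \<in> matchings {1..k}"
      have sub: "\<Union>M \<subseteq> {1..k}" using M by (simp add: matchings_def)
      have "even (card (\<Union>M))"
        using card_Union_pairing[OF finite_subset[OF sub] matching_pairings[OF M]] by simp
      then show "M \<in> (\<Union>A\<in>?I. pairings A)" using sub matching_pairings[OF M] by blast
    qed
    show "(\<Union>A\<in>?I. pairings A) \<subseteq> matchings {1..k}" using pairings_matchings by blast
  qed
  have "(\<Sum>M\<in>matchings {1..k}. F (\<Union>M)) = (\<Sum>A\<in>?I. \<Sum>M\<in>pairings A. F (\<Union>M))"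
    unfolding eq
    by (rule sum.UNION_disjoint) (auto simp: pairings_def intro: finite_pairings[unfolded pairings_def] finite_subset)
  also have "\<dots> = (\<Sum>A\<in>?I. card (tableaux_pairs (card A div 2)) * F A)"
  proof (rule sum.cong)
    fix A assume A: "A \<in> ?I"
    then have fin: "finite A" using finite_subset by auto
    have "card (pairings A) = card (tableaux_pairs (card A div 2))"
      using bij_betw_same_card[OF pairings_relabelling[OF fin]] A
      by (simp only: card_pairings card_tableaux_pairs mem_Collect_eq)
    moreover have "(\<Sum>M\<in>pairings A. F (\<Union>M)) = (\<Sum>M\<in>pairings A. F A)"
      by (rule sum.cong) (auto simp: pairings_def)
    ultimately show "(\<Sum>M\<in>pairings A. F (\<Union>M)) = card (tableaux_pairs (card A div 2)) * F A" by simp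
  qed simp
  finally show ?thesis .
qed

lemma finite_global_index: "finite (global_index k)"
  unfolding global_index_def by (rule finite_SigmaI) (auto intro: finite_tableaux_pairs)

lemma card_global_index: "card (global_index k) = card (matchings {1..k})"
  using sum_matchings_by_support[of "\<lambda>_. 1" k]
  unfolding global_index_def by (subst card_SigmaI) (auto intro: finite_tableaux_pairs)

lemma global_eigenvector:
  assumes n: "1 \<le> n" and y: "(A, l, T) \<in> global_index k" and M: "M \<in> matchings {1..k}"
  shows "(\<Sum>N\<in>matchings {1..k}. gram_kernel n {1..k} M N * global_vector n (A, l, T) N) =
    real n ^ (k - card A) * f_content (real n) l * global_vector n (A, l, T) M"
proof -
  define m where "m = card A div 2"
  define h where "h = relabelling A"
  define e where "e = eigenvector n m (l, T)"
  have A: "A \<subseteq> {1..k}" "even (card A)" and lT: "(l, T) \<in> tableaux_pairs m"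
    using y by (auto simp: global_index_def m_def)
  have finA: "finite A" using A finite_subset by auto
  have gv: "global_vector n (A, l, T) N = (if \<Union>N = A then e (relabel h N) else 0)" for N
    by (simp add: global_vector_def e_def h_def m_def)
  have h: "bij_betw h A {1..2 * m}" using relabelling[OF finA] A(2) by (simp add: h_def m_def)
  have hb: "bij_betw (relabel h) (pairings A) (pairings {1..2 * m})"
    unfolding h_def m_def by (rule pairings_relabelling[OF finA A(2)])
  have sub: "{N \<in> matchings {1..k}. \<Union>N = A} = pairings A"
    using A(1) by (auto simp: matchings_def pairings_def)
  have fink: "finite {1..k}" by simp
  have "(\<Sum>N\<in>matchings {1..k}. gram_kernel n {1..k} M N * global_vector n (A, l, T) N) =
      (\<Sum>N\<in>matchings {1..k}. if \<Union>N = A then gram_kernel n {1..k} M N * e (relabel h N) else 0)"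
    by (rule sum.cong) (simp_all add: gv)
  also have "\<dots> = (\<Sum>N\<in>pairings A. gram_kernel n {1..k} M N * e (relabel h N))"
    unfolding sub[symmetric] by (rule sum.inter_filter[symmetric, OF finite_matchings[OF fink]])
  also have "\<dots> = real n ^ (k - card A) * f_content (real n) l * global_vector n (A, l, T) M"
  proof (cases "\<Union>M = A")
    case False
    have "gram_kernel n {1..k} M N = 0" if N: "N \<in> pairings A" for N
    proof -
      have Nm: "N \<in> matchings {1..k}" and UN: "\<Union>N = A"
        using N pairings_matchings[OF A(1)] by (auto simp: pairings_def)
      show ?thesis
      proof (cases "\<Union>M \<subseteq> A")
        case True
        then obtain x where "x \<in> \<Union>N" "x \<notin> \<Union>M" using False UN by blast
        then show ?thesis using gram_kernel_uncovered[OF fink Nm M] gram_kernel_commute by metis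
      next
        case False
        then obtain x where "x \<in> \<Union>M" "x \<notin> \<Union>N" using UN by blast
        then show ?thesis using gram_kernel_uncovered[OF fink M Nm] by blast
      qed
    qed
    then show ?thesis using False by (simp add: gv)
  next
    case True
    have MA: "M \<in> pairings A" using matching_pairings[OF M] True by simp
    have rM: "relabel h M \<in> pairings {1..2 * m}" by (rule pairings_relabel[OF h MA])
    have ker: "gram_kernel n {1..k} M N = real n ^ (k - card A) * gram_kernel n {1..2 * m} (relabel h M) (relabel h N)"
      if N: "N \<in> pairings A" for N
    proof -
      have U: "\<Union>M \<subseteq> A" "\<Union>N \<subseteq> A" using MA N by (auto simp: pairings_def)
      have "gram_kernel n (A \<union> ({1..k} - A)) M N = real n ^ card ({1..k} - A) * gram_kernel n A M N"
        by (rule gram_kernel_extend) (use U in auto)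
      moreover have "A \<union> ({1..k} - A) = {1..k}" using A(1) by auto
      moreover have "card ({1..k} - A) = k - card A" using A(1) finA by (simp add: card_Diff_subset)
      ultimately show ?thesis using gram_kernel_relabel[OF h U] by simp
    qed
    have "(\<Sum>N\<in>pairings A. gram_kernel n {1..k} M N * e (relabel h N)) =
        real n ^ (k - card A) * (\<Sum>N\<in>pairings A. gram_kernel n {1..2 * m} (relabel h M) (relabel h N) * e (relabel h N))"
      unfolding sum_distrib_left by (rule sum.cong) (simp_all only: ker mult.assoc)
    also have "(\<Sum>N\<in>pairings A. gram_kernel n {1..2 * m} (relabel h M) (relabel h N) * e (relabel h N)) =
        (\<Sum>q\<in>pairings {1..2 * m}. gram_kernel n {1..2 * m} (relabel h M) q * e q)"
      by (rule sum.reindex_bij_betw[OF hb])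
    also have "\<dots> = gram_op n {1..2 * m} e (relabel h M)"
      unfolding gram_op_def using rM by (simp only: if_True)
    also have "\<dots> = f_content (real n) l * e (relabel h M)"
      using eigenvector[OF n lT] unfolding tableau_vector_def e_def by blast
    finally show ?thesis using True by (simp add: gv)
  qed
  finally show ?thesis .
qed

text \<open>
  Vectors with different supports never interfere, so a relation may be evaluated on the pairings of
  one set \<open>A\<close> at a time.
\<close>

lemma global_vectors_independent:
  assumes n: "1 \<le> n"
    and zero: "\<And>M. M \<in> matchings {1..k} \<Longrightarrow> (\<Sum>y\<in>global_index k. a y * global_vector n y M) = 0"
  shows "\<forall>y\<in>global_index k. a y = 0"
proof
  fix y0 assume y0: "y0 \<in> global_index k"
  obtain A z0 where y0_eq: "y0 = (A, z0)" by (cases y0)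
  define m where "m = card A div 2"
  have A: "A \<subseteq> {1..k}" "even (card A)" and z0: "z0 \<in> tableaux_pairs m"
    using y0 y0_eq by (auto simp: global_index_def m_def)
  have finA: "finite A" using A finite_subset by auto
  have hb: "bij_betw (relabel (relabelling A)) (pairings A) (pairings {1..2 * m})"
    unfolding m_def by (rule pairings_relabelling[OF finA A(2)])
  have "(\<Sum>z\<in>tableaux_pairs m. a (A, z) * eigenvector n m z q) = 0" if q: "q \<in> pairings {1..2 * m}" for q
  proof -
    obtain M where M: "M \<in> pairings A" "q = relabel (relabelling A) M"
      using q hb by (auto simp: bij_betw_def)
    have UM: "\<Union>M = A" using M by (simp add: pairings_def)
    have "0 = (\<Sum>y\<in>global_index k. a y * global_vector n y M)"
      using zero[of M] M pairings_matchings[OF A(1)] by auto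
    also have "\<dots> = (\<Sum>y\<in>Pair A ` tableaux_pairs m. a y * global_vector n y M)"
      by (rule sum.mono_neutral_right[OF finite_global_index])
        (use A UM in \<open>auto simp: global_index_def m_def global_vector_def image_iff\<close>)
    also have "\<dots> = (\<Sum>z\<in>tableaux_pairs m. a (A, z) * eigenvector n m z q)"
      by (subst sum.reindex) (auto simp: inj_on_def global_vector_def UM M m_def)
    finally show ?thesis by simp
  qed
  from eigenvectors_independent[OF n this] show "a y0 = 0" using z0 y0_eq by blast
qed

section \<open>The determinant\<close>

lemma prod_global_eigenvalues:
  "(\<Prod>(A, l, T)\<in>global_index k. real n ^ (k - card A) * f_content (real n) l) =
   real n ^ a_exp k * (\<Prod>l\<in>{l. young_diagram l \<and> 2 * card l \<le> k}.
       f_content (real n) l ^ ((k choose (2 * card l)) * num_SYT (double_rows l)))"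
proof -
  let ?I = "{A. A \<subseteq> {1..k} \<and> even (card A)}"
  let ?L = "{l. young_diagram l \<and> 2 * card l \<le> k}"
  have powers: "(\<Prod>(A, l, T)\<in>global_index k. real n ^ (k - card A)) = real n ^ a_exp k"
  proof -
    have "(\<Prod>(A, l, T)\<in>global_index k. real n ^ (k - card A)) = real n ^ (\<Sum>(A, z)\<in>global_index k. k - card A)"
      by (simp add: power_sum case_prod_unfold)
    also have "(\<Sum>(A, z)\<in>global_index k. k - card A) = (\<Sum>A\<in>?I. \<Sum>z\<in>tableaux_pairs (card A div 2). k - card A)"
      unfolding global_index_def by (rule sum.Sigma[symmetric]) (auto intro: finite_tableaux_pairs)
    also have "\<dots> = (\<Sum>M\<in>matchings {1..k}. k - card (\<Union>M))"
      using sum_matchings_by_support[of "\<lambda>A. k - card A" k] by simp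
    also have "\<dots> = (\<Sum>\<pi>\<in>P_b k. k - card (\<Union>(two_blocks \<pi>)))"
      by (rule sum.reindex_bij_betw[OF two_blocks_bij, symmetric])
    also have "\<dots> = a_exp k"
      unfolding a_exp_def by (rule sum.cong) (simp_all add: card_P_b_two_blocks)
    finally show ?thesis .
  qed
  have "(\<Prod>(A, l, T)\<in>global_index k. f_content (real n) l) =
      (\<Prod>A\<in>?I. \<Prod>(l, T)\<in>tableaux_pairs (card A div 2). f_content (real n) l)"
    unfolding global_index_def by (rule prod.Sigma[symmetric]) (auto intro: finite_tableaux_pairs)
  also have "\<dots> = (\<Prod>A\<in>?I. \<Prod>l\<in>shapes (card A div 2). f_content (real n) l ^ num_SYT (double_rows l))"
  proof (rule prod.cong)
    fix A
    have "(\<Prod>(l, T)\<in>tableaux_pairs (card A div 2). f_content (real n) l) =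
      (\<Prod>l\<in>shapes (card A div 2). \<Prod>T\<in>standard_young_tableaux (double_rows l). f_content (real n) l)"
      unfolding tableaux_pairs_def
      by (rule prod.Sigma[symmetric, OF finite_shapes]) (auto simp: shapes_def intro!: finite_syt card_double_rows)
    then show "(\<Prod>(l, T)\<in>tableaux_pairs (card A div 2). f_content (real n) l) =
      (\<Prod>l\<in>shapes (card A div 2). f_content (real n) l ^ num_SYT (double_rows l))"
      by (simp add: num_SYT_def)
  qed simp
  also have "\<dots> = (\<Prod>(A, l)\<in>(SIGMA A:?I. shapes (card A div 2)). f_content (real n) l ^ num_SYT (double_rows l))"
    by (rule prod.Sigma) (auto intro: finite_shapes)
  also have "\<dots> = (\<Prod>(l, A)\<in>(SIGMA l:?L. {A. A \<subseteq> {1..k} \<and> card A = 2 * card l}). f_content (real n) l ^ num_SYT (double_rows l))"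
  proof (rule prod.reindex_bij_witness[of _ "\<lambda>(l, A). (A, l)" "\<lambda>(A, l). (l, A)"])
    fix x assume "x \<in> (SIGMA A:?I. shapes (card A div 2))"
    then obtain A l where x: "x = (A, l)" "A \<subseteq> {1..k}" "even (card A)" "young_diagram l" "card l = card A div 2"
      by (auto simp: shapes_def)
    then have c: "card A = 2 * card l" by simp
    have "card A \<le> k" using card_mono[OF _ x(2)] by simp
    then show "(case x of (A, l) \<Rightarrow> (l, A)) \<in> (SIGMA l:?L. {A. A \<subseteq> {1..k} \<and> card A = 2 * card l})"
      using x(1,2,4) c by simp
  qed (auto simp: shapes_def)
  also have "\<dots> = (\<Prod>l\<in>?L. \<Prod>A\<in>{A. A \<subseteq> {1..k} \<and> card A = 2 * card l}. f_content (real n) l ^ num_SYT (double_rows l))"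
    by (rule prod.Sigma[symmetric, OF finite_young_diagrams]) auto
  also have "\<dots> = (\<Prod>l\<in>?L. f_content (real n) l ^ ((k choose (2 * card l)) * num_SYT (double_rows l)))"
  proof (rule prod.cong)
    fix l :: "(nat \<times> nat) set"
    have "card {A. A \<subseteq> {1..k} \<and> card A = 2 * card l} = k choose (2 * card l)"
      using n_subsets[of "{1..k}"] by simp
    then show "(\<Prod>A\<in>{A. A \<subseteq> {1..k} \<and> card A = 2 * card l}. f_content (real n) l ^ num_SYT (double_rows l)) =
        f_content (real n) l ^ ((k choose (2 * card l)) * num_SYT (double_rows l))"
      by (simp add: power_mult mult.commute flip: power_mult)
  qed simp
  finally show ?thesis using powers
    by (simp add: prod.distrib case_prod_unfold)
qed

lemma det_gram_mat_real:
  assumes n: "1 \<le> n" and \<pi>s: "distinct \<pi>s" "set \<pi>s = P_b k"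
  shows "det (gram_mat k \<pi>s (real n)) = real n ^ a_exp k *
    (\<Prod>l\<in>{l. young_diagram l \<and> 2 * card l \<le> k}.
       f_content (real n) l ^ ((k choose (2 * card l)) * num_SYT (double_rows l)))"
proof -
  define Ms where "Ms = map two_blocks \<pi>s"
  define L where "L = length \<pi>s"
  have lenM: "length Ms = L" by (simp add: Ms_def L_def)
  have inj: "inj_on two_blocks (P_b k)" and im: "two_blocks ` P_b k = matchings {1..k}"
    using two_blocks_bij[of k] by (auto simp: bij_betw_def)
  have Ms: "distinct Ms" "set Ms = matchings {1..k}"
    using \<pi>s inj im by (auto simp: Ms_def distinct_map)
  have bM: "bij_betw (\<lambda>i. Ms ! i) {0..<L} (matchings {1..k})"
    using bij_betw_nth[OF Ms(1), of "{0..<L}"] Ms(2) lenM by (simp add: atLeast0LessThan)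
  have Min: "Ms ! i \<in> matchings {1..k}" if "i < L" for i using that Ms(2) lenM nth_mem by metis
  have \<pi>in: "\<pi>s ! i \<in> P_b k" if "i < L" for i using that \<pi>s(2) L_def nth_mem by metis
  define E where "E = (\<lambda>M N :: nat set set. \<Sum>f\<in>{1..k} \<rightarrow>\<^sub>E {..<n}. delta_weight M f * delta_weight N f)"
  define G where "G = mat L L (\<lambda>(i, j). E (Ms ! i) (Ms ! j))"
  define S where "S = mat L L (\<lambda>(i, j). split_coeff n (Ms ! i) (Ms ! j))"
  define H where "H = mat L L (\<lambda>(i, j). gram_kernel n {1..k} (Ms ! i) (Ms ! j))"
  have carr: "G \<in> carrier_mat L L" "S \<in> carrier_mat L L" "S\<^sup>T \<in> carrier_mat L L" "H \<in> carrier_mat L L"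
    by (simp_all add: G_def S_def H_def)
  have gram: "gram_mat k \<pi>s (real n) = G"
    unfolding gram_mat_def G_def L_def[symmetric]
  proof (rule eq_matI, goal_cases)
    case (1 i j)
    then have "i < L" "j < L" by auto
    then show ?case using power_card_join[OF \<pi>in \<pi>in, of i j n]
      by (simp add: E_def Ms_def L_def)
  qed auto
  have detS: "det S = 1"
    unfolding S_def
  proof (rule det_unitriangular[where r = "\<lambda>i. card (Ms ! i)"])
    fix i j assume ij: "i < L" "j < L" "i \<noteq> j" and nz: "split_coeff n (Ms ! i) (Ms ! j) \<noteq> 0"
    have "Ms ! j \<subseteq> Ms ! i" using nz by (simp add: split_coeff_def split: if_splits)
    moreover have "Ms ! i \<noteq> Ms ! j" using nth_eq_iff_index_eq[OF Ms(1)] ij lenM by simp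
    moreover have "finite (Ms ! i)" using finite_matching[OF _ Min[OF ij(1)]] by simp
    ultimately show "card (Ms ! j) < card (Ms ! i)" by (intro psubset_card_mono) auto
  qed (simp add: split_coeff_def)
  have "H = S * (G * S\<^sup>T)"
  proof (rule eq_matI)
    fix i j assume "i < dim_row (S * (G * S\<^sup>T))" "j < dim_col (S * (G * S\<^sup>T))"
    then have ij: "i < L" "j < L" using carr by auto
    have "(S * (G * S\<^sup>T)) $$ (i, j) = (\<Sum>x\<in>{0..<L}. \<Sum>y\<in>{0..<L}.
        split_coeff n (Ms ! i) (Ms ! x) * E (Ms ! x) (Ms ! y) * split_coeff n (Ms ! j) (Ms ! y))"
      using ij by (simp add: S_def G_def scalar_prod_def sum_distrib_left mult.assoc)
    also have "\<dots> = (\<Sum>x\<in>{0..<L}. \<Sum>N\<in>matchings {1..k}.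
        split_coeff n (Ms ! i) (Ms ! x) * E (Ms ! x) N * split_coeff n (Ms ! j) N)"
      by (intro sum.cong refl sum.reindex_bij_betw[OF bM])
    also have "\<dots> = (\<Sum>M\<in>matchings {1..k}. \<Sum>N\<in>matchings {1..k}.
        split_coeff n (Ms ! i) M * E M N * split_coeff n (Ms ! j) N)"
      by (rule sum.reindex_bij_betw[OF bM])
    also have "\<dots> = gram_kernel n {1..k} (Ms ! i) (Ms ! j)"
      unfolding E_def by (rule gram_kernel_split[symmetric]) (use Min ij in auto)
    finally show "H $$ (i, j) = (S * (G * S\<^sup>T)) $$ (i, j)" using ij by (simp add: H_def)
  qed (simp_all add: H_def S_def)
  then have "det H = det S * (det G * det (S\<^sup>T))"
    using det_mult[OF carr(2) mult_carrier_mat[OF carr(1,3)]] det_mult[OF carr(1,3)] by simp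
  then have "det G = det H" using detS det_transpose[OF carr(2)] by simp
  also have "det H = (\<Prod>(A, l, T)\<in>global_index k. real n ^ (k - card A) * f_content (real n) l)"
    unfolding H_def lenM[symmetric]
  proof (rule det_eigenbasis[OF Ms(1), of "global_index k" _ "global_vector n"])
    show "finite (global_index k)" by (rule finite_global_index)
    show "card (global_index k) = length Ms"
      using card_global_index distinct_card[OF Ms(1)] Ms(2) by simp
    fix y M assume "y \<in> global_index k" "M \<in> set Ms"
    then show "(\<Sum>N\<in>set Ms. gram_kernel n {1..k} M N * global_vector n y N) =
        (case y of (A, l, T) \<Rightarrow> real n ^ (k - card A) * f_content (real n) l) * global_vector n y M"
      unfolding Ms(2) using global_eigenvector[OF n, of _ _ _ k M] by (cases y) auto
  next
    fix a assume "\<And>M. M \<in> set Ms \<Longrightarrow> (\<Sum>y\<in>global_index k. a y * global_vector n y M) = 0"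
    then show "\<forall>y\<in>global_index k. a y = 0"
      unfolding Ms(2) by (rule global_vectors_independent[OF n])
  qed
  finally show ?thesis unfolding gram prod_global_eigenvalues .
qed

lemma int_poly_eqI_nat:
  fixes p q :: "int poly"
  assumes "\<And>n. 1 \<le> n \<Longrightarrow> poly p (int n) = poly q (int n)"
  shows "p = q"
proof (rule ccontr)
  assume "p \<noteq> q"
  then have "finite {x. poly (p - q) x = 0}" by (intro poly_roots_finite) simp
  moreover have "int ` {1..} \<subseteq> {x. poly (p - q) x = 0}" using assms by auto
  ultimately have "finite (int ` {1..})" using finite_subset by blast
  then show False using finite_imageD[of int "{1..}"] by (simp add: infinite_Ici)
qed

theorem theorem4p2:
  fixes k :: nat and n :: "int poly" and \<pi>s :: "nat set set list"
  assumes n: "n = [:0, 1:]"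
    and \<pi>s: "distinct \<pi>s" "set \<pi>s = P_b k"
  shows "det (gram_mat k \<pi>s n) =
    n ^ a_exp k *
    (\<Prod>l\<in>{l. young_diagram l \<and> 2 * card l \<le> k}.
       f_content n l ^ ((k choose (2 * card l)) * num_SYT (double_rows l)))"
proof (rule int_poly_eqI_nat)
  fix N :: nat assume N: "1 \<le> N"
  define ev where "ev = (\<lambda>p :: int poly. real_of_int (poly p (int N)))"
  interpret ev: comm_ring_hom ev
    by unfold_locales (simp_all add: ev_def)
  have evn: "ev n = real N" by (simp add: ev_def n)
  have "ev (det (gram_mat k \<pi>s n)) = det (map_mat ev (gram_mat k \<pi>s n))"
    by simp
  also have "map_mat ev (gram_mat k \<pi>s n) = gram_mat k \<pi>s (real N)"
    by (rule eq_matI) (auto simp: gram_mat_def ev.hom_power evn)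
  also have "det (gram_mat k \<pi>s (real N)) = real N ^ a_exp k *
    (\<Prod>l\<in>{l. young_diagram l \<and> 2 * card l \<le> k}.
       f_content (real N) l ^ ((k choose (2 * card l)) * num_SYT (double_rows l)))"
    by (rule det_gram_mat_real[OF N \<pi>s])
  also have "\<dots> = ev (n ^ a_exp k *
    (\<Prod>l\<in>{l. young_diagram l \<and> 2 * card l \<le> k}.
       f_content n l ^ ((k choose (2 * card l)) * num_SYT (double_rows l))))"
  proof -
    have "ev (f_content n l) = f_content (real N) l" for l
      unfolding f_content_def by (simp add: ev_def n poly_prod case_prod_unfold)
    then show ?thesis by (simp add: ev.hom_mult ev.hom_power ev.hom_prod evn)
  qed
  finally show "poly (det (gram_mat k \<pi>s n)) (int N) = poly (n ^ a_exp k *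
    (\<Prod>l\<in>{l. young_diagram l \<and> 2 * card l \<le> k}.
       f_content n l ^ ((k choose (2 * card l)) * num_SYT (double_rows l)))) (int N)"
    by (simp only: ev_def of_int_eq_iff)
qed

end
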